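(* Let $S^5=\{x\in\mathbb{R}^6:\sum_{i=1}^6x_i^2=1\}$ be endowed with the standard Sasaki-Einstein $SU(2)$-structure $(\eta,\omega_1,\omega_2,\omega_3)$, with metric $g_5$, given by the restriction to $S^5$ of $$\begin{aligned} \eta={}&x_6dx_1-x_1dx_6+x_2dx_5-x_5dx_2+x_3dx_4-x_4dx_3,\\ \omega_1={}&x_3dx_{12}-x_2dx_{13}+x_1dx_{23}+x_5dx_{14}-x_4dx_{15}+x_1dx_{45}\\&+x_6dx_{24}-x_4dx_{26}+x_2dx_{46}+x_5dx_{36}-x_6dx_{35}-x_3dx_{56},\\ \omega_2={}&-x_4dx_{12}+x_5dx_{13}+x_2dx_{14}-x_3dx_{15}+x_6dx_{23}-x_1dx_{24}\\&-x_3dx_{26}+x_1dx_{35}+x_2dx_{36}+x_6dx_{45}-x_5dx_{46}+x_4dx_{56},\\ \omega_3={}&dx_{16}-dx_{34}-dx_{25}. \end{aligned}$$ Then: (i) The $SU(3)$-structure on $S^5\times[0,\pi]$ (coordinate $t$) defined by $$\begin{aligned}F&=\sin^2t\,(\sin t\,\omega_1+\cos t\,\omega_3)+\sin t\,\eta\wedge dt,\\ \Psi_+&=\sin^3t\,\eta\wedge\omega_2-\sin^2t\,(-\cos t\,\omega_1+\sin t\,\omega_3)\wedge dt,\\ \Psi_-&=\sin^3t\,(-\cos t\,\omega_1+\sin t\,\omega_3)\wedge\eta+\sin^2t\,\omega_2\wedge dt\end{aligned}$$ is a nearly Kähler structure generating the round metric on the $6$-sphere, $g_6=dt^2+\sin^2t\,g_5$,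 with two conical singularities at $t=0$, $t=\pi$. (ii) The $G_2$-structure on $(S^5\times[0,\pi])\times[0,\pi]$ (with $q$ the last coordinate) defined by $$\phi=\sin^2q\,F\wedge dq-\sin^3q\,(-\cos q\,\Psi_++\sin q\,\Psi_-)$$ is a nearly parallel $G_2$-structure generating the round metric on the $7$-sphere, $g_7=dq^2+\sin^2q\,(dt^2+\sin^2t\,g_5)$, with singularities at $t=0$, $t=\pi$, $q=0$, $q=\pi$.
   Context: Notation: $dx_{ij}=dx_i\wedge dx_j$. An $SU(2)$-structure on a $5$-manifold is a quadruplet $(\eta,\omega_1,\omega_2,\omega_3)$ of a $1$-form and three $2$-forms for which locally there is a coframe with $\eta=e^5$, $\omega_1=e^{12}+e^{34}$, $\omega_2=e^{13}+e^{42}$, $\omega_3=e^{14}+e^{23}$; its metric makes the coframe orthonormal. It is Sasaki-Einstein if $d\eta=-2\omega_3$, $d\omega_1=3\eta\wedge\omega_2$, $d\omega_2=-3\eta\wedge\omega_1$. An $SU(3)$-structure $(F,\Psi_+,\Psi_-)$ (locally $F=e^{12}+e^{34}+e^{56}$, $\Psi_++i\Psi_-=(e^1+ie^2)\wedge(e^3+ie^4)\wedge(e^5+ie^6)$, coframe orthonormal for its metric) is nearly Kähler if $dF=3\Psi_+$, $d\Psi_-=-2F\wedge F$. A $G_2$-structure is a $3$-form $\phi$ on a $7$-manifold locally of the form $\phi=F\wedge e^7-\Psi_-$ with $F=e^{12}+e^{34}+e^{56}$ and $\Psi_++i\Psi_-=(e^1+ie^2)\wedge(e^3+ie^4)\wedge(e^5+ie^6)$;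 $e^1,\dots,e^7$ is an oriented orthonormal coframe for its metric, and $*\phi=\frac12F\wedge F+\Psi_+\wedge e^7$. It is nearly parallel if $d\phi=4*\phi$. The structures are smooth and satisfy the stated equations for $t\in(0,\pi)$ and $q\in(0,\pi)$; "singularities" refers to the values of $t,q$ where the forms degenerate and the metric takes (to leading order) the cone form $ds^2+s^2g$ with $s$ the distance parameter to the end. *)

theory Defs
  imports "HOL-Analysis.Analysis" "HOL-Library.Function_Algebras"
begin

text \<open>
  Manifolds are embedded submanifolds of a Euclidean space, given as subsets of it.
  A differential form sends a base point and a list of tangent vectors to a real number; a
  \<open>k\<close>-form vanishes on lists whose length is not \<open>k\<close>, so the degree need not be an argument of
  the operations below. Forms and metrics on a submanifold are represented by functions on the
  ambient space, of which only the values on tangent vectors of the submanifold matter; thus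
  restriction to the submanifold is not written. Addition and subtraction of forms are the
  pointwise operations of \<^theory>\<open>HOL-Library.Function_Algebras\<close>.
\<close>

section \<open>Smooth functions and tangent spaces\<close>

primrec Ck_on :: "nat \<Rightarrow> 'a::euclidean_space set \<Rightarrow> ('a \<Rightarrow> 'b::euclidean_space) \<Rightarrow> bool" where
  "Ck_on 0 U f \<longleftrightarrow> continuous_on U f"
| "Ck_on (Suc n) U f \<longleftrightarrow>
     f differentiable_on U \<and> (\<forall>v. Ck_on n U (\<lambda>x. frechet_derivative f (at x) v))"

text \<open>Meant for open \<open>U\<close> only.\<close>

definition smooth_on :: "'a::euclidean_space set \<Rightarrow> ('a \<Rightarrow> 'b::euclidean_space) \<Rightarrow> bool" where
  "smooth_on U f \<longleftrightarrow> (\<forall>n. Ck_on n U f)"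

definition tangent_space :: "'a::euclidean_space set \<Rightarrow> 'a \<Rightarrow> 'a set" where
  "tangent_space N x = {v. \<exists>c \<epsilon>. \<epsilon> > 0 \<and> c 0 = x \<and> (\<forall>s. \<bar>s\<bar> < \<epsilon> \<longrightarrow> c s \<in> N) \<and>
     (c has_vector_derivative v) (at (0::real))}"


section \<open>Differential forms\<close>

type_synonym 'a form = "'a \<Rightarrow> 'a list \<Rightarrow> real"

definition scale_form :: "('a \<Rightarrow> real) \<Rightarrow> 'a form \<Rightarrow> 'a form" (infixr \<open>*\<^sub>f\<close> 75) where
  "f *\<^sub>f \<alpha> = (\<lambda>x vs. f x * \<alpha> x vs)"

text \<open>
  The wedge product as a sum over shuffles: \<open>I\<close> is the set of positions of the arguments given to
  \<open>\<alpha>\<close>, and the exponent is the number of inversions of the shuffle. On \<open>1\<close>-forms this gives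
  \<open>\<alpha>(v) \<beta>(w) - \<alpha>(w) \<beta>(v)\<close>.
\<close>

definition wedge :: "'a form \<Rightarrow> 'a form \<Rightarrow> 'a form" (infixl \<open>\<and>\<^sub>f\<close> 70) where
  "\<alpha> \<and>\<^sub>f \<beta> = (\<lambda>x vs. \<Sum>I\<in>Pow {..<length vs}.
     (- 1) ^ card {(i, j). i \<in> I \<and> j \<in> {..<length vs} - I \<and> j < i}
       * \<alpha> x (nths vs I) * \<beta> x (nths vs (- I)))"

definition differential :: "('a::euclidean_space \<Rightarrow> real) \<Rightarrow> 'a form" where
  "differential f = (\<lambda>x vs. case vs of [v] \<Rightarrow> frechet_derivative f (at x) v | _ \<Rightarrow> 0)"

definition pullback :: "('a::euclidean_space \<Rightarrow> 'b::euclidean_space) \<Rightarrow> 'b form \<Rightarrow> 'a form" where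
  "pullback f \<alpha> = (\<lambda>x vs. \<alpha> (f x) (map (frechet_derivative f (at x)) vs))"

definition ext_deriv :: "'a::euclidean_space form \<Rightarrow> 'a form" where
  "ext_deriv \<alpha> = (\<lambda>x vs. \<Sum>i<length vs.
     (- 1) ^ i * frechet_derivative (\<lambda>y. \<alpha> y (take i vs @ drop (Suc i) vs)) (at x) (vs ! i))"

definition alternating_on :: "'a::real_vector set \<Rightarrow> nat \<Rightarrow> ('a list \<Rightarrow> real) \<Rightarrow> bool" where
  "alternating_on V k A \<longleftrightarrow>
     (\<forall>vs. set vs \<subseteq> V \<and> length vs \<noteq> k \<longrightarrow> A vs = 0) \<and>
     (\<forall>vs i. set vs \<subseteq> V \<and> length vs = k \<and> i < k \<longrightarrow>
        (\<forall>u\<in>V. \<forall>w\<in>V. \<forall>a b. A (vs[i := a *\<^sub>R u + b *\<^sub>R w]) = a * A (vs[i := u]) + b * A (vs[i := w]))) \<and>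
     (\<forall>vs i j. set vs \<subseteq> V \<and> length vs = k \<and> i < j \<and> j < k \<and> vs ! i = vs ! j \<longrightarrow> A vs = 0)"

definition form_eq_at :: "'a::euclidean_space set \<Rightarrow> 'a \<Rightarrow> 'a form \<Rightarrow> 'a form \<Rightarrow> bool" where
  "form_eq_at N x \<alpha> \<beta> \<longleftrightarrow> (\<forall>vs. set vs \<subseteq> tangent_space N x \<longrightarrow> \<alpha> x vs = \<beta> x vs)"

text \<open>Smooth \<open>k\<close>-forms on an open subset \<open>U\<close> of the ambient space.\<close>

definition smooth_ambient_form :: "nat \<Rightarrow> 'a::euclidean_space set \<Rightarrow> 'a form \<Rightarrow> bool" where
  "smooth_ambient_form k U \<alpha> \<longleftrightarrow>
     (\<forall>x\<in>U. alternating_on UNIV k (\<alpha> x)) \<and> (\<forall>vs. smooth_on U (\<lambda>x. \<alpha> x vs))"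

text \<open>Smooth \<open>k\<close>-forms on a submanifold: locally, restrictions of ambient smooth forms.\<close>

definition smooth_form :: "nat \<Rightarrow> 'a::euclidean_space set \<Rightarrow> 'a form \<Rightarrow> bool" where
  "smooth_form k N \<alpha> \<longleftrightarrow> (\<forall>x\<in>N. \<exists>U \<gamma>. open U \<and> x \<in> U \<and> smooth_ambient_form k U \<gamma> \<and>
     (\<forall>y\<in>N \<inter> U. form_eq_at N y \<alpha> \<gamma>))"

text \<open>
  \<open>\<alpha>\<close> is a smooth \<open>k\<close>-form on \<open>N\<close> and \<open>d\<alpha> = \<beta>\<close> on \<open>N\<close>. As \<open>d\<close> commutes with restriction to
  submanifolds, \<open>d\<alpha>\<close> is locally the restriction of the exterior derivative of any smooth ambient
  extension of \<open>\<alpha>\<close>.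
\<close>

definition has_ext_deriv :: "nat \<Rightarrow> 'a::euclidean_space set \<Rightarrow> 'a form \<Rightarrow> 'a form \<Rightarrow> bool" where
  "has_ext_deriv k N \<alpha> \<beta> \<longleftrightarrow> (\<forall>x\<in>N. \<exists>U \<gamma>. open U \<and> x \<in> U \<and> smooth_ambient_form k U \<gamma> \<and>
     (\<forall>y\<in>N \<inter> U. form_eq_at N y \<alpha> \<gamma> \<and> form_eq_at N y \<beta> (ext_deriv \<gamma>)))"


section \<open>Metrics\<close>

type_synonym 'a metric = "'a \<Rightarrow> 'a \<Rightarrow> 'a \<Rightarrow> real"

text \<open>The metric induced by the ambient inner product; on unit spheres, the round metric.\<close>

definition induced_metric :: "'a::euclidean_space metric" where
  "induced_metric = (\<lambda>x v w. v \<bullet> w)"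

definition pullback_metric ::
    "('a::euclidean_space \<Rightarrow> 'b::euclidean_space) \<Rightarrow> 'b metric \<Rightarrow> 'a metric" where
  "pullback_metric f g =
     (\<lambda>x v w. g (f x) (frechet_derivative f (at x) v) (frechet_derivative f (at x) w))"

text \<open>\<open>dt\<^sup>2 + sin\<^sup>2 t g\<close>, where \<open>t\<close> is the last coordinate.\<close>

definition sine_cone_metric :: "'a::euclidean_space metric \<Rightarrow> ('a \<times> real) metric" where
  "sine_cone_metric g =
     (\<lambda>p v w. snd v * snd w + (sin (snd p))\<^sup>2 * g (fst p) (fst v) (fst w))"

text \<open>Since \<open>f\<close> is a bijective local isometry, it is a diffeomorphism when \<open>N\<close> and \<open>N'\<close> have the
  same dimension.\<close>

definition isometry_between ::
    "'a::euclidean_space set \<Rightarrow> 'a metric \<Rightarrow> ('a \<Rightarrow> 'b::euclidean_space) \<Rightarrow> 'b set \<Rightarrow> 'b metric \<Rightarrow> bool" where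
  "isometry_between N g f N' g' \<longleftrightarrow>
     (\<exists>U. open U \<and> N \<subseteq> U \<and> smooth_on U f) \<and> bij_betw f N N' \<and>
     (\<forall>x\<in>N. \<forall>v\<in>tangent_space N x. \<forall>w\<in>tangent_space N x. pullback_metric f g' x v w = g x v w)"

text \<open>
  The end \<open>r \<rightarrow> 0\<close> of \<open>N\<close> is conical: to leading order, that is up to an error which is small
  relative to \<open>g\<close>, the metric \<open>g\<close> is \<open>ds\<^sup>2 + s\<^sup>2 h + k\<close> with \<open>s \<rightarrow> 0\<close> at the end. Here \<open>h\<close> is the metric
  of the link and \<open>k\<close> is the metric in the directions along the singular set, \<open>0\<close> when the cone
  form is \<open>ds\<^sup>2 + s\<^sup>2 h\<close> in all directions.
\<close>

definition conical_end ::
    "'a::euclidean_space set \<Rightarrow> ('a \<Rightarrow> real) \<Rightarrow> 'a metric \<Rightarrow> ('a \<Rightarrow> real) \<Rightarrow> 'a metric \<Rightarrow> 'a metric \<Rightarrow> bool" where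
  "conical_end N r g s h k \<longleftrightarrow> (\<forall>p\<in>N. 0 < s p) \<and>
     (\<forall>\<epsilon>>0. \<exists>\<delta>>0. \<forall>p\<in>N. r p < \<delta> \<longrightarrow> s p < \<epsilon> \<and>
        (\<forall>v\<in>tangent_space N p.
           \<bar>g p v v - ((frechet_derivative s (at p) v)\<^sup>2 + (s p)\<^sup>2 * h p v v + k p v v)\<bar> \<le> \<epsilon> * g p v v))"


section \<open>Coframes and G-structures\<close>

text \<open>\<open>e 1, \<dots>, e n\<close> is a basis of the dual of the tangent space at \<open>x\<close>.\<close>

definition coframe_at :: "'a::euclidean_space set \<Rightarrow> 'a \<Rightarrow> nat \<Rightarrow> (nat \<Rightarrow> 'a form) \<Rightarrow> bool" where
  "coframe_at N x n e \<longleftrightarrow>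
     subspace (tangent_space N x) \<and> dim (tangent_space N x) = n \<and>
     (\<forall>i\<in>{1..n}. alternating_on (tangent_space N x) 1 (e i x)) \<and>
     (\<forall>v\<in>tangent_space N x. (\<forall>i\<in>{1..n}. e i x [v] = 0) \<longrightarrow> v = 0)"

definition orthonormal_coframe_at ::
    "'a::euclidean_space set \<Rightarrow> 'a \<Rightarrow> nat \<Rightarrow> (nat \<Rightarrow> 'a form) \<Rightarrow> 'a metric \<Rightarrow> bool" where
  "orthonormal_coframe_at N x n e g \<longleftrightarrow> coframe_at N x n e \<and>
     (\<forall>v\<in>tangent_space N x. \<forall>w\<in>tangent_space N x. g x v w = (\<Sum>i=1..n. e i x [v] * e i x [w]))"

text \<open>Complex-valued forms are pairs of a real and an imaginary part.\<close>

definition complex_wedge :: "'a form \<times> 'a form \<Rightarrow> 'a form \<times> 'a form \<Rightarrow> 'a form \<times> 'a form" where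
  "complex_wedge \<zeta> \<xi> =
     (fst \<zeta> \<and>\<^sub>f fst \<xi> - snd \<zeta> \<and>\<^sub>f snd \<xi>, fst \<zeta> \<and>\<^sub>f snd \<xi> + snd \<zeta> \<and>\<^sub>f fst \<xi>)"

definition model_F :: "(nat \<Rightarrow> 'a form) \<Rightarrow> 'a form" where
  "model_F e = e 1 \<and>\<^sub>f e 2 + e 3 \<and>\<^sub>f e 4 + e 5 \<and>\<^sub>f e 6"

definition model_Psi :: "(nat \<Rightarrow> 'a form) \<Rightarrow> 'a form \<times> 'a form" where
  "model_Psi e = complex_wedge (complex_wedge (e 1, e 2) (e 3, e 4)) (e 5, e 6)"

definition SU2_adapted ::
    "'a::euclidean_space set \<Rightarrow> 'a \<Rightarrow> (nat \<Rightarrow> 'a form) \<Rightarrow> 'a form \<Rightarrow> 'a form \<Rightarrow> 'a form \<Rightarrow> 'a form \<Rightarrow> bool" where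
  "SU2_adapted N x e \<eta> \<omega>1 \<omega>2 \<omega>3 \<longleftrightarrow> coframe_at N x 5 e \<and>
     form_eq_at N x \<eta> (e 5) \<and>
     form_eq_at N x \<omega>1 (e 1 \<and>\<^sub>f e 2 + e 3 \<and>\<^sub>f e 4) \<and>
     form_eq_at N x \<omega>2 (e 1 \<and>\<^sub>f e 3 + e 4 \<and>\<^sub>f e 2) \<and>
     form_eq_at N x \<omega>3 (e 1 \<and>\<^sub>f e 4 + e 2 \<and>\<^sub>f e 3)"

definition SU3_adapted ::
    "'a::euclidean_space set \<Rightarrow> 'a \<Rightarrow> (nat \<Rightarrow> 'a form) \<Rightarrow> 'a form \<Rightarrow> 'a form \<Rightarrow> 'a form \<Rightarrow> bool" where
  "SU3_adapted N x e F \<Psi>p \<Psi>m \<longleftrightarrow> coframe_at N x 6 e \<and>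
     form_eq_at N x F (model_F e) \<and>
     form_eq_at N x \<Psi>p (fst (model_Psi e)) \<and>
     form_eq_at N x \<Psi>m (snd (model_Psi e))"

definition G2_adapted :: "'a::euclidean_space set \<Rightarrow> 'a \<Rightarrow> (nat \<Rightarrow> 'a form) \<Rightarrow> 'a form \<Rightarrow> bool" where
  "G2_adapted N x e \<phi> \<longleftrightarrow> coframe_at N x 7 e \<and>
     form_eq_at N x \<phi> (model_F e \<and>\<^sub>f e 7 - snd (model_Psi e))"

text \<open>The Hodge dual of the \<open>3\<close>-form of a \<open>G\<^sub>2\<close>-structure in terms of an adapted coframe.\<close>

definition model_star_phi :: "(nat \<Rightarrow> 'a form) \<Rightarrow> 'a form" where
  "model_star_phi e =
     (\<lambda>_. 1 / 2) *\<^sub>f (model_F e \<and>\<^sub>f model_F e) + fst (model_Psi e) \<and>\<^sub>f e 7"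

text \<open>
  The argument \<open>g\<close> is the metric of the structure (and \<open>\<psi>\<close> below is the Hodge dual of \<open>\<phi>\<close>). They do
  not depend on the choice of the adapted coframe, because two of these differ by a map into
  \<open>SU(2)\<close>, \<open>SU(3)\<close> or \<open>G\<^sub>2\<close>, which are subgroups of the special orthogonal group.
\<close>

definition SU2_structure ::
    "'a::euclidean_space set \<Rightarrow> 'a form \<Rightarrow> 'a form \<Rightarrow> 'a form \<Rightarrow> 'a form \<Rightarrow> 'a metric \<Rightarrow> bool" where
  "SU2_structure N \<eta> \<omega>1 \<omega>2 \<omega>3 g \<longleftrightarrow>
     smooth_form 1 N \<eta> \<and> smooth_form 2 N \<omega>1 \<and> smooth_form 2 N \<omega>2 \<and> smooth_form 2 N \<omega>3 \<and>
     (\<forall>x\<in>N. \<exists>U e. open U \<and> x \<in> U \<and> (\<forall>i\<in>{1..5}. smooth_form 1 (N \<inter> U) (e i)) \<and>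
        (\<forall>y\<in>N \<inter> U. SU2_adapted N y e \<eta> \<omega>1 \<omega>2 \<omega>3 \<and> orthonormal_coframe_at N y 5 e g))"

definition SU3_structure ::
    "'a::euclidean_space set \<Rightarrow> 'a form \<Rightarrow> 'a form \<Rightarrow> 'a form \<Rightarrow> 'a metric \<Rightarrow> bool" where
  "SU3_structure N F \<Psi>p \<Psi>m g \<longleftrightarrow>
     smooth_form 2 N F \<and> smooth_form 3 N \<Psi>p \<and> smooth_form 3 N \<Psi>m \<and>
     (\<forall>x\<in>N. \<exists>U e. open U \<and> x \<in> U \<and> (\<forall>i\<in>{1..6}. smooth_form 1 (N \<inter> U) (e i)) \<and>
        (\<forall>y\<in>N \<inter> U. SU3_adapted N y e F \<Psi>p \<Psi>m \<and> orthonormal_coframe_at N y 6 e g))"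

definition G2_structure ::
    "'a::euclidean_space set \<Rightarrow> 'a form \<Rightarrow> 'a form \<Rightarrow> 'a metric \<Rightarrow> bool" where
  "G2_structure N \<phi> \<psi> g \<longleftrightarrow>
     smooth_form 3 N \<phi> \<and> smooth_form 4 N \<psi> \<and>
     (\<forall>x\<in>N. \<exists>U e. open U \<and> x \<in> U \<and> (\<forall>i\<in>{1..7}. smooth_form 1 (N \<inter> U) (e i)) \<and>
        (\<forall>y\<in>N \<inter> U. G2_adapted N y e \<phi> \<and> form_eq_at N y \<psi> (model_star_phi e) \<and>
           orthonormal_coframe_at N y 7 e g))"

definition Sasaki_Einstein ::
    "'a::euclidean_space set \<Rightarrow> 'a form \<Rightarrow> 'a form \<Rightarrow> 'a form \<Rightarrow> 'a form \<Rightarrow> 'a metric \<Rightarrow> bool" where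
  "Sasaki_Einstein N \<eta> \<omega>1 \<omega>2 \<omega>3 g \<longleftrightarrow> SU2_structure N \<eta> \<omega>1 \<omega>2 \<omega>3 g \<and>
     has_ext_deriv 1 N \<eta> ((\<lambda>_. - 2) *\<^sub>f \<omega>3) \<and>
     has_ext_deriv 2 N \<omega>1 ((\<lambda>_. 3) *\<^sub>f (\<eta> \<and>\<^sub>f \<omega>2)) \<and>
     has_ext_deriv 2 N \<omega>2 ((\<lambda>_. - 3) *\<^sub>f (\<eta> \<and>\<^sub>f \<omega>1))"

definition nearly_Kaehler ::
    "'a::euclidean_space set \<Rightarrow> 'a form \<Rightarrow> 'a form \<Rightarrow> 'a form \<Rightarrow> 'a metric \<Rightarrow> bool" where
  "nearly_Kaehler N F \<Psi>p \<Psi>m g \<longleftrightarrow> SU3_structure N F \<Psi>p \<Psi>m g \<and>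
     has_ext_deriv 2 N F ((\<lambda>_. 3) *\<^sub>f \<Psi>p) \<and>
     has_ext_deriv 3 N \<Psi>m ((\<lambda>_. - 2) *\<^sub>f (F \<and>\<^sub>f F))"

definition nearly_parallel_G2 ::
    "'a::euclidean_space set \<Rightarrow> 'a form \<Rightarrow> 'a metric \<Rightarrow> bool" where
  "nearly_parallel_G2 N \<phi> g \<longleftrightarrow>
     (\<exists>\<psi>. G2_structure N \<phi> \<psi> g \<and> has_ext_deriv 3 N \<phi> ((\<lambda>_. 4) *\<^sub>f \<psi>))"

text \<open>The points where the forms degenerate, i.e. do not have the normal form in any coframe.\<close>

definition SU3_degenerate :: "'a::euclidean_space set \<Rightarrow> 'a form \<Rightarrow> 'a form \<Rightarrow> 'a form \<Rightarrow> 'a \<Rightarrow> bool" where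
  "SU3_degenerate N F \<Psi>p \<Psi>m x \<longleftrightarrow> (\<nexists>e. SU3_adapted N x e F \<Psi>p \<Psi>m)"

definition G2_degenerate :: "'a::euclidean_space set \<Rightarrow> 'a form \<Rightarrow> 'a \<Rightarrow> bool" where
  "G2_degenerate N \<phi> x \<longleftrightarrow> (\<nexists>e. G2_adapted N x e \<phi>)"


section \<open>The five-sphere and its sine-cones\<close>

abbreviation S5 :: "(real ^ 6) set" where
  "S5 \<equiv> sphere 0 1"

definition xc :: "6 \<Rightarrow> real ^ 6 \<Rightarrow> real" where
  "xc i = (\<lambda>x. x $ i)"

definition dx :: "6 \<Rightarrow> (real ^ 6) form" where
  "dx i = differential (xc i)"

definition dxx :: "6 \<Rightarrow> 6 \<Rightarrow> (real ^ 6) form" where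
  "dxx i j = dx i \<and>\<^sub>f dx j"

definition eta :: "(real ^ 6) form" where
  "eta = xc 6 *\<^sub>f dx 1 - xc 1 *\<^sub>f dx 6 + xc 2 *\<^sub>f dx 5 - xc 5 *\<^sub>f dx 2 + xc 3 *\<^sub>f dx 4 - xc 4 *\<^sub>f dx 3"

definition omega1 :: "(real ^ 6) form" where
  "omega1 = xc 3 *\<^sub>f dxx 1 2 - xc 2 *\<^sub>f dxx 1 3 + xc 1 *\<^sub>f dxx 2 3
          + xc 5 *\<^sub>f dxx 1 4 - xc 4 *\<^sub>f dxx 1 5 + xc 1 *\<^sub>f dxx 4 5
          + xc 6 *\<^sub>f dxx 2 4 - xc 4 *\<^sub>f dxx 2 6 + xc 2 *\<^sub>f dxx 4 6
          + xc 5 *\<^sub>f dxx 3 6 - xc 6 *\<^sub>f dxx 3 5 - xc 3 *\<^sub>f dxx 5 6"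

definition omega2 :: "(real ^ 6) form" where
  "omega2 = - (xc 4 *\<^sub>f dxx 1 2) + xc 5 *\<^sub>f dxx 1 3 + xc 2 *\<^sub>f dxx 1 4
          - xc 3 *\<^sub>f dxx 1 5 + xc 6 *\<^sub>f dxx 2 3 - xc 1 *\<^sub>f dxx 2 4
          - xc 3 *\<^sub>f dxx 2 6 + xc 1 *\<^sub>f dxx 3 5 + xc 2 *\<^sub>f dxx 3 6
          + xc 6 *\<^sub>f dxx 4 5 - xc 5 *\<^sub>f dxx 4 6 + xc 4 *\<^sub>f dxx 5 6"

definition omega3 :: "(real ^ 6) form" where
  "omega3 = dxx 1 6 - dxx 3 4 - dxx 2 5"

abbreviation g5 :: "(real ^ 6) metric" where
  "g5 \<equiv> induced_metric"

text \<open>In a product with \<open>real\<close> as last factor: the sine and cosine of the last coordinate, the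
  differential of the last coordinate, and forms pulled back from the first factor.\<close>

definition sinl :: "'a \<times> real \<Rightarrow> real" where "sinl p = sin (snd p)"
definition cosl :: "'a \<times> real \<Rightarrow> real" where "cosl p = cos (snd p)"

definition dlast :: "('a::euclidean_space \<times> real) form" where
  "dlast = differential snd"

abbreviation lift :: "'a::euclidean_space form \<Rightarrow> ('a \<times> real) form" where
  "lift \<alpha> \<equiv> pullback fst \<alpha>"

definition F6 :: "((real ^ 6) \<times> real) form" where
  "F6 = (\<lambda>p. sinl p ^ 2) *\<^sub>f (sinl *\<^sub>f lift omega1 + cosl *\<^sub>f lift omega3)
        + sinl *\<^sub>f (lift eta \<and>\<^sub>f dlast)"

definition Psip6 :: "((real ^ 6) \<times> real) form" where
  "Psip6 = (\<lambda>p. sinl p ^ 3) *\<^sub>f (lift eta \<and>\<^sub>f lift omega2)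
        - (\<lambda>p. sinl p ^ 2) *\<^sub>f ((- (cosl *\<^sub>f lift omega1) + sinl *\<^sub>f lift omega3) \<and>\<^sub>f dlast)"

definition Psim6 :: "((real ^ 6) \<times> real) form" where
  "Psim6 = (\<lambda>p. sinl p ^ 3) *\<^sub>f ((- (cosl *\<^sub>f lift omega1) + sinl *\<^sub>f lift omega3) \<and>\<^sub>f lift eta)
        + (\<lambda>p. sinl p ^ 2) *\<^sub>f (lift omega2 \<and>\<^sub>f dlast)"

definition phi7 :: "(((real ^ 6) \<times> real) \<times> real) form" where
  "phi7 = (\<lambda>p. sinl p ^ 2) *\<^sub>f (lift F6 \<and>\<^sub>f dlast)
        - (\<lambda>p. sinl p ^ 3) *\<^sub>f (- (cosl *\<^sub>f lift Psip6) + sinl *\<^sub>f lift Psim6)"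

definition g6 :: "((real ^ 6) \<times> real) metric" where
  "g6 = sine_cone_metric g5"

definition g7 :: "(((real ^ 6) \<times> real) \<times> real) metric" where
  "g7 = sine_cone_metric g6"

text \<open>Polar coordinates on \<open>S\<^sup>6\<close> and \<open>S\<^sup>7\<close>, the unit spheres of the ambient spaces.\<close>

definition polar6 :: "(real ^ 6) \<times> real \<Rightarrow> (real ^ 6) \<times> real" where
  "polar6 = (\<lambda>(x, t). (sin t *\<^sub>R x, cos t))"

definition polar7 :: "((real ^ 6) \<times> real) \<times> real \<Rightarrow> ((real ^ 6) \<times> real) \<times> real" where
  "polar7 = (\<lambda>(p, q). (sin q *\<^sub>R polar6 p, cos q))"

end

theory Submission
  imports Defs
begin

text \<open>
  The five-sphere. Identify \<open>\<real>\<^sup>6\<close> with complex three-space such that \<open>\<omega>\<^sub>3\<close> is its Kaehler form, and let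
  \<open>\<Omega>\<close> be the holomorphic volume form. At a point \<open>x\<close> of the sphere, \<open>\<eta>\<close> is minus the contraction of
  \<open>\<omega>\<^sub>3\<close> with \<open>x\<close>, and \<open>\<omega>\<^sub>1 + i \<omega>\<^sub>2\<close> is the contraction of \<open>\<Omega>\<close> with \<open>x\<close>. Contracting a constant
  \<open>k\<close>-form with the position vector and differentiating multiplies it by \<open>k\<close>, so \<open>d \<eta> = - 2 \<omega>\<^sub>3\<close> and
  \<open>d (\<omega>\<^sub>1 + i \<omega>\<^sub>2) = 3 \<Omega>\<close>. On vectors tangent to the sphere, \<open>\<Omega> = - i \<eta> \<and> (\<omega>\<^sub>1 + i \<omega>\<^sub>2)\<close>, which is
  Cramer's relation between four vectors of a three-dimensional space (\<open>holo_vol_tangent\<close>). These are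
  the Sasaki-Einstein equations. An adapted coframe comes from a unitary basis \<open>x, y, z\<close> with \<open>\<Omega>(x, y, z) = 1\<close>,
  and the identities that make it adapted are Parseval's identity and again Cramer's relation
  (\<open>herm_expand\<close>, \<open>holo_vol_expand\<close>).

  The cones. Both passages, from dimension five to six and from six to seven, have the same pattern.
  The given forms are the standard ones for a coframe that consists of \<open>dt\<close> (or \<open>dq\<close>) and \<open>sin t\<close>
  (or \<open>sin q\<close>) times the previous coframe, after a rotation of two of its members by an angle that
  depends on \<open>t\<close> (or \<open>q\<close>): \<open>SU3_coframe\<close> and \<open>G2_coframe\<close>. Since rotations preserve
  orthonormality, the metric is the sine-cone metric. The differential equations follow from those
  one dimension below by the Leibniz rule, the relations \<open>\<omega>\<^sub>1 \<and> \<omega>\<^sub>3 = \<omega>\<^sub>2 \<and> \<omega>\<^sub>3 = 0\<close> and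
  \<open>\<omega>\<^sub>1 \<and> \<omega>\<^sub>1 = \<omega>\<^sub>3 \<and> \<omega>\<^sub>3\<close>, and \<open>sin\<^sup>2 + cos\<^sup>2 = 1\<close>. Polar coordinates on the sphere turn the sine-cone
  over the round metric into the round metric, and near the ends \<open>sin t\<close> agrees with the distance to
  the end up to a factor that tends to \<open>1\<close>.

  The forms are functions of lists of vectors. The sum over shuffles that defines the wedge product
  is plainly bilinear and natural. Its finer properties come from the recursion
  \<open>shuffle_product_Cons\<close> in the first argument, that is, the antiderivation law of the interior product. Associativity, graded commutativity, the alternating
  property and the Leibniz rule are short inductions from it, and afterwards all computations take
  place in the graded algebra of forms.
\<close>


section \<open>Wedge products by recursion on the arguments\<close>

text \<open>The wedge product at a fixed base point, where a form is just a function of lists of vectors.\<close>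

definition shuffle_product ::
    "('a list \<Rightarrow> real) \<Rightarrow> ('a list \<Rightarrow> real) \<Rightarrow> 'a list \<Rightarrow> real" where
  "shuffle_product a b vs = (\<Sum>I\<in>Pow {..<length vs}.
     (- 1) ^ card {(i, j). i \<in> I \<and> j \<in> {..<length vs} - I \<and> j < i}
       * a (nths vs I) * b (nths vs (- I)))"

text \<open>The interior product, at a fixed base point.\<close>

definition contract :: "'a \<Rightarrow> ('a list \<Rightarrow> real) \<Rightarrow> 'a list \<Rightarrow> real" where
  "contract v a = (\<lambda>ws. a (v # ws))"

text \<open>The grade involution, the sign of moving a vector past a form.\<close>

definition grade_sign :: "('a list \<Rightarrow> real) \<Rightarrow> 'a list \<Rightarrow> real" where
  "grade_sign a = (\<lambda>ws. (- 1) ^ length ws * a ws)"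

lemma wedge_eq_shuffle_product: "(\<alpha> \<and>\<^sub>f \<beta>) x vs = shuffle_product (\<alpha> x) (\<beta> x) vs"
  by (simp add: wedge_def shuffle_product_def)

lemma shuffle_product_Nil [simp]: "shuffle_product a b [] = a [] * b []"
proof -
  have "{(i, j). (i::nat) \<in> {} \<and> j \<in> {..<0} - {} \<and> j < i} = {}" by auto
  thus ?thesis by (simp add: shuffle_product_def)
qed

text \<open>
  The interior product is an antiderivation. Split the shuffles according to whether the first
  argument goes to \<open>a\<close> or to \<open>b\<close>; in the second case it is overtaken by all arguments of \<open>a\<close>, which
  gives the sign. Associativity, the commutation law and the Leibniz rule are inductions along this recursion.
\<close>

lemma shuffle_product_Cons:
  "shuffle_product a b (v # vs) =
     shuffle_product (contract v a) b vs + shuffle_product (grade_sign a) (contract v b) vs"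
proof -
  define n where "n = length vs"
  define inv where "inv m I = {(i, j). i \<in> I \<and> j \<in> {..<m} - I \<and> j < i}" for m :: nat and I
  define g where "g I = (- 1) ^ card (inv (Suc n) I) * a (nths (v # vs) I) * b (nths (v # vs) (- I))" for I
  have split: "Pow {..<Suc n} = image Suc ` Pow {..<n} \<union> (\<lambda>I. insert 0 (Suc ` I)) ` Pow {..<n}"
    unfolding lessThan_Suc_eq_insert_0 Pow_insert by (simp add: image_image image_Pow_surj[OF refl, symmetric])
  have disj: "image Suc ` Pow {..<n} \<inter> (\<lambda>I. insert 0 (Suc ` I)) ` Pow {..<n} = {}"
    by auto
  have inj1: "inj_on (image Suc) (Pow {..<n})"
    by (simp add: inj_on_def inj_image_eq_iff)
  have inj2: "inj_on (\<lambda>I. insert 0 (Suc ` I)) (Pow {..<n})"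
    by (rule inj_onI) (metis image_Suc_atLeastAtMost image_iff inj_Suc inj_image_eq_iff insert_ident nat.distinct(1))
  have fin: "finite (inv m I)" if "I \<subseteq> {..<k}" for m k I
    by (rule finite_subset[of _ "{..<k} \<times> {..<m}"]) (use that in \<open>auto simp: inv_def\<close>)
  have injmap: "inj_on (map_prod Suc Suc) P" for P
    by (auto simp: inj_on_def)
  \<comment> \<open>The first argument goes to \<open>a\<close>: it takes part in no inversion.\<close>
  have A: "g (insert 0 (Suc ` I)) = (- 1) ^ card (inv n I) * contract v a (nths vs I) * b (nths vs (- I))"
    if I: "I \<subseteq> {..<n}" for I
  proof -
    have "inv (Suc n) (insert 0 (Suc ` I)) = map_prod Suc Suc ` inv n I"
    proof (intro equalityI subsetI)
      fix p assume "p \<in> inv (Suc n) (insert 0 (Suc ` I))"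
      then obtain i j where p: "p = (i, j)" "i \<in> insert 0 (Suc ` I)" "j < Suc n" "j \<notin> insert 0 (Suc ` I)" "j < i"
        by (auto simp: inv_def)
      then obtain i' j' where "i = Suc i'" "i' \<in> I" "j = Suc j'" by (cases i; cases j) auto
      with p show "p \<in> map_prod Suc Suc ` inv n I"
        by (auto simp: inv_def intro!: image_eqI[of _ _ "(i', j')"])
    qed (auto simp: inv_def)
    hence "card (inv (Suc n) (insert 0 (Suc ` I))) = card (inv n I)"
      by (simp add: card_image injmap)
    moreover have "nths (v # vs) (insert 0 (Suc ` I)) = v # nths vs I"
      "nths (v # vs) (- insert 0 (Suc ` I)) = nths vs (- I)"
      by (auto simp: nths_Cons image_iff intro!: arg_cong2[where f = nths])
    ultimately show ?thesis by (simp add: g_def contract_def)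
  qed
  \<comment> \<open>The first argument goes to \<open>b\<close>: it is inverted with each element of \<open>I\<close>.\<close>
  have B: "g (Suc ` I) = (- 1) ^ card (inv n I) * grade_sign a (nths vs I) * contract v b (nths vs (- I))"
    if I: "I \<subseteq> {..<n}" for I
  proof -
    have "inv (Suc n) (Suc ` I) = map_prod Suc Suc ` inv n I \<union> (\<lambda>i. (Suc i, 0)) ` I"
    proof (intro equalityI subsetI)
      fix p assume "p \<in> inv (Suc n) (Suc ` I)"
      then obtain i j where p: "p = (i, j)" "i \<in> Suc ` I" "j < Suc n" "j \<notin> Suc ` I" "j < i"
        by (auto simp: inv_def)
      show "p \<in> map_prod Suc Suc ` inv n I \<union> (\<lambda>i. (Suc i, 0)) ` I"
      proof (cases j)
        case (Suc j')
        from p obtain i' where "i = Suc i'" "i' \<in> I" by auto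
        with p Suc show ?thesis
          by (auto simp: inv_def intro!: image_eqI[of _ _ "(i', j')"])
      qed (use p in auto)
    qed (auto simp: inv_def)
    moreover have "card (map_prod Suc Suc ` inv n I \<union> (\<lambda>i. (Suc i, 0)) ` I) =
        card (map_prod Suc Suc ` inv n I) + card ((\<lambda>i. (Suc i, 0::nat)) ` I)"
      by (rule card_Un_disjoint) (use I fin[OF I] finite_subset[OF I] in auto)
    ultimately have "card (inv (Suc n) (Suc ` I)) = card (inv n I) + card I"
      by (simp add: card_image[OF injmap] card_image inj_on_def)
    moreover have "nths (v # vs) (Suc ` I) = nths vs I"
      "nths (v # vs) (- Suc ` I) = v # nths vs (- I)"
      by (auto simp: nths_Cons image_iff intro!: arg_cong2[where f = nths])
    moreover have "length (nths vs I) = card I"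
    proof -
      have "{i. i < length vs \<and> i \<in> I} = I" using I by (auto simp: n_def)
      thus ?thesis by (simp add: length_nths)
    qed
    ultimately show ?thesis by (simp add: g_def contract_def grade_sign_def power_add)
  qed
  have "shuffle_product a b (v # vs) = sum g (Pow {..<Suc n})"
    by (simp add: shuffle_product_def g_def inv_def n_def)
  also have "\<dots> = (\<Sum>I\<in>Pow {..<n}. g (Suc ` I)) + (\<Sum>I\<in>Pow {..<n}. g (insert 0 (Suc ` I)))"
    unfolding split by (subst sum.union_disjoint[OF _ _ disj]) (simp_all add: sum.reindex inj1 inj2)
  also have "(\<Sum>I\<in>Pow {..<n}. g (Suc ` I)) = shuffle_product (grade_sign a) (contract v b) vs"
    unfolding shuffle_product_def n_def[symmetric] by (intro sum.cong refl) (simp add: B inv_def)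
  also have "(\<Sum>I\<in>Pow {..<n}. g (insert 0 (Suc ` I))) = shuffle_product (contract v a) b vs"
    unfolding shuffle_product_def n_def[symmetric] by (intro sum.cong refl) (simp add: A inv_def)
  finally show ?thesis by simp
qed

lemma shuffle_product_add_left:
  "shuffle_product (\<lambda>ws. a ws + a' ws) b vs = shuffle_product a b vs + shuffle_product a' b vs"
  by (simp add: shuffle_product_def algebra_simps sum.distrib)

lemma shuffle_product_add_right:
  "shuffle_product a (\<lambda>ws. b ws + b' ws) vs = shuffle_product a b vs + shuffle_product a b' vs"
  by (simp add: shuffle_product_def algebra_simps sum.distrib)

lemma shuffle_product_scale_left:
  "shuffle_product (\<lambda>ws. c * a ws) b vs = c * shuffle_product a b vs"
  by (simp add: shuffle_product_def algebra_simps sum_distrib_left)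

lemma shuffle_product_scale_right:
  "shuffle_product a (\<lambda>ws. c * b ws) vs = c * shuffle_product a b vs"
  by (simp add: shuffle_product_def algebra_simps sum_distrib_left)

lemma shuffle_product_zero [simp]:
  "shuffle_product (\<lambda>_. 0) b = (\<lambda>_. 0)" "shuffle_product a (\<lambda>_. 0) = (\<lambda>_. 0)"
  by (simp_all add: shuffle_product_def fun_eq_iff)

lemmas shuffle_product_linear =
  shuffle_product_add_left shuffle_product_add_right shuffle_product_scale_left shuffle_product_scale_right

lemma shuffle_product_cong:
  assumes "\<And>ws. set ws \<subseteq> set vs \<Longrightarrow> a ws = a' ws" "\<And>ws. set ws \<subseteq> set vs \<Longrightarrow> b ws = b' ws"
  shows "shuffle_product a b vs = shuffle_product a' b' vs"
  unfolding shuffle_product_def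
  by (intro sum.cong refl arg_cong2[where f = "(*)"] assms set_nths_subset)

lemma contract_shuffle_product:
  "contract v (shuffle_product a b) =
     (\<lambda>ws. shuffle_product (contract v a) b ws + shuffle_product (grade_sign a) (contract v b) ws)"
  by (simp add: fun_eq_iff contract_def[of v "shuffle_product a b"] shuffle_product_Cons)

lemma contract_grade_sign: "contract v (grade_sign a) = (\<lambda>ws. - 1 * grade_sign (contract v a) ws)"
  by (simp add: fun_eq_iff contract_def grade_sign_def)

lemma grade_sign_grade_sign [simp]: "grade_sign (grade_sign a) = a"
  by (simp add: fun_eq_iff grade_sign_def power_add[symmetric] mult.assoc[symmetric] flip: mult_2)

lemma grade_sign_shuffle_product:
  "grade_sign (shuffle_product a b) = shuffle_product (grade_sign a) (grade_sign b)"
proof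
  show "grade_sign (shuffle_product a b) vs = shuffle_product (grade_sign a) (grade_sign b) vs" for vs
  proof (induction vs arbitrary: a b)
    case (Cons v vs)
    have "grade_sign (shuffle_product a b) (v # vs) =
      - grade_sign (shuffle_product (contract v a) b) vs - grade_sign (shuffle_product (grade_sign a) (contract v b)) vs"
      by (simp add: grade_sign_def[of "shuffle_product _ _"] shuffle_product_Cons algebra_simps)
    also have "\<dots> = shuffle_product (grade_sign a) (grade_sign b) (v # vs)"
      unfolding Cons.IH shuffle_product_Cons contract_grade_sign shuffle_product_linear by simp
    finally show ?case .
  qed (simp add: grade_sign_def)
qed

lemma shuffle_product_assoc:
  "shuffle_product (shuffle_product a b) c vs = shuffle_product a (shuffle_product b c) vs"
proof (induction vs arbitrary: a b c)
  case (Cons v vs)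
  show ?case
    by (simp only: shuffle_product_Cons contract_shuffle_product grade_sign_shuffle_product
        shuffle_product_linear Cons.IH add.assoc)
qed simp

text \<open>
  A parity instead of a degree makes the commutation law insensitive to contractions of
  \<open>0\<close>-forms: contraction always changes the parity.
\<close>

definition has_parity :: "bool \<Rightarrow> ('a list \<Rightarrow> real) \<Rightarrow> bool" where
  "has_parity od a \<longleftrightarrow> (\<forall>ws. odd (length ws) \<noteq> od \<longrightarrow> a ws = 0)"

lemma has_parity_contract: "has_parity od a \<Longrightarrow> has_parity (\<not> od) (contract v a)"
  by (auto simp: has_parity_def contract_def)

lemma grade_sign_has_parity: "has_parity od a \<Longrightarrow> grade_sign a = (\<lambda>ws. (if od then - 1 else 1) * a ws)"
  unfolding has_parity_def grade_sign_def fun_eq_iff by (metis (full_types) minus_one_power_iff mult_zero_right)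

lemma shuffle_product_commute:
  assumes "has_parity p a" "has_parity q b"
  shows "shuffle_product b a vs = (if p \<and> q then - 1 else 1) * shuffle_product a b vs"
  using assms
proof (induction vs arbitrary: a b p q)
  case (Cons v vs)
  note 1 = Cons.IH[OF Cons.prems(1) has_parity_contract[OF Cons.prems(2)], of v]
  note 2 = Cons.IH[OF has_parity_contract[OF Cons.prems(1)] Cons.prems(2), of v]
  show ?case
    unfolding shuffle_product_Cons grade_sign_has_parity[OF Cons.prems(1)]
      grade_sign_has_parity[OF Cons.prems(2)] shuffle_product_linear 1 2
    by simp
qed (auto simp: has_parity_def)

section \<open>Alternating multilinear forms\<close>

lemma alternating_add:
  "alternating_on V k a \<Longrightarrow> alternating_on V k b \<Longrightarrow> alternating_on V k (\<lambda>ws. a ws + b ws)"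
  by (simp add: alternating_on_def algebra_simps)

lemma alternating_scale: "alternating_on V k a \<Longrightarrow> alternating_on V k (\<lambda>ws. c * a ws)"
  by (simp add: alternating_on_def algebra_simps)

lemma alternating_zero: "alternating_on V k (\<lambda>_. 0)"
  by (simp add: alternating_on_def)

lemma alternating_mono: "alternating_on UNIV k a \<Longrightarrow> alternating_on V k a"
  by (simp add: alternating_on_def)

lemma alternating_length: "alternating_on UNIV k a \<Longrightarrow> length vs \<noteq> k \<Longrightarrow> a vs = 0"
  by (simp add: alternating_on_def)

lemma alternating_parity: "alternating_on UNIV k a \<Longrightarrow> has_parity (odd k) a"
  by (auto simp: has_parity_def dest!: alternating_length)

lemma alternating_Suc_contract: "alternating_on UNIV (Suc k) a \<Longrightarrow> alternating_on UNIV k (contract v a)"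
  unfolding alternating_on_def contract_def
  apply (intro conjI allI impI ballI)
    apply simp
  subgoal for vs i u w x y
    by (elim conjE allE[of _ "v # vs"] allE[of _ "Suc i"]) simp
  subgoal for vs i j
    by (elim conjE) (rotate_tac -1, elim allE[of _ "v # vs"] allE[of _ "Suc i"] allE[of _ "Suc j"], simp)
  done

lemma alternating_Suc_linear:
  assumes "alternating_on UNIV (Suc k) a"
  shows "contract (c *\<^sub>R u + d *\<^sub>R w) a = (\<lambda>ws. c * contract u a ws + d * contract w a ws)"
proof
  fix ws
  show "contract (c *\<^sub>R u + d *\<^sub>R w) a ws = c * contract u a ws + d * contract w a ws"
  proof (cases "length ws = k")
    case True
    have "\<forall>vs i. set vs \<subseteq> UNIV \<and> length vs = Suc k \<and> i < Suc k \<longrightarrow>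
        (\<forall>u\<in>UNIV. \<forall>w\<in>UNIV. \<forall>c d. a (vs[i := c *\<^sub>R u + d *\<^sub>R w]) = c * a (vs[i := u]) + d * a (vs[i := w]))"
      using assms unfolding alternating_on_def by blast
    from this[rule_format, of "u # ws" 0 u w c d] True show ?thesis by (simp add: contract_def)
  qed (use assms in \<open>simp add: contract_def alternating_length\<close>)
qed

lemma alternating_Suc_repeat:
  assumes "alternating_on UNIV (Suc k) a" shows "contract v (contract v a) = (\<lambda>_. 0)"
proof
  fix ws
  show "contract v (contract v a) ws = 0"
  proof (cases "Suc (length ws) = k")
    case True
    have "\<forall>vs i j. set vs \<subseteq> UNIV \<and> length vs = Suc k \<and> i < j \<and> j < Suc k \<and> vs ! i = vs ! j \<longrightarrow> a vs = 0"
      using assms unfolding alternating_on_def by blast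
    from this[rule_format, of "v # v # ws" 0 1] True show ?thesis by (simp add: contract_def)
  qed (use assms in \<open>simp add: contract_def alternating_length\<close>)
qed

text \<open>
  A form is alternating as soon as its contractions are, provided that it is linear in the first
  argument and vanishes when the first two coincide: a coincidence of the first argument with a
  later one is moved to the contraction by exchanging the first two arguments.
\<close>

lemma alternating_SucI:
  assumes contr: "\<And>v. alternating_on UNIV k (contract v a)" and Nil: "a [] = 0"
    and lin: "\<And>c d u w. contract (c *\<^sub>R u + d *\<^sub>R w) a = (\<lambda>ws. c * contract u a ws + d * contract w a ws)"
    and rep: "\<And>v. contract v (contract v a) = (\<lambda>_. 0)"
  shows "alternating_on UNIV (Suc k) a"
proof -
  have len: "a vs = 0" if "length vs \<noteq> Suc k" for vs
    using that Nil alternating_length[OF contr, of "tl vs" "hd vs"] by (cases vs) (auto simp: contract_def)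
  have multi: "a (vs[i := c *\<^sub>R u + d *\<^sub>R w]) = c * a (vs[i := u]) + d * a (vs[i := w])"
    if hyp: "length vs = Suc k" "i < Suc k" for vs i u w c d
  proof -
    obtain v ws where vs: "vs = v # ws" "length ws = k" using hyp by (cases vs) auto
    show ?thesis
    proof (cases i)
      case 0
      with vs show ?thesis using fun_cong[OF lin] by (simp add: contract_def)
    next
      case (Suc i')
      have "contract v a (ws[i' := c *\<^sub>R u + d *\<^sub>R w]) = c * contract v a (ws[i' := u]) + d * contract v a (ws[i' := w])"
        using contr[of v] vs Suc hyp unfolding alternating_on_def by simp
      with vs Suc show ?thesis by (simp add: contract_def)
    qed
  qed
  have swap: "a (u # w # ws) = - a (w # u # ws)" for u w ws
  proof (cases "Suc (length ws) = k")
    case True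
    have lin2: "a (v # (1 *\<^sub>R u + 1 *\<^sub>R w) # ws) = a (v # u # ws) + a (v # w # ws)" for v
      using multi[of "v # u # ws" 1 1 u 1 w] True by simp
    have lin1: "a ((1 *\<^sub>R u + 1 *\<^sub>R w) # vs) = a (u # vs) + a (w # vs)" for vs
      using fun_cong[OF lin, of 1 u 1 w vs] by (simp add: contract_def)
    have "a (v # v # ws) = 0" for v using fun_cong[OF rep, of v ws] by (simp add: contract_def)
    from this[of "1 *\<^sub>R u + 1 *\<^sub>R w"] this[of u] this[of w] show ?thesis
      unfolding lin1 lin2 by simp
  qed (simp add: len)
  have alt: "a vs = 0" if hyp: "length vs = Suc k" "i < j" "j < Suc k" "vs ! i = vs ! j" for vs i j
  proof -
    have alt': "contract v a ws = 0" if "length ws = k" "i < j" "j < k" "ws ! i = ws ! j" for v ws i j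
      using contr[of v] that unfolding alternating_on_def by blast
    obtain v ws where vs: "vs = v # ws" "length ws = k" using hyp by (cases vs) auto
    obtain j' where j: "j = Suc j'" using hyp by (cases j) auto
    show ?thesis
    proof (cases i)
      case 0
      with hyp vs j have v: "v = ws ! j'" "j' < k" by auto
      with vs obtain w us where ws: "ws = w # us" by (cases ws) auto
      show ?thesis
      proof (cases j')
        case 0
        with v ws vs show ?thesis using fun_cong[OF rep, of v us] by (simp add: contract_def)
      next
        case (Suc m)
        with v ws vs have "contract w a (v # us) = 0" by (intro alt'[of _ 0 j']) auto
        with ws vs show ?thesis by (simp add: contract_def swap[of v])
      qed
    next
      case (Suc i')
      with hyp vs j have "contract v a ws = 0" by (intro alt'[of _ i' j']) auto
      with vs show ?thesis by (simp add: contract_def)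
    qed
  qed
  show ?thesis unfolding alternating_on_def using len multi alt by blast
qed

lemma alternating_grade_sign:
  assumes "alternating_on UNIV k a" shows "alternating_on UNIV k (grade_sign a)"
  by (simp add: grade_sign_has_parity[OF alternating_parity[OF assms]] assms
        alternating_scale[where c = "- 1", simplified])

lemma alternating_contract_Suc_or_zero:
  assumes "alternating_on UNIV k a"
  obtains k' where "k = Suc k'" "\<And>v. alternating_on UNIV k' (contract v a)"
  | "k = 0" "\<And>v. contract v a = (\<lambda>_. 0)"
proof (cases k)
  case 0
  have "contract v a = (\<lambda>_. 0)" for v
    using assms 0 by (auto simp: fun_eq_iff contract_def intro: alternating_length)
  with 0 show thesis by (rule that(2))
next
  case (Suc k')
  with assms show thesis using that(1) alternating_Suc_contract by blast
qed

lemma alternating_contract_linear: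
  assumes "alternating_on UNIV k a"
  shows "contract (c *\<^sub>R u + d *\<^sub>R w) a = (\<lambda>ws. c * contract u a ws + d * contract w a ws)"
  using assms alternating_Suc_linear[of _ a c u d w]
  by (cases rule: alternating_contract_Suc_or_zero[OF assms]) auto

lemma alternating_contract_repeat:
  assumes "alternating_on UNIV k a" shows "contract v (contract v a) = (\<lambda>_. 0)"
  using assms alternating_Suc_repeat[of _ a v]
  by (cases rule: alternating_contract_Suc_or_zero[OF assms]) (auto simp: contract_def)

text \<open>
  Induction on the total degree with the criterion above. The contractions of a product are sums of
  products of smaller degree by the antiderivation law.
\<close>

lemma alternating_shuffle_product:
  assumes "alternating_on UNIV k a" "alternating_on UNIV l b"
  shows "alternating_on UNIV (k + l) (shuffle_product a b)"
  using assms
proof (induction "k + l" arbitrary: k l a b)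
  case 0
  then have a: "alternating_on UNIV 0 a" and b: "alternating_on UNIV 0 b" by auto
  have z: "contract v a = (\<lambda>_. 0)" "contract v b = (\<lambda>_. 0)" for v
    using a b by (auto simp: fun_eq_iff contract_def intro: alternating_length)
  have "shuffle_product a b vs = 0" if "vs \<noteq> []" for vs
    using that z by (cases vs) (auto simp: shuffle_product_Cons)
  with 0 show ?case by (auto simp: alternating_on_def)
next
  case (Suc m)
  note a = Suc.prems(1) and b = Suc.prems(2)
  have 1: "alternating_on UNIV m (shuffle_product (contract v a) b)" for v
    using Suc.hyps b
    by (cases rule: alternating_contract_Suc_or_zero[OF a]) (auto simp: alternating_zero)
  have 2: "alternating_on UNIV m (shuffle_product (grade_sign a) (contract v b))" for v
    using alternating_contract_Suc_or_zero[OF b]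
  proof cases
    case (1 k')
    with Suc.hyps(2) have "m = k + k'" by simp
    from Suc.hyps(1)[OF this alternating_grade_sign[OF a] 1(2)] this show ?thesis by simp
  qed (simp add: alternating_zero)
  have "alternating_on UNIV (Suc m) (shuffle_product a b)"
  proof (rule alternating_SucI)
    show "alternating_on UNIV m (contract v (shuffle_product a b))" for v
      unfolding contract_shuffle_product by (rule alternating_add[OF 1 2])
    show "shuffle_product a b [] = 0"
      using Suc.hyps(2) a b by (cases "k = 0") (auto dest: alternating_length[where vs = "[]"])
    show "contract (c *\<^sub>R u + d *\<^sub>R w) (shuffle_product a b) =
       (\<lambda>ws. c * contract u (shuffle_product a b) ws + d * contract w (shuffle_product a b) ws)" for c d u w
      by (simp add: fun_eq_iff contract_shuffle_product alternating_contract_linear[OF a]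
          alternating_contract_linear[OF b] shuffle_product_linear algebra_simps)
    \<comment> \<open>The two mixed terms cancel, as \<open>contract v\<close> anticommutes with \<open>grade_sign\<close>.\<close>
    show "contract v (contract v (shuffle_product a b)) = (\<lambda>_. 0)" for v
    proof
      fix ws
      have "contract v (contract v (shuffle_product a b)) ws =
        contract v (shuffle_product (contract v a) b) ws + contract v (shuffle_product (grade_sign a) (contract v b)) ws"
        unfolding contract_shuffle_product[of v a b] by (simp add: contract_def)
      also have "\<dots> = 0"
        unfolding contract_shuffle_product contract_grade_sign alternating_contract_repeat[OF a]
          alternating_contract_repeat[OF b] shuffle_product_linear
        by simp
      finally show "contract v (contract v (shuffle_product a b)) ws = 0" .
    qed
  qed
  with Suc.hyps(2) show ?case by simp
qed


section \<open>Elementary functions\<close>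

text \<open>
  All functions below are built from linear ones by arithmetic, sine, cosine and the inverse square
  root. This class is closed under directional derivatives, so that its members are smooth by
  induction on the order alone, without higher product and chain rules.
\<close>

inductive elementary :: "'a::euclidean_space set \<Rightarrow> ('a \<Rightarrow> real) \<Rightarrow> bool" for U where
  elementary_linear: "bounded_linear f \<Longrightarrow> elementary U f"
| elementary_const: "elementary U (\<lambda>_. c)"
| elementary_add: "elementary U f \<Longrightarrow> elementary U g \<Longrightarrow> elementary U (\<lambda>x. f x + g x)"
| elementary_mult: "elementary U f \<Longrightarrow> elementary U g \<Longrightarrow> elementary U (\<lambda>x. f x * g x)"
| elementary_sin: "elementary U f \<Longrightarrow> elementary U (\<lambda>x. sin (f x))"
| elementary_cos: "elementary U f \<Longrightarrow> elementary U (\<lambda>x. cos (f x))"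
| elementary_rsqrt: "elementary U f \<Longrightarrow> \<forall>x\<in>U. 0 < f x \<Longrightarrow> elementary U (\<lambda>x. inverse (sqrt (f x)))"

lemma elementary_minus: "elementary U f \<Longrightarrow> elementary U (\<lambda>x. - f x)"
  using elementary_mult[OF elementary_const[of U "- 1"]] by simp

lemma elementary_diff: "elementary U f \<Longrightarrow> elementary U g \<Longrightarrow> elementary U (\<lambda>x. f x - g x)"
  using elementary_add[OF _ elementary_minus] by fastforce

lemma elementary_power: "elementary U f \<Longrightarrow> elementary U (\<lambda>x. f x ^ n)"
  by (induction n) (auto intro: elementary_const elementary_mult)

lemma elementary_sum:
  "(\<And>i. i \<in> I \<Longrightarrow> elementary U (f i)) \<Longrightarrow> elementary U (\<lambda>x. \<Sum>i\<in>I. f i x)"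
  by (induction I rule: infinite_finite_induct) (auto intro: elementary_const elementary_add)

lemmas elementary_intros =
  elementary_const elementary_add elementary_diff elementary_minus elementary_mult elementary_power
  elementary_sin elementary_cos

lemma elementary_compose_linear:
  assumes "elementary U f" "bounded_linear l"
  shows "elementary (l -` U) (\<lambda>x. f (l x))"
  using assms(1)
  by (induction rule: elementary.induct)
    (auto intro: elementary.intros bounded_linear_compose[OF _ assms(2)])

lemma elementary_has_derivative:
  assumes "elementary U f"
  shows "\<exists>f'. (\<forall>x\<in>U. (f has_derivative f' x) (at x)) \<and> (\<forall>v. elementary U (\<lambda>x. f' x v))"
  using assms
proof (induction rule: elementary.induct)
  case (elementary_linear f)
  then show ?case
    by (intro exI[of _ "\<lambda>_. f"]) (auto intro: bounded_linear_imp_has_derivative elementary_const)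
next
  case (elementary_const c)
  then show ?case
    by (intro exI[of _ "\<lambda>_ _. 0"]) (auto intro: elementary.elementary_const)
next
  case (elementary_add f g)
  then obtain f' g' where "\<forall>x\<in>U. (f has_derivative f' x) (at x)" "\<forall>v. elementary U (\<lambda>x. f' x v)"
    "\<forall>x\<in>U. (g has_derivative g' x) (at x)" "\<forall>v. elementary U (\<lambda>x. g' x v)" by blast
  then show ?case
    by (intro exI[of _ "\<lambda>x v. f' x v + g' x v"]) (auto intro!: has_derivative_add elementary.elementary_add)
next
  case (elementary_mult f g)
  then obtain f' g' where "\<forall>x\<in>U. (f has_derivative f' x) (at x)" "\<forall>v. elementary U (\<lambda>x. f' x v)"
    "\<forall>x\<in>U. (g has_derivative g' x) (at x)" "\<forall>v. elementary U (\<lambda>x. g' x v)" by blast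
  with elementary_mult.hyps show ?case
    by (intro exI[of _ "\<lambda>x v. f x * g' x v + f' x v * g x"])
      (auto intro!: has_derivative_mult elementary.elementary_add elementary.elementary_mult)
next
  case (elementary_sin f)
  then obtain f' where "\<forall>x\<in>U. (f has_derivative f' x) (at x)" "\<forall>v. elementary U (\<lambda>x. f' x v)" by blast
  with elementary_sin.hyps show ?case
    by (intro exI[of _ "\<lambda>x v. f' x v * cos (f x)"])
      (auto intro!: derivative_eq_intros elementary.elementary_mult elementary.elementary_cos)
next
  case (elementary_cos f)
  then obtain f' where "\<forall>x\<in>U. (f has_derivative f' x) (at x)" "\<forall>v. elementary U (\<lambda>x. f' x v)" by blast
  with elementary_cos.hyps show ?case
    by (intro exI[of _ "\<lambda>x v. f' x v * - sin (f x)"])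
      (auto intro!: derivative_eq_intros elementary_mult elementary_minus elementary.elementary_sin)
next
  case (elementary_rsqrt f)
  then obtain f' where f': "\<forall>x\<in>U. (f has_derivative f' x) (at x)" "\<forall>v. elementary U (\<lambda>x. f' x v)" by blast
  show ?case
  proof (intro exI[of _ "\<lambda>x v. - (1 / 2) * inverse (sqrt (f x)) ^ 3 * f' x v"] conjI ballI allI)
    fix x assume "x \<in> U"
    with elementary_rsqrt.hyps f' have pos: "0 < f x" and D: "(f has_derivative f' x) (at x)" by auto
    show "((\<lambda>x. inverse (sqrt (f x))) has_derivative
        (\<lambda>v. - (1 / 2) * inverse (sqrt (f x)) ^ 3 * f' x v)) (at x)"
      using pos by (auto intro!: derivative_eq_intros D simp: power3_eq_cube)
  next
    fix v
    show "elementary U (\<lambda>x. - (1 / 2) * inverse (sqrt (f x)) ^ 3 * f' x v)"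
      using f' elementary_rsqrt.hyps
      by (intro elementary_mult elementary_power elementary_const elementary.elementary_rsqrt) auto
  qed
qed

lemma elementary_differentiable: "elementary U f \<Longrightarrow> x \<in> U \<Longrightarrow> f differentiable (at x)"
  using elementary_has_derivative differentiable_def by blast

text \<open>On an open set the iterated derivatives only depend on the values of the function there.\<close>

lemma Ck_on_cong:
  assumes "open U" "Ck_on n U g" "\<And>x. x \<in> U \<Longrightarrow> f x = g x"
  shows "Ck_on n U f"
  using assms(2,3)
proof (induction n arbitrary: f g)
  case 0
  then show ?case by (simp cong: continuous_on_cong)
next
  case (Suc n)
  have D: "(f has_derivative frechet_derivative g (at x)) (at x)" if "x \<in> U" for x
    using Suc.prems that assms(1)
    by (intro has_derivative_transform_within_open[of g _ x UNIV U f])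
      (auto simp: differentiable_on_def at_within_open[OF _ assms(1)] simp flip: frechet_derivative_works)
  hence "f differentiable_on U"
    using differentiable_at_imp_differentiable_on differentiable_def by blast
  moreover have "Ck_on n U (\<lambda>x. frechet_derivative f (at x) v)" for v
  proof (rule Suc.IH)
    show "Ck_on n U (\<lambda>x. frechet_derivative g (at x) v)" using Suc.prems by simp
    show "frechet_derivative f (at x) v = frechet_derivative g (at x) v" if "x \<in> U" for x
      using frechet_derivative_at[OF D[OF that]] by simp
  qed
  ultimately show ?case by simp
qed

lemma smooth_on_componentwise_elementary:
  fixes f :: "'a::euclidean_space \<Rightarrow> 'b::euclidean_space"
  assumes "open U" "\<And>b. b \<in> Basis \<Longrightarrow> elementary U (\<lambda>x. f x \<bullet> b)"
  shows "smooth_on U f"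
proof -
  have "Ck_on n U f" for n
    using assms(2)
  proof (induction n arbitrary: f)
    case 0
    have "f differentiable (at x)" if "x \<in> U" for x
      using 0 that elementary_differentiable by (subst differentiable_componentwise_within) auto
    then show ?case
      by (auto intro!: differentiable_imp_continuous_on differentiable_at_imp_differentiable_on)
  next
    case (Suc n)
    have "\<forall>b\<in>Basis. \<exists>g'. (\<forall>x\<in>U. ((\<lambda>x. f x \<bullet> b) has_derivative g' x) (at x)) \<and> (\<forall>v. elementary U (\<lambda>x. g' x v))"
      using Suc.prems elementary_has_derivative by blast
    then obtain g' where g': "\<And>b x. b \<in> Basis \<Longrightarrow> x \<in> U \<Longrightarrow> ((\<lambda>x. f x \<bullet> b) has_derivative g' b x) (at x)"
      "\<And>b v. b \<in> Basis \<Longrightarrow> elementary U (\<lambda>x. g' b x v)" by metis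
    define f' where "f' x v = (\<Sum>b\<in>Basis. g' b x v *\<^sub>R b)" for x v
    have f': "f' x v \<bullet> b = g' b x v" if "b \<in> Basis" for x v b
      using that by (simp add: f'_def)
    have D: "(f has_derivative f' x) (at x)" if "x \<in> U" for x
      using g'(1)[OF _ that] by (subst has_derivative_componentwise_within) (simp add: f')
    hence "f differentiable_on U"
      using differentiable_at_imp_differentiable_on differentiable_def by blast
    moreover have "Ck_on n U (\<lambda>x. frechet_derivative f (at x) v)" for v
    proof (rule Ck_on_cong[OF assms(1)])
      show "Ck_on n U (\<lambda>x. f' x v)"
        using g'(2) by (intro Suc.IH) (simp add: f')
      show "frechet_derivative f (at x) v = f' x v" if "x \<in> U" for x
        using frechet_derivative_at[OF D[OF that]] by simp
    qed
    ultimately show ?case by simp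
  qed
  thus ?thesis by (simp add: smooth_on_def)
qed

lemma smooth_on_elementary: "open U \<Longrightarrow> elementary U f \<Longrightarrow> smooth_on U f"
  by (rule smooth_on_componentwise_elementary) auto


section \<open>Elementary forms\<close>

text \<open>Forms whose coefficients are elementary; they are smooth, and closed under all operations used.\<close>

definition elementary_form :: "nat \<Rightarrow> 'a::euclidean_space set \<Rightarrow> 'a form \<Rightarrow> bool" where
  "elementary_form k U \<alpha> \<longleftrightarrow>
     (\<forall>x\<in>U. alternating_on UNIV k (\<alpha> x)) \<and> (\<forall>vs. elementary U (\<lambda>x. \<alpha> x vs))"

lemma scale_form_apply: "(f *\<^sub>f \<alpha>) x vs = f x * \<alpha> x vs"
  by (simp add: scale_form_def)

lemma elementary_form_add: "elementary_form k U \<alpha> \<Longrightarrow> elementary_form k U \<beta> \<Longrightarrow> elementary_form k U (\<alpha> + \<beta>)"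
  using alternating_add by (fastforce simp: elementary_form_def plus_fun_def intro: elementary_add)

lemma elementary_form_scale: "elementary U f \<Longrightarrow> elementary_form k U \<alpha> \<Longrightarrow> elementary_form k U (f *\<^sub>f \<alpha>)"
  by (auto simp: elementary_form_def scale_form_def intro: elementary_mult alternating_scale)

lemma elementary_form_minus: "elementary_form k U \<alpha> \<Longrightarrow> elementary_form k U (- \<alpha>)"
  using elementary_form_scale[OF elementary_const[of U "- 1"], of k \<alpha>]
  by (simp add: scale_form_def fun_Compl_def)

lemma elementary_form_diff: "elementary_form k U \<alpha> \<Longrightarrow> elementary_form k U \<beta> \<Longrightarrow> elementary_form k U (\<alpha> - \<beta>)"
  using elementary_form_add[OF _ elementary_form_minus, of k U \<alpha> \<beta>] by simp

lemma elementary_form_wedge: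
  assumes "elementary_form k U \<alpha>" "elementary_form l U \<beta>"
  shows "elementary_form (k + l) U (\<alpha> \<and>\<^sub>f \<beta>)"
proof -
  have "(\<alpha> \<and>\<^sub>f \<beta>) x = shuffle_product (\<alpha> x) (\<beta> x)" for x
    by (simp add: fun_eq_iff wedge_eq_shuffle_product)
  moreover have "elementary U (\<lambda>x. (\<alpha> \<and>\<^sub>f \<beta>) x vs)" for vs
    unfolding wedge_def
    by (intro elementary_sum elementary_mult elementary_const) (use assms in \<open>auto simp: elementary_form_def\<close>)
  ultimately show ?thesis
    using assms by (auto simp: elementary_form_def intro: alternating_shuffle_product)
qed

lemma elementary_form_wedge':
  "elementary_form k U \<alpha> \<Longrightarrow> elementary_form l U \<beta> \<Longrightarrow> m = k + l \<Longrightarrow> elementary_form m U (\<alpha> \<and>\<^sub>f \<beta>)"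
  using elementary_form_wedge by blast

lemma frechet_derivative_bounded_linear: "bounded_linear f \<Longrightarrow> frechet_derivative f (at x) = f"
  by (metis frechet_derivative_at bounded_linear_imp_has_derivative)

lemma lift_apply: "lift \<alpha> p vs = \<alpha> (fst p) (map fst vs)"
proof -
  have "frechet_derivative fst (at p) = (fst :: 'a \<times> real \<Rightarrow> 'a)"
    by (rule frechet_derivative_bounded_linear[OF bounded_linear_fst])
  thus ?thesis by (simp add: pullback_def)
qed

lemma lift_alternating:
  assumes "alternating_on UNIV k a"
  shows "alternating_on UNIV k (\<lambda>vs :: ('a::real_vector \<times> 'b::real_vector) list. a (map fst vs))"
proof -
  have "a (map fst vs) = 0" if "length vs = k" "i < j" "j < k" "vs ! i = vs ! j" for vs :: "('a \<times> 'b) list" and i j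
  proof -
    have "map fst vs ! i = map fst vs ! j" using that by simp
    with that assms show ?thesis unfolding alternating_on_def by (metis length_map top_greatest)
  qed
  with assms show ?thesis unfolding alternating_on_def by (simp add: map_update) blast
qed

lemma elementary_form_lift: "elementary_form k U \<alpha> \<Longrightarrow> elementary_form k (U \<times> UNIV) (lift \<alpha>)"
proof -
  assume *: "elementary_form k U \<alpha>"
  have "elementary (U \<times> UNIV) (\<lambda>x. lift \<alpha> x vs)" for vs
    using elementary_compose_linear[OF _ bounded_linear_fst, of U "\<lambda>x. \<alpha> x (map fst vs)"] *
    by (simp add: lift_apply elementary_form_def vimage_fst)
  moreover have "alternating_on UNIV k (lift \<alpha> x)" if "x \<in> U \<times> UNIV" for x
    using * that lift_alternating[of k "\<alpha> (fst x)"]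
    by (auto simp: elementary_form_def lift_apply[abs_def])
  ultimately show ?thesis by (simp add: elementary_form_def)
qed

lemma dlast_apply: "dlast p vs = (case vs of [v] \<Rightarrow> snd v | _ \<Rightarrow> 0)"
proof -
  have "frechet_derivative snd (at p) = (snd :: 'a \<times> real \<Rightarrow> real)"
    by (rule frechet_derivative_bounded_linear[OF bounded_linear_snd])
  thus ?thesis by (simp add: dlast_def differential_def)
qed

lemma alternating_one:
  assumes "linear f"
  shows "alternating_on UNIV 1 (\<lambda>vs. case vs of [v] \<Rightarrow> f v | _ \<Rightarrow> 0)"
  using assms unfolding alternating_on_def
  by (auto simp: length_Suc_conv linear_add linear_scale split: list.splits)

lemma elementary_form_one:
  assumes "\<And>x. x \<in> U \<Longrightarrow> linear (f x)" "\<And>v. elementary U (\<lambda>x. f x v)"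
  shows "elementary_form 1 U (\<lambda>x vs. case vs of [v] \<Rightarrow> f x v | _ \<Rightarrow> 0)"
  unfolding elementary_form_def
proof (intro conjI ballI allI)
  show "elementary U (\<lambda>x. case vs of [v] \<Rightarrow> f x v | _ \<Rightarrow> 0)" for vs
    using assms by (cases vs rule: remdups_adj.cases) (auto intro: elementary_const)
qed (use assms alternating_one in blast)

lemma elementary_form_dlast: "elementary_form 1 U dlast"
  using elementary_form_one[of U "\<lambda>_. snd"]
  by (simp add: dlast_apply[abs_def] linear_snd elementary_const)

lemma elementary_sinl: "elementary U sinl" and elementary_cosl: "elementary U cosl"
  by (simp_all add: sinl_def[abs_def] cosl_def[abs_def] elementary_sin elementary_cos
      elementary_linear bounded_linear_snd)

lemmas elementary_form_intros =
  elementary_form_add elementary_form_diff elementary_form_minus elementary_form_scale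
  elementary_form_wedge' elementary_form_dlast
  elementary_sinl elementary_cosl elementary_intros

lemma smooth_ambient_form_elementary:
  "open U \<Longrightarrow> elementary_form k U \<alpha> \<Longrightarrow> smooth_ambient_form k U \<alpha>"
  by (simp add: elementary_form_def smooth_ambient_form_def smooth_on_elementary)

lemma smooth_form_elementary:
  assumes "open U" "elementary_form k U \<alpha>" "N \<subseteq> U"
  shows "smooth_form k N \<alpha>"
  unfolding smooth_form_def using assms smooth_ambient_form_elementary
  by (fastforce simp: form_eq_at_def)

lemma has_ext_deriv_elementary:
  assumes "elementary_form k UNIV \<alpha>" "\<And>x. x \<in> N \<Longrightarrow> form_eq_at N x \<beta> (ext_deriv \<alpha>)"
  shows "has_ext_deriv k N \<alpha> \<beta>"
  unfolding has_ext_deriv_def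
  using assms smooth_ambient_form_elementary[of UNIV k \<alpha>]
  by (intro ballI exI[of _ UNIV] exI[of _ \<alpha>]) (auto simp: form_eq_at_def)


section \<open>The exterior derivative\<close>

definition differentiable_form :: "'a::euclidean_space form \<Rightarrow> bool" where
  "differentiable_form \<alpha> \<longleftrightarrow> (\<forall>x vs. (\<lambda>y. \<alpha> y vs) differentiable (at x))"

lemma elementary_form_differentiable: "elementary_form k UNIV \<alpha> \<Longrightarrow> differentiable_form \<alpha>"
  unfolding elementary_form_def differentiable_form_def using elementary_differentiable by blast

lemma ext_deriv_Nil [simp]: "ext_deriv \<alpha> x [] = 0"
  by (simp add: ext_deriv_def)

lemma ext_deriv_Cons:
  "ext_deriv \<alpha> x (v # vs) =
     frechet_derivative (\<lambda>y. \<alpha> y vs) (at x) v - ext_deriv (\<lambda>y. contract v (\<alpha> y)) x vs"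
  by (simp add: ext_deriv_def sum.lessThan_Suc_shift contract_def sum_negf del: sum.lessThan_Suc)

lemma differentiable_form_contract:
  "differentiable_form \<alpha> \<Longrightarrow> differentiable_form (\<lambda>y. contract v (\<alpha> y))"
  by (simp add: differentiable_form_def contract_def)

lemma frechet_derivative_lin_comb:
  fixes f g :: "'a::euclidean_space \<Rightarrow> real"
  assumes "f differentiable (at x)" "g differentiable (at x)"
  shows "frechet_derivative (\<lambda>y. c * f y + d * g y) (at x) v =
    c * frechet_derivative f (at x) v + d * frechet_derivative g (at x) v"
proof -
  have "((\<lambda>y. c * f y + d * g y) has_derivative
      (\<lambda>v. c * frechet_derivative f (at x) v + d * frechet_derivative g (at x) v)) (at x)"
    using assms by (auto intro!: derivative_eq_intros simp: frechet_derivative_works[symmetric])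
  from frechet_derivative_at[OF this] show ?thesis by metis
qed

lemma ext_deriv_lin_comb:
  assumes "differentiable_form \<alpha>" "differentiable_form \<beta>"
  shows "ext_deriv (\<lambda>y vs. c * \<alpha> y vs + d * \<beta> y vs) x vs = c * ext_deriv \<alpha> x vs + d * ext_deriv \<beta> x vs"
  using assms
  by (simp add: ext_deriv_def differentiable_form_def frechet_derivative_lin_comb sum.distrib
      sum_distrib_left algebra_simps)

lemma ext_deriv_add:
  "differentiable_form \<alpha> \<Longrightarrow> differentiable_form \<beta> \<Longrightarrow> ext_deriv (\<alpha> + \<beta>) = ext_deriv \<alpha> + ext_deriv \<beta>"
  using ext_deriv_lin_comb[of \<alpha> \<beta> 1 1] by (simp add: fun_eq_iff plus_fun_def)

lemma ext_deriv_diff: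
  "differentiable_form \<alpha> \<Longrightarrow> differentiable_form \<beta> \<Longrightarrow> ext_deriv (\<alpha> - \<beta>) = ext_deriv \<alpha> - ext_deriv \<beta>"
  using ext_deriv_lin_comb[of \<alpha> \<beta> 1 "- 1"] by (simp add: fun_eq_iff fun_diff_def)

lemma ext_deriv_minus: "differentiable_form \<alpha> \<Longrightarrow> ext_deriv (- \<alpha>) = - ext_deriv \<alpha>"
  using ext_deriv_lin_comb[of \<alpha> \<alpha> "- 1" 0] by (simp add: fun_eq_iff fun_Compl_def)

text \<open>
  The Leibniz rule, by induction on the list of arguments. For a constant vector \<open>v\<close>, Cartan's formula
  \<open>ext_deriv_Cons\<close> expresses the contraction of an exterior derivative with \<open>v\<close> by the directional
  derivative along \<open>v\<close> and the exterior derivative of the contraction. The former obeys the ordinary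
  product rule, and the latter is covered by the induction hypothesis and the antiderivation law.
\<close>

lemma ext_deriv_shuffle_product:
  assumes "differentiable_form \<alpha>" "differentiable_form \<beta>"
  shows "ext_deriv (\<lambda>y. shuffle_product (\<alpha> y) (\<beta> y)) x vs =
    shuffle_product (ext_deriv \<alpha> x) (\<beta> x) vs + shuffle_product (grade_sign (\<alpha> x)) (ext_deriv \<beta> x) vs"
  using assms
proof (induction vs arbitrary: \<alpha> \<beta>)
  case (Cons v vs)
  define \<alpha>' where "\<alpha>' ws = frechet_derivative (\<lambda>y. \<alpha> y ws) (at x) v" for ws
  define \<beta>' where "\<beta>' ws = frechet_derivative (\<lambda>y. \<beta> y ws) (at x) v" for ws
  have diff: "(\<lambda>y. \<alpha> y ws) differentiable (at x)" "(\<lambda>y. \<beta> y ws) differentiable (at x)" for ws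
    using Cons.prems by (auto simp: differentiable_form_def)
  have sign: "differentiable_form (\<lambda>y. grade_sign (\<gamma> y))" if "differentiable_form \<gamma>" for \<gamma> :: "'a form"
    using that by (auto simp: differentiable_form_def grade_sign_def intro!: derivative_intros)
  have dsign: "ext_deriv (\<lambda>y. grade_sign (\<alpha> y)) x = (\<lambda>ws. - 1 * grade_sign (ext_deriv \<alpha> x) ws)"
  proof
    fix ws :: "'a list"
    have "(- 1) ^ (length ws - Suc 0) = - ((- 1) ^ length ws :: real)" if "i < length ws" for i
      using that by (cases "length ws") auto
    thus "ext_deriv (\<lambda>y. grade_sign (\<alpha> y)) x ws = - 1 * grade_sign (ext_deriv \<alpha> x) ws"
      unfolding grade_sign_def ext_deriv_def sum_distrib_left
      using frechet_derivative_lin_comb[OF diff(1) diff(1), of "(- 1) ^ (length ws - Suc 0)" _ 0]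
      by (intro sum.cong refl) (auto simp: min_def)
  qed
  have prod_diff: "differentiable_form (\<lambda>y. shuffle_product (\<gamma> y) (\<delta> y))"
    if "differentiable_form \<gamma>" "differentiable_form \<delta>" for \<gamma> \<delta> :: "'a form"
    using that unfolding differentiable_form_def shuffle_product_def
    by (auto intro!: derivative_intros)
  have prod_deriv: "frechet_derivative (\<lambda>y. shuffle_product (\<alpha> y) (\<beta> y) vs) (at x) v =
      shuffle_product \<alpha>' (\<beta> x) vs + shuffle_product (\<alpha> x) \<beta>' vs"
  proof -
    have "((\<lambda>y. \<alpha> y ws) has_derivative frechet_derivative (\<lambda>y. \<alpha> y ws) (at x)) (at x)"
      "((\<lambda>y. \<beta> y ws) has_derivative frechet_derivative (\<lambda>y. \<beta> y ws) (at x)) (at x)" for ws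
      using diff by (simp_all add: frechet_derivative_works[symmetric])
    note [derivative_intros] = this
    let ?s = "\<lambda>I. (- 1) ^ card {(i, j). i \<in> I \<and> j \<in> {..<length vs} - I \<and> j < i}"
    have "((\<lambda>y. shuffle_product (\<alpha> y) (\<beta> y) vs) has_derivative (\<lambda>v. \<Sum>I\<in>Pow {..<length vs}.
       ?s I * \<alpha> x (nths vs I) * frechet_derivative (\<lambda>y. \<beta> y (nths vs (- I))) (at x) v
       + ?s I * frechet_derivative (\<lambda>y. \<alpha> y (nths vs I)) (at x) v * \<beta> x (nths vs (- I)))) (at x)"
      unfolding shuffle_product_def by (auto intro!: derivative_eq_intros simp: fun_eq_iff)
    from frechet_derivative_at[OF this, symmetric] show ?thesis
      by (simp add: shuffle_product_def \<alpha>'_def \<beta>'_def sum.distrib)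
  qed
  have "ext_deriv (\<lambda>y. shuffle_product (\<alpha> y) (\<beta> y)) x (v # vs) =
      shuffle_product \<alpha>' (\<beta> x) vs + shuffle_product (\<alpha> x) \<beta>' vs
      - (ext_deriv (\<lambda>y. shuffle_product (contract v (\<alpha> y)) (\<beta> y)) x vs
         + ext_deriv (\<lambda>y. shuffle_product (grade_sign (\<alpha> y)) (contract v (\<beta> y))) x vs)"
    unfolding ext_deriv_Cons prod_deriv contract_shuffle_product
    using ext_deriv_lin_comb[OF prod_diff prod_diff, of _ _ _ _ 1 1] Cons.prems
    by (simp add: differentiable_form_contract sign)
  also have "\<dots> = shuffle_product (ext_deriv \<alpha> x) (\<beta> x) (v # vs)
      + shuffle_product (grade_sign (\<alpha> x)) (ext_deriv \<beta> x) (v # vs)"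
  proof -
    have contr: "contract v (ext_deriv \<alpha> x) = (\<lambda>ws. \<alpha>' ws + - 1 * ext_deriv (\<lambda>y. contract v (\<alpha> y)) x ws)"
      "contract v (ext_deriv \<beta> x) = (\<lambda>ws. \<beta>' ws + - 1 * ext_deriv (\<lambda>y. contract v (\<beta> y)) x ws)"
      by (simp_all add: fun_eq_iff contract_def[of v "ext_deriv _ _"] ext_deriv_Cons \<alpha>'_def \<beta>'_def)
    show ?thesis
      unfolding Cons.IH[OF differentiable_form_contract[OF Cons.prems(1)] Cons.prems(2)]
        Cons.IH[OF sign[OF Cons.prems(1)] differentiable_form_contract[OF Cons.prems(2)]]
        shuffle_product_Cons contr dsign contract_grade_sign shuffle_product_linear
        grade_sign_grade_sign
      by simp
  qed
  finally show ?case .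
qed simp

definition odd_form :: "'a form \<Rightarrow> bool" where
  "odd_form \<alpha> \<longleftrightarrow> (\<forall>x. has_parity True (\<alpha> x))"

definition even_form :: "'a form \<Rightarrow> bool" where
  "even_form \<alpha> \<longleftrightarrow> (\<forall>x. has_parity False (\<alpha> x))"

lemma wedge_eq: "\<alpha> \<and>\<^sub>f \<beta> = (\<lambda>y. shuffle_product (\<alpha> y) (\<beta> y))"
  by (simp add: fun_eq_iff wedge_eq_shuffle_product)

lemma ext_deriv_wedge_odd:
  assumes "differentiable_form \<alpha>" "differentiable_form \<beta>" "odd_form \<alpha>"
  shows "ext_deriv (\<alpha> \<and>\<^sub>f \<beta>) = ext_deriv \<alpha> \<and>\<^sub>f \<beta> - \<alpha> \<and>\<^sub>f ext_deriv \<beta>"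
proof (intro ext)
  fix x vs
  have "grade_sign (\<alpha> x) = (\<lambda>ws. - 1 * \<alpha> x ws)"
    using grade_sign_has_parity[of True "\<alpha> x"] assms(3) by (simp add: odd_form_def)
  thus "ext_deriv (\<alpha> \<and>\<^sub>f \<beta>) x vs = (ext_deriv \<alpha> \<and>\<^sub>f \<beta> - \<alpha> \<and>\<^sub>f ext_deriv \<beta>) x vs"
    unfolding wedge_eq ext_deriv_shuffle_product[OF assms(1,2)] fun_diff_def
    by (simp only: shuffle_product_scale_left)
qed

lemma ext_deriv_wedge_even:
  assumes "differentiable_form \<alpha>" "differentiable_form \<beta>" "even_form \<alpha>"
  shows "ext_deriv (\<alpha> \<and>\<^sub>f \<beta>) = ext_deriv \<alpha> \<and>\<^sub>f \<beta> + \<alpha> \<and>\<^sub>f ext_deriv \<beta>"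
proof (intro ext)
  fix x vs
  have "grade_sign (\<alpha> x) = \<alpha> x"
    using grade_sign_has_parity[of False "\<alpha> x"] assms(3) by (simp add: even_form_def)
  thus "ext_deriv (\<alpha> \<and>\<^sub>f \<beta>) x vs = (ext_deriv \<alpha> \<and>\<^sub>f \<beta> + \<alpha> \<and>\<^sub>f ext_deriv \<beta>) x vs"
    unfolding wedge_eq ext_deriv_shuffle_product[OF assms(1,2)] plus_fun_def by simp
qed

lemma shuffle_product_scalar:
  assumes "\<And>vs. vs \<noteq> [] \<Longrightarrow> a vs = 0"
  shows "shuffle_product a b vs = a [] * b vs"
  using assms
proof (induction vs arbitrary: b)
  case (Cons v vs)
  have "contract v a = (\<lambda>_. 0)" "grade_sign a = a"
    using Cons.prems by (auto simp: contract_def grade_sign_def fun_eq_iff) (metis power_0 list.size(3) mult_1 mult_zero_right)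
  then show ?case using Cons.IH[OF Cons.prems] by (simp add: shuffle_product_Cons contract_def)
qed simp

text \<open>A function is a \<open>0\<close>-form, and scaling by it is a wedge product.\<close>

lemma ext_deriv_scale:
  assumes "\<And>x. f differentiable (at x)" "differentiable_form \<alpha>"
  shows "ext_deriv (f *\<^sub>f \<alpha>) = differential f \<and>\<^sub>f \<alpha> + f *\<^sub>f ext_deriv \<alpha>"
proof -
  define f0 :: "'a form" where "f0 = (\<lambda>x vs. if vs = [] then f x else 0)"
  have f0: "differentiable_form f0" "even_form f0"
  proof -
    have "(\<lambda>x. if vs = [] then f x else 0) differentiable (at x)" for vs :: "'a list" and x
      using assms(1) by (cases "vs = []") simp_all
    thus "differentiable_form f0" by (simp add: differentiable_form_def f0_def)
  qed (auto simp: even_form_def has_parity_def f0_def)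
  have eq: "f0 \<and>\<^sub>f \<beta> = f *\<^sub>f \<beta>" for \<beta>
  proof (intro ext)
    show "(f0 \<and>\<^sub>f \<beta>) x vs = (f *\<^sub>f \<beta>) x vs" for x vs
      using shuffle_product_scalar[of "f0 x" "\<beta> x" vs]
      by (simp add: wedge_eq_shuffle_product scale_form_apply f0_def)
  qed
  have "ext_deriv f0 = differential f"
  proof (intro ext)
    show "ext_deriv f0 x vs = differential f x vs" for x vs
    proof (cases vs rule: remdups_adj.cases)
      case (3 u w ws)
      then show ?thesis by (auto simp: ext_deriv_def differential_def f0_def take_Cons' intro!: sum.neutral)
    qed (simp_all add: ext_deriv_def differential_def f0_def)
  qed
  with ext_deriv_wedge_even[OF f0(1) assms(2) f0(2)] show ?thesis by (simp add: eq)
qed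

lemma ext_deriv_lift:
  assumes "differentiable_form \<alpha>"
  shows "ext_deriv (lift \<alpha>) = lift (ext_deriv \<alpha>)"
proof (intro ext)
  fix p :: "'a \<times> real" and vs
  have "frechet_derivative (\<lambda>y. \<alpha> (fst y) ws) (at p) v = frechet_derivative (\<lambda>y. \<alpha> y ws) (at (fst p)) (fst v)" for ws v
  proof -
    have "((\<lambda>y. \<alpha> y ws) has_derivative frechet_derivative (\<lambda>y. \<alpha> y ws) (at (fst p))) (at (fst p))"
      using assms by (simp add: differentiable_form_def frechet_derivative_works[symmetric])
    from has_derivative_compose[OF bounded_linear_imp_has_derivative[OF bounded_linear_fst] this]
    have "((\<lambda>y. \<alpha> (fst y) ws) has_derivative
        (\<lambda>v. frechet_derivative (\<lambda>y. \<alpha> y ws) (at (fst p)) (fst v))) (at p)" by simp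
    from frechet_derivative_at[OF this] show ?thesis by metis
  qed
  thus "ext_deriv (lift \<alpha>) p vs = lift (ext_deriv \<alpha>) p vs"
    by (simp add: ext_deriv_def lift_apply take_map drop_map)
qed

lemma ext_deriv_dlast: "ext_deriv dlast = 0"
proof (intro ext)
  show "ext_deriv dlast x vs = 0 x vs" for x vs
    by (simp add: ext_deriv_def dlast_apply frechet_derivative_const)
qed


section \<open>The graded algebra of forms\<close>

lemma wedge_add_left: "(\<alpha> + \<beta>) \<and>\<^sub>f \<gamma> = \<alpha> \<and>\<^sub>f \<gamma> + \<beta> \<and>\<^sub>f \<gamma>"
  by (simp add: wedge_eq plus_fun_def shuffle_product_linear fun_eq_iff)

lemma wedge_add_right: "\<gamma> \<and>\<^sub>f (\<alpha> + \<beta>) = \<gamma> \<and>\<^sub>f \<alpha> + \<gamma> \<and>\<^sub>f \<beta>"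
  by (simp add: wedge_eq plus_fun_def shuffle_product_linear fun_eq_iff)

lemma wedge_scale_left: "(f *\<^sub>f \<alpha>) \<and>\<^sub>f \<gamma> = f *\<^sub>f (\<alpha> \<and>\<^sub>f \<gamma>)"
  by (simp add: wedge_eq scale_form_def shuffle_product_linear fun_eq_iff)

lemma wedge_scale_right: "\<gamma> \<and>\<^sub>f (f *\<^sub>f \<alpha>) = f *\<^sub>f (\<gamma> \<and>\<^sub>f \<alpha>)"
  by (simp add: wedge_eq scale_form_def shuffle_product_linear fun_eq_iff)

lemma minus_eq_scale: "- \<alpha> = (\<lambda>_. - 1) *\<^sub>f \<alpha>"
  by (simp add: fun_eq_iff fun_Compl_def scale_form_def)

lemma wedge_minus_left: "(- \<alpha>) \<and>\<^sub>f \<gamma> = - (\<alpha> \<and>\<^sub>f \<gamma>)"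
  by (simp only: minus_eq_scale wedge_scale_left)

lemma wedge_minus_right: "\<gamma> \<and>\<^sub>f (- \<alpha>) = - (\<gamma> \<and>\<^sub>f \<alpha>)"
  by (simp only: minus_eq_scale wedge_scale_right)

lemma wedge_diff_left: "(\<alpha> - \<beta>) \<and>\<^sub>f \<gamma> = \<alpha> \<and>\<^sub>f \<gamma> - \<beta> \<and>\<^sub>f \<gamma>"
  using wedge_add_left[of \<alpha> "- \<beta>" \<gamma>] by (simp add: wedge_minus_left)

lemma wedge_diff_right: "\<gamma> \<and>\<^sub>f (\<alpha> - \<beta>) = \<gamma> \<and>\<^sub>f \<alpha> - \<gamma> \<and>\<^sub>f \<beta>"
  using wedge_add_right[of \<gamma> \<alpha> "- \<beta>"] by (simp add: wedge_minus_right)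

lemma wedge_zero: "0 \<and>\<^sub>f \<gamma> = 0" "\<gamma> \<and>\<^sub>f 0 = 0"
  using wedge_diff_left[of \<gamma> \<gamma> \<gamma>] wedge_diff_right[of \<gamma> \<gamma> \<gamma>] by simp_all

lemma wedge_assoc: "(\<alpha> \<and>\<^sub>f \<beta>) \<and>\<^sub>f \<gamma> = \<alpha> \<and>\<^sub>f (\<beta> \<and>\<^sub>f \<gamma>)"
  by (simp add: wedge_eq shuffle_product_assoc fun_eq_iff)

lemma form_apply:
  "(\<alpha> + \<beta>) x vs = \<alpha> x vs + \<beta> x vs" "(\<alpha> - \<beta>) x vs = \<alpha> x vs - \<beta> x vs" "(- \<alpha>) x vs = - \<alpha> x vs"
  "(0 :: 'a form) x vs = 0" "(f *\<^sub>f \<alpha>) x vs = f x * \<alpha> x vs"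
  for \<alpha> \<beta> :: "'a form"
  by (simp_all add: plus_fun_def fun_diff_def fun_Compl_def scale_form_def)

lemmas wedge_linear =
  wedge_add_left wedge_add_right wedge_scale_left wedge_scale_right wedge_minus_left wedge_minus_right
  wedge_diff_left wedge_diff_right wedge_zero

lemma odd_wedge_odd: "odd_form \<alpha> \<Longrightarrow> odd_form \<beta> \<Longrightarrow> \<beta> \<and>\<^sub>f \<alpha> = - (\<alpha> \<and>\<^sub>f \<beta>)"
  unfolding odd_form_def wedge_eq fun_Compl_def
  by (intro ext) (subst shuffle_product_commute[of True _ True]; simp)

lemma wedge_commute_even: "even_form \<alpha> \<Longrightarrow> odd_form \<beta> \<or> even_form \<beta> \<Longrightarrow> \<beta> \<and>\<^sub>f \<alpha> = \<alpha> \<and>\<^sub>f \<beta>"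
  unfolding odd_form_def even_form_def wedge_eq
  by (intro ext, elim disjE)
    (subst shuffle_product_commute[of False _ True], simp_all, subst shuffle_product_commute[of False _ False], simp_all)

lemma wedge_left_commute_odd:
  assumes "odd_form \<alpha>" "odd_form \<beta>" shows "\<beta> \<and>\<^sub>f (\<alpha> \<and>\<^sub>f \<gamma>) = - (\<alpha> \<and>\<^sub>f (\<beta> \<and>\<^sub>f \<gamma>))"
  by (simp only: wedge_assoc[symmetric] odd_wedge_odd[OF assms] wedge_minus_left)

lemma wedge_left_commute_even:
  assumes "even_form \<alpha>" "odd_form \<beta> \<or> even_form \<beta>" shows "\<beta> \<and>\<^sub>f (\<alpha> \<and>\<^sub>f \<gamma>) = \<alpha> \<and>\<^sub>f (\<beta> \<and>\<^sub>f \<gamma>)"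
  by (simp only: wedge_assoc[symmetric] wedge_commute_even[OF assms])

lemma odd_wedge_self:
  assumes "odd_form \<alpha>" shows "\<alpha> \<and>\<^sub>f \<alpha> = 0" "\<alpha> \<and>\<^sub>f (\<alpha> \<and>\<^sub>f \<gamma>) = 0"
proof -
  show 1: "\<alpha> \<and>\<^sub>f \<alpha> = 0"
    using odd_wedge_odd[OF assms assms] by (simp add: fun_eq_iff fun_Compl_def)
  show "\<alpha> \<and>\<^sub>f (\<alpha> \<and>\<^sub>f \<gamma>) = 0" by (simp add: wedge_assoc[symmetric] 1 wedge_zero)
qed

text \<open>A parity is all that the sign rules require of a form.\<close>

lemma alternating_form_parity:
  "(\<And>x. alternating_on UNIV k (\<alpha> x)) \<Longrightarrow> odd k \<Longrightarrow> odd_form \<alpha>"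
  "(\<And>x. alternating_on UNIV k (\<alpha> x)) \<Longrightarrow> even k \<Longrightarrow> even_form \<alpha>"
  using alternating_parity by (fastforce simp: odd_form_def even_form_def)+

lemma elementary_form_parity:
  "elementary_form k UNIV \<alpha> \<Longrightarrow> odd k \<Longrightarrow> odd_form \<alpha>"
  "elementary_form k UNIV \<alpha> \<Longrightarrow> even k \<Longrightarrow> even_form \<alpha>"
  using alternating_form_parity by (auto simp: elementary_form_def)

lemma lift_linear:
  "lift (\<alpha> + \<beta>) = lift \<alpha> + lift \<beta>" "lift (\<alpha> - \<beta>) = lift \<alpha> - lift \<beta>" "lift (- \<alpha>) = - lift \<alpha>"
  "lift 0 = 0" "lift ((\<lambda>_. c) *\<^sub>f \<alpha>) = (\<lambda>_. c) *\<^sub>f lift \<alpha>"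
  by (simp_all add: fun_eq_iff lift_apply form_apply)

lemma lift_wedge: "lift (\<alpha> \<and>\<^sub>f \<beta>) = lift \<alpha> \<and>\<^sub>f lift \<beta>"
  by (simp add: fun_eq_iff wedge_def lift_apply nths_map)

lemma lift_parity: "odd_form \<alpha> \<Longrightarrow> odd_form (lift \<alpha>)" "even_form \<alpha> \<Longrightarrow> even_form (lift \<alpha>)"
  by (simp_all add: odd_form_def even_form_def has_parity_def lift_apply)

lemma odd_dlast: "odd_form dlast"
  by (rule elementary_form_parity(1)[OF elementary_form_dlast]) simp

text \<open>Equality on tangent vectors is a congruence, since a form only sees the vectors that it is given.\<close>

lemma form_eq_at_add: "form_eq_at N x \<alpha> \<alpha>' \<Longrightarrow> form_eq_at N x \<beta> \<beta>' \<Longrightarrow> form_eq_at N x (\<alpha> + \<beta>) (\<alpha>' + \<beta>')"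
  by (simp add: form_eq_at_def plus_fun_def)

lemma form_eq_at_diff: "form_eq_at N x \<alpha> \<alpha>' \<Longrightarrow> form_eq_at N x \<beta> \<beta>' \<Longrightarrow> form_eq_at N x (\<alpha> - \<beta>) (\<alpha>' - \<beta>')"
  by (simp add: form_eq_at_def fun_diff_def)

lemma form_eq_at_minus: "form_eq_at N x \<alpha> \<alpha>' \<Longrightarrow> form_eq_at N x (- \<alpha>) (- \<alpha>')"
  by (simp add: form_eq_at_def fun_Compl_def)

lemma form_eq_at_scale: "form_eq_at N x \<alpha> \<alpha>' \<Longrightarrow> form_eq_at N x (f *\<^sub>f \<alpha>) (f *\<^sub>f \<alpha>')"
  by (simp add: form_eq_at_def scale_form_def)

lemma form_eq_at_wedge:
  "form_eq_at N x \<alpha> \<alpha>' \<Longrightarrow> form_eq_at N x \<beta> \<beta>' \<Longrightarrow> form_eq_at N x (\<alpha> \<and>\<^sub>f \<beta>) (\<alpha>' \<and>\<^sub>f \<beta>')"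
  unfolding form_eq_at_def wedge_eq_shuffle_product
  by (intro allI impI shuffle_product_cong) (meson order_trans)+

lemma form_eq_at_refl: "form_eq_at N x \<alpha> \<alpha>"
  by (simp add: form_eq_at_def)

lemma form_eq_at_trans: "form_eq_at N x \<alpha> \<beta> \<Longrightarrow> form_eq_at N x \<beta> \<gamma> \<Longrightarrow> form_eq_at N x \<alpha> \<gamma>"
  by (simp add: form_eq_at_def)

lemma form_eq_at_lift:
  assumes "fst ` tangent_space M p \<subseteq> tangent_space N (fst p)" "form_eq_at N (fst p) \<alpha> \<beta>"
  shows "form_eq_at M p (lift \<alpha>) (lift \<beta>)"
  using assms unfolding form_eq_at_def lift_apply by (metis image_mono order_trans set_map)

lemmas form_eq_at_cong =
  form_eq_at_add form_eq_at_diff form_eq_at_minus form_eq_at_scale form_eq_at_wedge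

lemma differentiable_form_add:
  "differentiable_form \<alpha> \<Longrightarrow> differentiable_form \<beta> \<Longrightarrow> differentiable_form (\<alpha> + \<beta>)"
  by (simp add: differentiable_form_def plus_fun_def)

lemma differentiable_form_minus: "differentiable_form \<alpha> \<Longrightarrow> differentiable_form (- \<alpha>)"
  by (simp add: differentiable_form_def fun_Compl_def)

lemma differentiable_form_diff:
  "differentiable_form \<alpha> \<Longrightarrow> differentiable_form \<beta> \<Longrightarrow> differentiable_form (\<alpha> - \<beta>)"
  by (simp add: differentiable_form_def fun_diff_def)

lemma differentiable_form_scale:
  "(\<And>x. f differentiable (at x)) \<Longrightarrow> differentiable_form \<alpha> \<Longrightarrow> differentiable_form (f *\<^sub>f \<alpha>)"
  by (simp add: differentiable_form_def scale_form_def)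

lemma differentiable_form_wedge:
  "differentiable_form \<alpha> \<Longrightarrow> differentiable_form \<beta> \<Longrightarrow> differentiable_form (\<alpha> \<and>\<^sub>f \<beta>)"
  unfolding differentiable_form_def wedge_def by (auto intro!: derivative_intros)

lemma differentiable_form_lift:
  assumes "differentiable_form \<alpha>" shows "differentiable_form (lift \<alpha>)"
  unfolding differentiable_form_def lift_apply
proof (intro allI)
  fix p :: "'a \<times> real" and vs
  have "(\<lambda>y. \<alpha> y (map fst vs)) differentiable (at (fst p))"
    using assms by (simp add: differentiable_form_def)
  thus "(\<lambda>y. \<alpha> (fst y) (map fst vs)) differentiable (at p)"
    using has_derivative_compose[OF bounded_linear_imp_has_derivative[OF bounded_linear_fst]]
    unfolding differentiable_def by blast
qed

lemma differentiable_form_dlast: "differentiable_form dlast"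
  by (rule elementary_form_differentiable[OF elementary_form_dlast])

lemma cosl_squared: "cosl p * cosl p = 1 - sinl p * sinl p"
  using cos_squared_eq[of "snd p"] by (simp add: sinl_def cosl_def power2_eq_square)

lemma differentiable_sinl_cosl: "sinl differentiable (at p)" "cosl differentiable (at p)" for p :: "'a::euclidean_space \<times> real"
proof -
  show "sinl differentiable (at p)" by (rule elementary_differentiable[OF elementary_sinl UNIV_I])
  show "cosl differentiable (at p)" by (rule elementary_differentiable[OF elementary_cosl UNIV_I])
qed

lemma differential_sinl_cosl:
  "differential sinl = cosl *\<^sub>f (dlast :: ('a::euclidean_space \<times> real) form)"
  "differential cosl = - (sinl *\<^sub>f (dlast :: ('a \<times> real) form))"
  "differential (\<lambda>p. sinl p ^ n) = (\<lambda>p. n * sinl p ^ (n - 1) * cosl p) *\<^sub>f (dlast :: ('a \<times> real) form)"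
proof -
  have snd: "(snd has_derivative snd) (at p)" for p :: "'a \<times> real"
    by (rule bounded_linear_imp_has_derivative[OF bounded_linear_snd])
  have "(sinl has_derivative (\<lambda>v. cosl p * snd v)) (at p)" "(cosl has_derivative (\<lambda>v. - (sinl p * snd v))) (at p)"
    "((\<lambda>p. sinl p ^ n) has_derivative (\<lambda>v. n * sinl p ^ (n - 1) * cosl p * snd v)) (at p)" for p :: "'a \<times> real"
    unfolding sinl_def[abs_def] cosl_def[abs_def]
    by (auto intro!: derivative_eq_intros snd)
  note this[THEN frechet_derivative_at, symmetric]
  thus "differential sinl = cosl *\<^sub>f (dlast :: ('a \<times> real) form)"
    "differential cosl = - (sinl *\<^sub>f (dlast :: ('a \<times> real) form))"
    "differential (\<lambda>p. sinl p ^ n) = (\<lambda>p. n * sinl p ^ (n - 1) * cosl p) *\<^sub>f (dlast :: ('a \<times> real) form)"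
    by (auto simp: differential_def fun_eq_iff form_apply dlast_apply split: list.splits)
qed

lemmas differentiable_form_rules =
  differentiable_form_add differentiable_form_diff differentiable_form_minus differentiable_form_scale differentiable_form_wedge
  differentiable_form_lift differentiable_form_dlast differentiable_sinl_cosl differentiable_power

lemmas ext_deriv_rules =
  ext_deriv_add ext_deriv_diff ext_deriv_minus ext_deriv_scale ext_deriv_wedge_odd ext_deriv_wedge_even
  ext_deriv_lift ext_deriv_dlast differential_sinl_cosl


section \<open>Tangent spaces\<close>

lemma tangent_space_sphere:
  fixes x :: "'a::euclidean_space"
  assumes x: "norm x = 1"
  shows "tangent_space (sphere 0 1) x = {v. x \<bullet> v = 0}"
proof (intro equalityI subsetI)
  fix v assume "v \<in> tangent_space (sphere 0 1) x"
  then obtain c \<epsilon> where c: "\<epsilon> > 0" "c 0 = x" "\<And>s. \<bar>s\<bar> < \<epsilon> \<Longrightarrow> c s \<in> sphere 0 1"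
    "(c has_vector_derivative v) (at (0::real))" by (auto simp: tangent_space_def)
  have "((\<lambda>s. c s \<bullet> c s) has_derivative (\<lambda>s. c 0 \<bullet> (s *\<^sub>R v) + (s *\<^sub>R v) \<bullet> c 0)) (at 0)"
    using c(4) unfolding has_vector_derivative_def by (intro has_derivative_inner)
  moreover have "((\<lambda>s. c s \<bullet> c s) has_derivative (\<lambda>_. 0)) (at 0)"
  proof (rule has_derivative_transform_within_open[of "\<lambda>_. 1" _ 0 UNIV "{- \<epsilon><..<\<epsilon>}"])
    show "1 = c s \<bullet> c s" if "s \<in> {- \<epsilon><..<\<epsilon>}" for s
      using c(3)[of s] that by (auto simp: norm_eq_1 abs_less_iff)
  qed (use c(1) in auto)
  ultimately have "(\<lambda>s. c 0 \<bullet> (s *\<^sub>R v) + (s *\<^sub>R v) \<bullet> c 0) = (\<lambda>_. 0)"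
    by (rule has_derivative_unique)
  from fun_cong[OF this, of 1] show "v \<in> {v. x \<bullet> v = 0}"
    by (simp add: c(2) inner_commute)
next
  fix v assume "v \<in> {v. x \<bullet> v = 0}"
  hence v: "x \<bullet> v = 0" by simp
  \<comment> \<open>The curve is the radial projection of a straight line.\<close>
  define c where "c s = inverse (sqrt (1 + s\<^sup>2 * (v \<bullet> v))) *\<^sub>R (x + s *\<^sub>R v)" for s :: real
  have pos: "0 < 1 + s\<^sup>2 * (v \<bullet> v)" for s :: real
    by (rule add_pos_nonneg) auto
  have "c s \<in> sphere 0 1" for s
  proof -
    have "(x + s *\<^sub>R v) \<bullet> (x + s *\<^sub>R v) = 1 + s\<^sup>2 * (v \<bullet> v)"
      using x v by (simp add: algebra_simps norm_eq_1 inner_commute[of v x] power2_eq_square)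
    hence "norm (x + s *\<^sub>R v) = sqrt (1 + s\<^sup>2 * (v \<bullet> v))" by (simp add: norm_eq_sqrt_inner)
    with pos[of s] show ?thesis by (simp add: c_def)
  qed
  moreover have "(c has_vector_derivative v) (at 0)"
  proof -
    have "((\<lambda>s. 1 + s\<^sup>2 * (v \<bullet> v)) has_real_derivative 0) (at 0)"
      by (auto intro!: derivative_eq_intros)
    hence "((\<lambda>s. inverse (sqrt (1 + s\<^sup>2 * (v \<bullet> v)))) has_real_derivative 0) (at 0)"
      by (auto intro!: derivative_eq_intros)
    hence "((\<lambda>s. inverse (sqrt (1 + s\<^sup>2 * (v \<bullet> v)))) has_vector_derivative 0) (at 0)"
      by (simp add: has_real_derivative_iff_has_vector_derivative)
    thus ?thesis unfolding c_def
      by (auto intro!: derivative_eq_intros)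
  qed
  ultimately show "v \<in> tangent_space (sphere 0 1) x"
    unfolding tangent_space_def using x by (intro CollectI exI[of _ c] exI[of _ 1]) (auto simp: c_def)
qed

lemma tangent_space_Times_open:
  fixes N :: "'a::euclidean_space set" and V :: "real set"
  assumes "open V" "t \<in> V"
  shows "tangent_space (N \<times> V) (x, t) = tangent_space N x \<times> UNIV"
proof (intro equalityI subsetI)
  fix v assume "v \<in> tangent_space (N \<times> V) (x, t)"
  then obtain c \<epsilon> where c: "\<epsilon> > 0" "c 0 = (x, t)" "\<And>s. \<bar>s\<bar> < \<epsilon> \<Longrightarrow> c s \<in> N \<times> V"
    "(c has_vector_derivative v) (at (0::real))" by (auto simp: tangent_space_def)
  have "((\<lambda>s. fst (c s)) has_vector_derivative fst v) (at 0)"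
    by (rule bounded_linear.has_vector_derivative[OF bounded_linear_fst c(4)])
  with c have "fst v \<in> tangent_space N x"
    unfolding tangent_space_def by (intro CollectI exI[of _ "\<lambda>s. fst (c s)"] exI[of _ \<epsilon>]) (auto simp: mem_Times_iff)
  thus "v \<in> tangent_space N x \<times> UNIV" by (simp add: mem_Times_iff)
next
  fix v assume "v \<in> tangent_space N x \<times> (UNIV :: real set)"
  then obtain u r where v: "v = (u, r)" "u \<in> tangent_space N x" by (cases v) auto
  then obtain c \<epsilon> where c: "\<epsilon> > 0" "c 0 = x" "\<And>s. \<bar>s\<bar> < \<epsilon> \<Longrightarrow> c s \<in> N"
    "(c has_vector_derivative u) (at (0::real))" by (auto simp: tangent_space_def)
  have "continuous_on UNIV (\<lambda>s. t + s * r)" by (intro continuous_intros)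
  hence "open ((\<lambda>s. t + s * r) -` V)" using assms(1) by (simp add: continuous_on_open_vimage)
  moreover have "0 \<in> (\<lambda>s. t + s * r) -` V" using assms(2) by simp
  ultimately obtain \<delta> where \<delta>: "\<delta> > 0" "ball 0 \<delta> \<subseteq> (\<lambda>s. t + s * r) -` V"
    by (meson openE)
  have "((\<lambda>s. (c s, t + s * r)) has_vector_derivative (u, r)) (at 0)"
    using c(4) by (intro has_vector_derivative_Pair) (auto intro!: derivative_eq_intros)
  moreover have "(c s, t + s * r) \<in> N \<times> V" if "\<bar>s\<bar> < min \<epsilon> \<delta>" for s
    using c(3)[of s] \<delta>(2) that by auto
  ultimately show "v \<in> tangent_space (N \<times> V) (x, t)"
    unfolding tangent_space_def v using c(1,2) \<delta>(1)
    by (intro CollectI exI[of _ "\<lambda>s. (c s, t + s * r)"] exI[of _ "min \<epsilon> \<delta>"]) auto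
qed


section \<open>Coframes\<close>

text \<open>Each functional cuts the dimension by at most one, and together they cut \<open>T\<close> down to zero.\<close>

lemma dim_le_card_separating_functionals:
  fixes T :: "'a::euclidean_space set" and f :: "'i \<Rightarrow> 'a \<Rightarrow> real"
  assumes "finite I" "subspace T"
    and "\<And>i u w c d. i \<in> I \<Longrightarrow> u \<in> T \<Longrightarrow> w \<in> T \<Longrightarrow> f i (c *\<^sub>R u + d *\<^sub>R w) = c * f i u + d * f i w"
    and "\<And>v. v \<in> T \<Longrightarrow> \<forall>i\<in>I. f i v = 0 \<Longrightarrow> v = 0"
  shows "dim T \<le> card I"
  using assms
proof (induction I arbitrary: T rule: finite_induct)
  case empty
  then have "T \<subseteq> {0}" by auto
  then show ?case using dim_subset[of T "{0}"] by simp
next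
  case (insert i I)
  define K where "K = {v \<in> T. f i v = 0}"
  note lin = insert.prems(2)[of i, simplified]
  have "subspace K"
    unfolding subspace_def
  proof (intro conjI ballI allI)
    have "0 \<in> T" using insert.prems(1) by (rule subspace_0)
    with lin[of 0 0 0 0] show "0 \<in> K" by (simp add: K_def)
    show "u + w \<in> K" if "u \<in> K" "w \<in> K" for u w
      using that lin[of u w 1 1] insert.prems(1) by (auto simp: K_def subspace_add)
    show "c *\<^sub>R u \<in> K" if "u \<in> K" for c u
      using that lin[of u u c 0] insert.prems(1) by (auto simp: K_def subspace_scale)
  qed
  moreover have "v = 0" if "v \<in> K" "\<forall>i\<in>I. f i v = 0" for v
    using insert.prems(3)[of v] that by (auto simp: K_def)
  ultimately have "dim K \<le> card I"
    using insert.prems(2) by (intro insert.IH) (auto simp: K_def)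
  moreover have "dim T \<le> Suc (dim K)"
  proof (cases "\<exists>a\<in>T. f i a \<noteq> 0")
    case True
    then obtain a where a: "a \<in> T" "f i a \<noteq> 0" by blast
    have "T \<subseteq> span (insert a K)"
    proof
      fix v assume v: "v \<in> T"
      have "1 *\<^sub>R v + (- (f i v / f i a)) *\<^sub>R a \<in> K"
        using lin[OF v a(1), of 1 "- (f i v / f i a)"] a v insert.prems(1)
        by (auto simp: K_def intro!: subspace_diff subspace_scale)
      hence "(v - (f i v / f i a) *\<^sub>R a) + (f i v / f i a) *\<^sub>R a \<in> span (insert a K)"
        by (intro span_add span_scale span_base) auto
      thus "v \<in> span (insert a K)" by simp
    qed
    hence "dim T \<le> dim (insert a K)" using dim_subset[of T "span (insert a K)"] by simp
    also have "\<dots> \<le> Suc (dim K)" by (simp add: dim_insert)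
    finally show ?thesis .
  next
    case False
    then have "T \<subseteq> K" by (auto simp: K_def)
    then show ?thesis using dim_subset[of T K] by simp
  qed
  ultimately show ?case using insert.hyps by simp
qed

lemma alternating_one_linear:
  assumes "alternating_on V 1 a" "u \<in> V" "w \<in> V"
  shows "a [c *\<^sub>R u + d *\<^sub>R w] = c * a [u] + d * a [w]"
proof -
  have "\<forall>vs i. set vs \<subseteq> V \<and> length vs = 1 \<and> i < 1 \<longrightarrow>
      (\<forall>u\<in>V. \<forall>w\<in>V. \<forall>c d. a (vs[i := c *\<^sub>R u + d *\<^sub>R w]) = c * a (vs[i := u]) + d * a (vs[i := w]))"
    using assms(1) unfolding alternating_on_def by blast
  from this[rule_format, of "[u]" 0 u w c d] assms(2,3) show ?thesis by simp
qed

text \<open>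
  If no such vector existed, the remaining \<open>n - 1\<close> members of the coframe would already separate
  the points of the \<open>n\<close>-dimensional tangent space.
\<close>

lemma coframe_dual_vector:
  assumes "coframe_at N x n e" "j \<in> {1..n}"
  obtains b where "b \<in> tangent_space N x" "\<And>i. i \<in> {1..n} \<Longrightarrow> e i x [b] = (if i = j then 1 else 0)"
proof -
  let ?T = "tangent_space N x"
  from assms have T: "subspace ?T" "dim ?T = n" and alt: "\<And>i. i \<in> {1..n} \<Longrightarrow> alternating_on ?T 1 (e i x)"
    and sep: "\<And>v. v \<in> ?T \<Longrightarrow> \<forall>i\<in>{1..n}. e i x [v] = 0 \<Longrightarrow> v = 0" by (auto simp: coframe_at_def)
  have "\<exists>a\<in>?T. (\<forall>i\<in>{1..n} - {j}. e i x [a] = 0) \<and> e j x [a] \<noteq> 0"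
  proof (rule ccontr)
    assume neg: "\<not> ?thesis"
    have "dim ?T \<le> card ({1..n} - {j})"
    proof (rule dim_le_card_separating_functionals[where f = "\<lambda>i v. e i x [v]"])
      show "v = 0" if "v \<in> ?T" "\<forall>i\<in>{1..n} - {j}. e i x [v] = 0" for v
        using neg that sep by blast
    qed (use T(1) alternating_one_linear[OF alt] in auto)
    also have "\<dots> < n" using assms(2) by simp
    finally show False using T(2) by simp
  qed
  then obtain a where a: "a \<in> ?T" "\<And>i. i \<in> {1..n} - {j} \<Longrightarrow> e i x [a] = 0" "e j x [a] \<noteq> 0" by blast
  have "e i x [(1 / e j x [a]) *\<^sub>R a] = (if i = j then 1 else 0)" if "i \<in> {1..n}" for i
    using alternating_one_linear[OF alt[OF that] a(1) a(1), of "1 / e j x [a]" 0] a(2)[of i] a(3) that by auto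
  moreover have "(1 / e j x [a]) *\<^sub>R a \<in> ?T" using T(1) a(1) by (rule subspace_scale)
  ultimately show thesis using that by blast
qed

text \<open>For a definite metric, an orthonormal family of \<open>n\<close> one-forms is automatically a basis.\<close>

lemma orthonormal_coframe_atI:
  assumes "subspace (tangent_space N x)" "dim (tangent_space N x) = n"
    and "\<And>i. i \<in> {1..n} \<Longrightarrow> alternating_on UNIV 1 (e i x)"
    and eq: "\<And>v w. v \<in> tangent_space N x \<Longrightarrow> w \<in> tangent_space N x \<Longrightarrow>
      g x v w = (\<Sum>i=1..n. e i x [v] * e i x [w])"
    and "\<And>v. v \<in> tangent_space N x \<Longrightarrow> g x v v = 0 \<Longrightarrow> v = 0"
  shows "orthonormal_coframe_at N x n e g"
  using assms(1-3) assms(5) by (auto simp: orthonormal_coframe_at_def coframe_at_def eq alternating_mono)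

lemma shuffle_product_1_1:
  assumes "alternating_on UNIV 1 a" "alternating_on UNIV 1 b"
  shows "shuffle_product a b [u, v] = a [u] * b [v] - a [v] * b [u]"
  using assms[THEN alternating_length]
  by (simp add: shuffle_product_Cons contract_def grade_sign_def)

lemma shuffle_product_1_2:
  assumes "alternating_on UNIV 1 a" "alternating_on UNIV 2 b"
  shows "shuffle_product a b [u, v, w] = a [u] * b [v, w] - a [v] * b [u, w] + a [w] * b [u, v]"
  using assms[THEN alternating_length]
  by (simp add: shuffle_product_Cons contract_def grade_sign_def)


section \<open>Complex geometry of the five-sphere\<close>

lemma UNIV_6: "(UNIV :: 6 set) = {1, 2, 3, 4, 5, 6}"
proof -
  have "x \<in> {1, 2, 3, 4, 5, 6}" for x :: 6
  proof (induct x)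
    case (of_int z)
    then have "z = 0 \<or> z = 1 \<or> z = 2 \<or> z = 3 \<or> z = 4 \<or> z = 5" by fastforce
    then show ?case by auto
  qed
  thus ?thesis by blast
qed

lemma sum_6: "sum f (UNIV :: 6 set) = f 1 + f 2 + f 3 + f 4 + f 5 + f 6"
  unfolding UNIV_6 by (simp add: ac_simps)

text \<open>
  Complex coordinates in which \<open>omega3\<close> is the standard Kaehler form of the complex three-space, and
  \<open>omega1\<close> and \<open>omega2\<close> are the real and the imaginary part of the contraction of the holomorphic
  volume form with the position vector.
\<close>

definition z1 :: "real ^ 6 \<Rightarrow> complex" where "z1 x = Complex (x $ 1) (x $ 6)"
definition z2 :: "real ^ 6 \<Rightarrow> complex" where "z2 x = Complex (x $ 4) (x $ 3)"
definition z3 :: "real ^ 6 \<Rightarrow> complex" where "z3 x = Complex (x $ 5) (x $ 2)"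

definition herm :: "real ^ 6 \<Rightarrow> real ^ 6 \<Rightarrow> complex" where
  "herm u v = cnj (z1 u) * z1 v + cnj (z2 u) * z2 v + cnj (z3 u) * z3 v"

definition holo_vol :: "real ^ 6 \<Rightarrow> real ^ 6 \<Rightarrow> real ^ 6 \<Rightarrow> complex" where
  "holo_vol u v w =
     z1 u * (z2 v * z3 w - z3 v * z2 w) - z2 u * (z1 v * z3 w - z3 v * z1 w)
     + z3 u * (z1 v * z2 w - z2 v * z1 w)"

lemmas z_defs = z1_def z2_def z3_def

lemma z_linear:
  "z1 (u + v) = z1 u + z1 v" "z2 (u + v) = z2 u + z2 v" "z3 (u + v) = z3 u + z3 v"
  "z1 (c *\<^sub>R u) = of_real c * z1 u" "z2 (c *\<^sub>R u) = of_real c * z2 u" "z3 (c *\<^sub>R u) = of_real c * z3 u"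
  by (simp_all add: z_defs complex_eq_iff)

lemma herm_linear:
  "herm u (v + w) = herm u v + herm u w" "herm u (c *\<^sub>R v) = of_real c * herm u v"
  "herm (u + v) w = herm u w + herm v w" "herm (c *\<^sub>R u) v = of_real c * herm u v"
  by (simp_all add: herm_def z_linear algebra_simps)

lemma holo_vol_linear:
  "holo_vol (u + u') v w = holo_vol u v w + holo_vol u' v w"
  "holo_vol u (v + v') w = holo_vol u v w + holo_vol u v' w"
  "holo_vol u v (w + w') = holo_vol u v w + holo_vol u v w'"
  "holo_vol (c *\<^sub>R u) v w = of_real c * holo_vol u v w"
  "holo_vol u (c *\<^sub>R v) w = of_real c * holo_vol u v w"
  "holo_vol u v (c *\<^sub>R w) = of_real c * holo_vol u v w"
  by (simp_all add: holo_vol_def z_linear algebra_simps)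

lemma herm_cnj: "cnj (herm u v) = herm v u"
  by (simp add: herm_def)

lemma Re_herm: "Re (herm u v) = u \<bullet> v"
  by (simp add: herm_def z_defs inner_vec_def sum_6)

lemma herm_self: "herm u u = of_real (u \<bullet> u)"
proof -
  have "Im (herm u u) = 0" by (simp add: herm_def)
  thus ?thesis by (simp add: complex_eq_iff Re_herm)
qed

text \<open>Four vectors of a three-dimensional complex space satisfy Cramer's relation; pair it with \<open>a\<close>.\<close>

lemma herm_cramer:
  "herm a p * holo_vol q r s - herm a q * holo_vol p r s + herm a r * holo_vol p q s
     - herm a s * holo_vol p q r = 0"
  unfolding herm_def holo_vol_def by (simp add: algebra_simps)

text \<open>The Gram determinant of \<open>(x, y, u)\<close> against \<open>(x, y, v)\<close> is a product of two determinants.\<close>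

lemma holo_vol_gram:
  "cnj (holo_vol x y u) * holo_vol x y v =
     herm x x * (herm y y * herm u v - herm y v * herm u y)
     - herm x y * (herm y x * herm u v - herm y v * herm u x)
     + herm x v * (herm y x * herm u y - herm y y * herm u x)"
  unfolding herm_def holo_vol_def by (simp add: algebra_simps)

lemma dx_apply: "dx i x vs = (case vs of [v] \<Rightarrow> v $ i | _ \<Rightarrow> 0)"
proof -
  have "frechet_derivative (xc i) (at x) = (\<lambda>v. v $ i)"
    unfolding xc_def by (rule frechet_derivative_bounded_linear[OF bounded_linear_vec_nth])
  thus ?thesis by (simp add: dx_def differential_def)
qed

lemma elementary_xc: "elementary U (xc i)"
  unfolding xc_def by (rule elementary_linear[OF bounded_linear_vec_nth])

lemma elementary_form_dx: "elementary_form 1 U (dx i)"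
  using elementary_form_one[of U "\<lambda>_ v. v $ i"]
  by (simp add: dx_apply[abs_def] elementary_const bounded_linear_vec_nth[THEN bounded_linear.linear])

lemma elementary_form_dxx: "elementary_form 2 U (dxx i j)"
  unfolding dxx_def by (rule elementary_form_wedge'[OF elementary_form_dx elementary_form_dx]) simp

lemma elementary_form_sasaki:
  "elementary_form 1 U eta" "elementary_form 2 U omega1" "elementary_form 2 U omega2" "elementary_form 2 U omega3"
  unfolding eta_def omega1_def omega2_def omega3_def
  by (intro elementary_form_intros elementary_form_dx elementary_form_dxx elementary_xc)+

lemma two_form_apply:
  assumes "alternating_on UNIV 2 a"
  shows "a vs = (case vs of [u, v] \<Rightarrow> a [u, v] | _ \<Rightarrow> 0)"
  using alternating_length[OF assms, of vs] by (auto split: list.splits)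

lemma elementary_form_alternating: "elementary_form k UNIV \<alpha> \<Longrightarrow> alternating_on UNIV k (\<alpha> x)"
  by (simp add: elementary_form_def)

lemma dxx_apply: "dxx i j x [u, v] = u $ i * v $ j - v $ i * u $ j"
  using shuffle_product_1_1[OF elementary_form_alternating[OF elementary_form_dx]
      elementary_form_alternating[OF elementary_form_dx], of i x j x u v]
  by (simp add: dxx_def wedge_eq_shuffle_product dx_apply)

lemma eta_apply: "eta x vs = (case vs of [u] \<Rightarrow> - Im (herm x u) | _ \<Rightarrow> 0)"
  by (auto simp: eta_def plus_fun_def fun_diff_def scale_form_apply dx_apply xc_def herm_def z_defs
      split: list.splits)

lemma omega1_apply: "omega1 x vs = (case vs of [u, v] \<Rightarrow> Re (holo_vol x u v) | _ \<Rightarrow> 0)"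
proof -
  have "omega1 x [u, v] = Re (holo_vol x u v)" for u v
    by (simp add: omega1_def plus_fun_def fun_diff_def scale_form_apply dxx_apply xc_def
        holo_vol_def z_defs algebra_simps)
  thus ?thesis
    by (subst two_form_apply[OF elementary_form_alternating[OF elementary_form_sasaki(2)]]) (simp split: list.splits)
qed

lemma omega2_apply: "omega2 x vs = (case vs of [u, v] \<Rightarrow> Im (holo_vol x u v) | _ \<Rightarrow> 0)"
proof -
  have "omega2 x [u, v] = Im (holo_vol x u v)" for u v
    by (simp add: omega2_def plus_fun_def fun_diff_def fun_Compl_def scale_form_apply dxx_apply xc_def
        holo_vol_def z_defs algebra_simps)
  thus ?thesis
    by (subst two_form_apply[OF elementary_form_alternating[OF elementary_form_sasaki(3)]]) (simp split: list.splits)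
qed

lemma omega3_apply: "omega3 x vs = (case vs of [u, v] \<Rightarrow> Im (herm u v) | _ \<Rightarrow> 0)"
proof -
  have "omega3 x [u, v] = Im (herm u v)" for u v
    by (simp add: omega3_def fun_diff_def dxx_apply herm_def z_defs algebra_simps)
  thus ?thesis
    by (subst two_form_apply[OF elementary_form_alternating[OF elementary_form_sasaki(4)]]) (simp split: list.splits)
qed


section \<open>The Sasaki-Einstein equations\<close>

definition re_vol :: "(real ^ 6) form" where
  "re_vol = (\<lambda>x vs. case vs of [u, v, w] \<Rightarrow> Re (holo_vol u v w) | _ \<Rightarrow> 0)"

definition im_vol :: "(real ^ 6) form" where
  "im_vol = (\<lambda>x vs. case vs of [u, v, w] \<Rightarrow> Im (holo_vol u v w) | _ \<Rightarrow> 0)"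

lemma frechet_derivative_linear:
  fixes f :: "'a::euclidean_space \<Rightarrow> 'b::euclidean_space"
  shows "linear f \<Longrightarrow> frechet_derivative f (at x) = f"
  by (rule frechet_derivative_bounded_linear) (simp add: linear_conv_bounded_linear)

lemma linear_holo_vol:
  "linear (\<lambda>x. Re (holo_vol x u v))" "linear (\<lambda>x. Im (holo_vol x u v))" "linear (\<lambda>x. Im (herm x u))"
  by (auto intro!: linearI simp: holo_vol_linear herm_linear)

lemma ext_deriv_length:
  assumes "\<And>y ws. length ws \<noteq> k \<Longrightarrow> \<alpha> y ws = 0" "length vs \<noteq> Suc k"
  shows "ext_deriv \<alpha> x vs = 0"
  using assms unfolding ext_deriv_def by (intro sum.neutral) auto

lemma ext_deriv_eta: "ext_deriv eta = (\<lambda>_. - 2) *\<^sub>f omega3"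
proof (intro ext)
  fix x vs
  have D: "frechet_derivative (\<lambda>x. - Im (herm x u)) (at x) v = - Im (herm v u)" for u v
    by (subst frechet_derivative_linear) (auto intro!: linear_compose_neg linear_holo_vol)
  have swap: "Im (herm v u) = - Im (herm u v)" for u v by (metis cnj.simps(2) herm_cnj)
  show "ext_deriv eta x vs = ((\<lambda>_. - 2) *\<^sub>f omega3) x vs"
  proof (cases "length vs = 2")
    case True
    then obtain u v where vs: "vs = [u, v]" by (auto simp: length_Suc_conv numeral_2_eq_2)
    show ?thesis
      by (simp add: swap[of v u] vs ext_deriv_def eta_apply omega3_apply scale_form_apply D)
  next
    case False
    have "ext_deriv eta x vs = 0"
      by (rule ext_deriv_length[of 1]) (use False in \<open>auto simp: eta_apply split: list.splits\<close>)
    with False show ?thesis by (auto simp: omega3_apply scale_form_apply split: list.splits)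
  qed
qed

text \<open>
  The coefficients of \<open>\<omega>\<close> are linear in the base point, so each of the three terms of the exterior
  derivative is the volume form itself up to a permutation of its arguments, and all three agree.
\<close>

lemma ext_deriv_contracted_vol:
  fixes f :: "complex \<Rightarrow> real" and \<omega> :: "(real ^ 6) form"
  assumes f: "linear f" and \<omega>: "\<And>x vs. \<omega> x vs = (case vs of [u, v] \<Rightarrow> f (holo_vol x u v) | _ \<Rightarrow> 0)"
  shows "ext_deriv \<omega> x vs = 3 * (case vs of [u, v, w] \<Rightarrow> f (holo_vol u v w) | _ \<Rightarrow> 0)"
proof (cases "length vs = 3")
  case True
  then obtain u v w where vs: "vs = [u, v, w]" by (auto simp: length_Suc_conv numeral_3_eq_3)
  have "linear (\<lambda>x. f (holo_vol x u v))" for u v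
    using f by (auto intro!: linearI simp: holo_vol_linear linear_add linear_scale simp flip: scaleR_conv_of_real)
  hence D: "frechet_derivative (\<lambda>x. f (holo_vol x u v)) (at x) a = f (holo_vol a u v)" for u v a
    by (simp add: frechet_derivative_linear)
  have "holo_vol v u w = - holo_vol u v w" "holo_vol w u v = holo_vol u v w"
    by (simp_all add: holo_vol_def algebra_simps)
  thus ?thesis
    by (simp add: vs ext_deriv_def \<omega> D linear_neg[OF f] numeral_3_eq_3)
next
  case False
  have "ext_deriv \<omega> x vs = 0"
    by (rule ext_deriv_length[of 2]) (use False in \<open>auto simp: \<omega> split: list.splits\<close>)
  with False show ?thesis by (auto split: list.splits)
qed

lemma ext_deriv_omega1: "ext_deriv omega1 = (\<lambda>_. 3) *\<^sub>f re_vol"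
  using ext_deriv_contracted_vol[OF bounded_linear.linear[OF bounded_linear_Re] omega1_apply]
  by (simp add: fun_eq_iff scale_form_apply re_vol_def)

lemma ext_deriv_omega2: "ext_deriv omega2 = (\<lambda>_. 3) *\<^sub>f im_vol"
  using ext_deriv_contracted_vol[OF bounded_linear.linear[OF bounded_linear_Im] omega2_apply]
  by (simp add: fun_eq_iff scale_form_apply im_vol_def)

lemma ext_deriv_omega3: "ext_deriv omega3 = 0"
proof (intro ext)
  show "ext_deriv omega3 x vs = 0 x vs" for x vs
    by (simp add: ext_deriv_def omega3_apply frechet_derivative_const)
qed

lemma tangent_S5: "x \<in> S5 \<Longrightarrow> tangent_space S5 x = {v. x \<bullet> v = 0}"
  by (rule tangent_space_sphere) simp

text \<open>
  This is Cramer's relation for \<open>x, u, v, w\<close>, paired with \<open>x\<close>. The hermitian product of \<open>x\<close> with a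
  tangent vector is imaginary, since its real part is the inner product. The real and imaginary
  parts of the identity relate the volume form to \<open>\<eta> \<and> \<omega>\<^sub>2\<close> and \<open>- \<eta> \<and> \<omega>\<^sub>1\<close>; they hold on tangent
  vectors only.
\<close>

lemma holo_vol_tangent:
  assumes "x \<in> S5" "u \<in> tangent_space S5 x" "v \<in> tangent_space S5 x" "w \<in> tangent_space S5 x"
  shows "holo_vol u v w = \<i> * (Im (herm x u) * holo_vol x v w - Im (herm x v) * holo_vol x u w
      + Im (herm x w) * holo_vol x u v)"
proof -
  have h: "herm x a = \<i> * Im (herm x a)" if "a \<in> tangent_space S5 x" for a
    using that Re_herm[of x a] by (simp add: tangent_S5[OF assms(1)] complex_eq_iff)
  have "herm x x = 1" using assms(1) by (simp add: herm_self norm_eq_1)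
  with herm_cramer[of x x u v w]
  have "holo_vol u v w = herm x u * holo_vol x v w - herm x v * holo_vol x u w + herm x w * holo_vol x u v"
    by (simp add: algebra_simps)
  also have "\<dots> = \<i> * (Im (herm x u) * holo_vol x v w - Im (herm x v) * holo_vol x u w
      + Im (herm x w) * holo_vol x u v)"
    by (subst (1 2 3) h) (use assms in \<open>simp_all add: algebra_simps\<close>)
  finally show ?thesis .
qed

lemma form_eq_at_3I:
  assumes "\<And>vs. length vs \<noteq> 3 \<Longrightarrow> \<alpha> x vs = 0" "\<And>vs. length vs \<noteq> 3 \<Longrightarrow> \<beta> x vs = 0"
    and "\<And>u v w. {u, v, w} \<subseteq> tangent_space N x \<Longrightarrow> \<alpha> x [u, v, w] = \<beta> x [u, v, w]"
  shows "form_eq_at N x \<alpha> \<beta>"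
  unfolding form_eq_at_def
proof (intro allI impI)
  fix vs assume vs: "set vs \<subseteq> tangent_space N x"
  show "\<alpha> x vs = \<beta> x vs"
  proof (cases "length vs = 3")
    case True
    then obtain u v w where "vs = [u, v, w]" by (auto simp: length_Suc_conv numeral_3_eq_3)
    with vs assms(3) show ?thesis by simp
  qed (use assms in auto)
qed

lemma form_eq_at_2I:
  assumes "alternating_on UNIV 2 (\<alpha> x)" "alternating_on UNIV 2 (\<beta> x)"
    and "\<And>u v. {u, v} \<subseteq> tangent_space N x \<Longrightarrow> \<alpha> x [u, v] = \<beta> x [u, v]"
  shows "form_eq_at N x \<alpha> \<beta>"
  unfolding form_eq_at_def
proof (intro allI impI)
  fix vs assume vs: "set vs \<subseteq> tangent_space N x"
  show "\<alpha> x vs = \<beta> x vs"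
  proof (cases "length vs = 2")
    case True
    then obtain u v where "vs = [u, v]" by (auto simp: length_Suc_conv numeral_2_eq_2)
    with vs assms(3) show ?thesis by simp
  qed (use assms alternating_length in metis)
qed

lemma eta_wedge_apply:
  assumes "elementary_form 2 UNIV \<omega>"
  shows "(eta \<and>\<^sub>f \<omega>) x [u, v, w] = eta x [u] * \<omega> x [v, w] - eta x [v] * \<omega> x [u, w] + eta x [w] * \<omega> x [u, v]"
    and "length vs \<noteq> 3 \<Longrightarrow> (eta \<and>\<^sub>f \<omega>) x vs = 0"
  using alternating_length[OF elementary_form_alternating[OF elementary_form_wedge[OF elementary_form_sasaki(1) assms]], of vs x]
    shuffle_product_1_2[OF elementary_form_alternating[OF elementary_form_sasaki(1)] elementary_form_alternating[OF assms]]
  by (simp_all add: wedge_eq_shuffle_product)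

lemma re_vol_eq:
  assumes "x \<in> S5" shows "form_eq_at S5 x re_vol (eta \<and>\<^sub>f omega2)"
proof (rule form_eq_at_3I)
  show "re_vol x vs = 0" if "length vs \<noteq> 3" for vs
    using that by (auto simp: re_vol_def split: list.splits)
  show "re_vol x [u, v, w] = (eta \<and>\<^sub>f omega2) x [u, v, w]" if "{u, v, w} \<subseteq> tangent_space S5 x" for u v w
    using that
    by (simp add: re_vol_def eta_wedge_apply elementary_form_sasaki eta_apply omega2_apply)
      (subst holo_vol_tangent[OF assms], auto)
qed (simp add: eta_wedge_apply elementary_form_sasaki)

lemma im_vol_eq:
  assumes "x \<in> S5" shows "form_eq_at S5 x im_vol (- (eta \<and>\<^sub>f omega1))"
proof (rule form_eq_at_3I)
  show "im_vol x vs = 0" if "length vs \<noteq> 3" for vs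
    using that by (auto simp: im_vol_def split: list.splits)
  show "im_vol x [u, v, w] = (- (eta \<and>\<^sub>f omega1)) x [u, v, w]" if "{u, v, w} \<subseteq> tangent_space S5 x" for u v w
    using that
    by (simp add: im_vol_def eta_wedge_apply elementary_form_sasaki eta_apply omega1_apply fun_Compl_def)
      (subst holo_vol_tangent[OF assms], auto)
qed (simp add: eta_wedge_apply elementary_form_sasaki fun_Compl_def)


section \<open>Adapted coframes on the five-sphere\<close>

text \<open>
  Let \<open>y\<close> be a unit vector that is hermitian orthogonal to \<open>x\<close>. Then \<open>x\<close>, \<open>y\<close> and the complex conjugate of
  their cross product form a unitary basis. The last two coordinates with respect to it are
  \<open>herm y = e 1 + i e 4\<close> and \<open>holo_vol x y = e 2 + i e 3\<close>, which gives the coframe below. Such a \<open>y\<close>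
  is obtained locally by normalizing a linear field \<open>L\<close>.
\<close>

definition frame_vector :: "(real ^ 6 \<Rightarrow> real ^ 6) \<Rightarrow> real ^ 6 \<Rightarrow> real ^ 6" where
  "frame_vector L x = inverse (sqrt (L x \<bullet> L x)) *\<^sub>R L x"

definition SU2_coframe :: "(real ^ 6 \<Rightarrow> real ^ 6) \<Rightarrow> nat \<Rightarrow> (real ^ 6) form" where
  "SU2_coframe L i = (\<lambda>x vs. case vs of [v] \<Rightarrow>
     (if i = 1 then Re (herm (frame_vector L x) v)
      else if i = 2 then Re (holo_vol x (frame_vector L x) v)
      else if i = 3 then Im (holo_vol x (frame_vector L x) v)
      else if i = 4 then Im (herm (frame_vector L x) v)
      else - Im (herm x v)) | _ \<Rightarrow> 0)"

lemma elementary_form_SU2_coframe: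
  assumes L: "linear L" and nz: "\<And>x. x \<in> U \<Longrightarrow> L x \<noteq> 0"
  shows "elementary_form 1 U (SU2_coframe L i)"
  unfolding SU2_coframe_def
proof (rule elementary_form_one)
  have Lc: "elementary U (\<lambda>x. L x $ j)" for j
    using bounded_linear_compose[OF bounded_linear_vec_nth, of L j] L
    by (intro elementary_linear) (simp add: linear_conv_bounded_linear)
  have xc: "elementary U (\<lambda>x. x $ j)" for j
    by (rule elementary_linear[OF bounded_linear_vec_nth])
  define r where "r x = inverse (sqrt (L x \<bullet> L x))" for x
  have fv: "frame_vector L x = r x *\<^sub>R L x" for x
    by (simp add: frame_vector_def r_def)
  have norm: "elementary U (\<lambda>x. inverse (sqrt (L x \<bullet> L x)))"
  proof (rule elementary_rsqrt)
    show "elementary U (\<lambda>x. L x \<bullet> L x)"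
      by (auto simp: inner_vec_def intro!: elementary_sum elementary_mult Lc)
  qed (use nz in auto)
  have el: "elementary U (\<lambda>x. Re (herm (L x) v))" "elementary U (\<lambda>x. Im (herm (L x) v))"
    "elementary U (\<lambda>x. Re (holo_vol x (L x) v))" "elementary U (\<lambda>x. Im (holo_vol x (L x) v))"
    "elementary U (\<lambda>x. Im (herm x v))" for v
    unfolding herm_def holo_vol_def z_defs by (simp; intro elementary_intros Lc xc)+
  have "elementary U (\<lambda>x. Re (herm (frame_vector L x) v))"
    "elementary U (\<lambda>x. Im (herm (frame_vector L x) v))"
    "elementary U (\<lambda>x. Re (holo_vol x (frame_vector L x) v))"
    "elementary U (\<lambda>x. Im (holo_vol x (frame_vector L x) v))"
    "elementary U (\<lambda>x. - Im (herm x v))" for v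
    using elementary_minus[OF el(5)] el(1-4)[THEN elementary_mult[OF norm, folded r_def]]
    by (simp_all add: fv herm_linear holo_vol_linear)
  thus "elementary U (\<lambda>x. if i = 1 then Re (herm (frame_vector L x) v)
      else if i = 2 then Re (holo_vol x (frame_vector L x) v)
      else if i = 3 then Im (holo_vol x (frame_vector L x) v)
      else if i = 4 then Im (herm (frame_vector L x) v) else - Im (herm x v))" for v
    by (cases "i = 1"; cases "i = 2"; cases "i = 3"; cases "i = 4") simp_all
qed (auto intro!: linearI simp: herm_linear holo_vol_linear algebra_simps)

lemma SU2_coframe_apply:
  "SU2_coframe L i x [v] =
     (if i = 1 then Re (herm (frame_vector L x) v)
      else if i = 2 then Re (holo_vol x (frame_vector L x) v)
      else if i = 3 then Im (holo_vol x (frame_vector L x) v)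
      else if i = 4 then Im (herm (frame_vector L x) v)
      else - Im (herm x v))"
  by (simp add: SU2_coframe_def)

lemma SU2_coframe_alternating: "alternating_on UNIV 1 (SU2_coframe L i x)"
  unfolding SU2_coframe_def
  by (rule alternating_one) (auto intro!: linearI simp: herm_linear holo_vol_linear algebra_simps)

context
  fixes L :: "real ^ 6 \<Rightarrow> real ^ 6" and x :: "real ^ 6"
  assumes herm_L: "herm x (L x) = 0" and L_nz: "L x \<noteq> 0" and x: "x \<in> S5"
begin

private abbreviation "y \<equiv> frame_vector L x"

lemma herm_frame_vector: "herm x x = 1" "herm x y = 0" "herm y x = 0" "herm y y = 1"
proof -
  show 1: "herm x x = 1" using x by (simp add: herm_self norm_eq_1)
  show 2: "herm x y = 0" by (simp add: frame_vector_def herm_linear herm_L)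
  show "herm y x = 0" using herm_cnj[of x y] 2 by simp
  have "0 < L x \<bullet> L x" using L_nz by simp
  hence "y \<bullet> y = 1" by (simp add: frame_vector_def field_simps del: scaleR_conv_of_real)
  thus "herm y y = 1" by (simp add: herm_self)
qed

text \<open>Parseval's identity for the unitary basis, read off from the Gram determinant.\<close>

lemma herm_expand:
  "herm u v = cnj (herm x u) * herm x v + cnj (herm y u) * herm y v
     + cnj (holo_vol x y u) * holo_vol x y v"
  using holo_vol_gram[of x y u v] by (simp add: herm_frame_vector herm_cnj algebra_simps)

text \<open>
  Cramer's relation for \<open>y, x, u, v\<close>, paired with \<open>y\<close>. It says that \<open>\<omega>\<^sub>1 + i \<omega>\<^sub>2\<close> is the wedge product of
  the two complex coordinates.
\<close>

lemma holo_vol_expand: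
  "holo_vol x u v = herm y u * holo_vol x y v - herm y v * holo_vol x y u"
proof -
  have "holo_vol y x v = - holo_vol x y v" for v by (simp add: holo_vol_def algebra_simps)
  with herm_cramer[of y y x u v] show ?thesis by (simp add: herm_frame_vector algebra_simps)
qed

lemma orthonormal_SU2_coframe: "orthonormal_coframe_at S5 x 5 (SU2_coframe L) g5"
proof (rule orthonormal_coframe_atI)
  show "subspace (tangent_space S5 x)" unfolding tangent_S5[OF x] by (rule subspace_hyperplane)
  have "x \<noteq> 0" using x by auto
  thus "dim (tangent_space S5 x) = 5" unfolding tangent_S5[OF x] by (subst dim_hyperplane) auto
  show "g5 x u v = (\<Sum>i = 1..5. SU2_coframe L i x [u] * SU2_coframe L i x [v])"
    if "u \<in> tangent_space S5 x" "v \<in> tangent_space S5 x" for u v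
  proof -
    have "Re (herm x u) = 0" "Re (herm x v) = 0" using that by (simp_all add: tangent_S5[OF x] Re_herm)
    moreover have "{1..5::nat} = {1, 2, 3, 4, 5}" by auto
    ultimately show ?thesis
      using arg_cong[OF herm_expand[of u v], of Re]
      by (simp add: induced_metric_def SU2_coframe_apply Re_herm[of u v, symmetric] algebra_simps)
  qed
qed (auto simp: SU2_coframe_alternating induced_metric_def simp del: One_nat_def)

lemma SU2_adapted_SU2_coframe: "SU2_adapted S5 x (SU2_coframe L) eta omega1 omega2 omega3"
proof -
  let ?e = "\<lambda>i. SU2_coframe L i"
  have w: "(?e i \<and>\<^sub>f ?e j) x [u, v] = ?e i x [u] * ?e j x [v] - ?e i x [v] * ?e j x [u]" for i j u v
    by (simp add: wedge_eq_shuffle_product shuffle_product_1_1 SU2_coframe_alternating del: One_nat_def)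
  have "alternating_on UNIV (1 + 1) ((?e i \<and>\<^sub>f ?e j) x)" for i j
    using alternating_shuffle_product[OF SU2_coframe_alternating SU2_coframe_alternating]
    by (simp add: wedge_eq_shuffle_product[abs_def])
  hence alt: "alternating_on UNIV 2 ((?e i \<and>\<^sub>f ?e j + ?e k \<and>\<^sub>f ?e l) x)" for i j k l
    using alternating_add by (fastforce simp: plus_fun_def numeral_2_eq_2)
  have h: "Re (herm x u) = 0" if "u \<in> tangent_space S5 x" for u
    using that by (simp add: tangent_S5[OF x] Re_herm)
  have "form_eq_at S5 x eta (?e 5)"
    by (simp add: form_eq_at_def eta_apply SU2_coframe_def split: list.splits)
  moreover have "form_eq_at S5 x omega1 (?e 1 \<and>\<^sub>f ?e 2 + ?e 3 \<and>\<^sub>f ?e 4)"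
  proof (rule form_eq_at_2I)
    show "omega1 x [u, v] = (?e 1 \<and>\<^sub>f ?e 2 + ?e 3 \<and>\<^sub>f ?e 4) x [u, v]" for u v
      using arg_cong[OF holo_vol_expand[of u v], of Re]
      by (simp add: w omega1_apply SU2_coframe_apply algebra_simps)
  qed (rule elementary_form_alternating[OF elementary_form_sasaki(2)] alt)+
  moreover have "form_eq_at S5 x omega2 (?e 1 \<and>\<^sub>f ?e 3 + ?e 4 \<and>\<^sub>f ?e 2)"
  proof (rule form_eq_at_2I)
    show "omega2 x [u, v] = (?e 1 \<and>\<^sub>f ?e 3 + ?e 4 \<and>\<^sub>f ?e 2) x [u, v]" for u v
      using arg_cong[OF holo_vol_expand[of u v], of Im]
      by (simp add: w omega2_apply SU2_coframe_apply algebra_simps)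
  qed (rule elementary_form_alternating[OF elementary_form_sasaki(3)] alt)+
  moreover have "form_eq_at S5 x omega3 (?e 1 \<and>\<^sub>f ?e 4 + ?e 2 \<and>\<^sub>f ?e 3)"
  proof (rule form_eq_at_2I)
    show "omega3 x [u, v] = (?e 1 \<and>\<^sub>f ?e 4 + ?e 2 \<and>\<^sub>f ?e 3) x [u, v]" if "{u, v} \<subseteq> tangent_space S5 x" for u v
      using arg_cong[OF herm_expand[of u v], of Im] h that
      by (simp add: w omega3_apply SU2_coframe_apply algebra_simps)
  qed (rule elementary_form_alternating[OF elementary_form_sasaki(4)] alt)+
  ultimately show ?thesis
    using orthonormal_SU2_coframe by (simp add: SU2_adapted_def orthonormal_coframe_at_def)
qed

end

text \<open>
  The linear maps \<open>(z1, z2, z3) \<mapsto> (cnj z2, - cnj z1, 0)\<close> and \<open>(0, cnj z3, - cnj z2)\<close> have no common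
  zero on the sphere, so that near any point one of them can be normalized.
\<close>

lemma horizontal_linear_field:
  assumes "x \<in> S5"
  obtains L where "linear L" "\<And>y. herm y (L y) = 0" "L x \<noteq> (0 :: real ^ 6)"
proof -
  define L1 where "L1 x = ((\<chi> i. if i = 1 then x $ 4 else if i = 6 then - x $ 3
    else if i = 4 then - x $ 1 else if i = 3 then x $ 6 else 0) :: real ^ 6)" for x :: "real ^ 6"
  define L2 where "L2 x = ((\<chi> i. if i = 4 then x $ 5 else if i = 3 then - x $ 2
    else if i = 5 then - x $ 4 else if i = 2 then x $ 3 else 0) :: real ^ 6)" for x :: "real ^ 6"
  have lin: "linear L1" "linear L2"
    by (auto intro!: linearI simp: L1_def L2_def vec_eq_iff)
  have h: "herm y (L1 y) = 0" "herm y (L2 y) = 0" for y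
    by (simp_all add: L1_def L2_def herm_def z_defs complex_eq_iff)
  show thesis
  proof (cases "L1 x = 0")
    case False
    with that lin h show thesis by blast
  next
    case True
    have "L2 x \<noteq> 0"
    proof
      assume "L2 x = 0"
      with True have c: "L1 x $ j = 0" "L2 x $ j = 0" for j by simp_all
      have "x $ j = 0" for j
        using c(1)[of 1] c(1)[of 6] c(1)[of 4] c(1)[of 3] c(2)[of 4] c(2)[of 3] UNIV_I[of j]
        unfolding UNIV_6 by (auto simp: L1_def L2_def)
      hence "x = 0" by (simp add: vec_eq_iff)
      with assms show False by simp
    qed
    with that lin h show thesis by blast
  qed
qed

lemma SU2_coframe_exists:
  assumes "x \<in> S5"
  obtains U e where "open U" "x \<in> U" "\<And>i. elementary_form 1 U (e i)"
    "\<And>i y. alternating_on UNIV 1 (e i y)"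
    "\<And>y. y \<in> S5 \<inter> U \<Longrightarrow> SU2_adapted S5 y e eta omega1 omega2 omega3"
    "\<And>y. y \<in> S5 \<inter> U \<Longrightarrow> orthonormal_coframe_at S5 y 5 e g5"
proof -
  obtain L where L: "linear L" "\<And>y. herm y (L y) = 0" "L x \<noteq> 0"
    using horizontal_linear_field[OF assms] by blast
  have "open (L -` (- {0}))"
    using L(1) by (intro open_vimage linear_continuous_on) (auto simp: linear_conv_bounded_linear)
  thus thesis
  proof (rule that)
    show "elementary_form 1 (L -` (- {0})) (SU2_coframe L i)" for i
      using L(1) by (rule elementary_form_SU2_coframe) simp
    show "alternating_on UNIV 1 (SU2_coframe L i y)" for i y
      by (rule SU2_coframe_alternating)
  qed (use L in \<open>auto intro: SU2_adapted_SU2_coframe orthonormal_SU2_coframe\<close>)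
qed

theorem Sasaki_Einstein_S5: "Sasaki_Einstein S5 eta omega1 omega2 omega3 g5"
proof -
  have "SU2_structure S5 eta omega1 omega2 omega3 g5"
    unfolding SU2_structure_def
  proof (intro conjI ballI)
    fix x assume "x \<in> S5"
    then obtain U e where "open U" "x \<in> U" "\<And>i. elementary_form 1 U (e i)"
      "\<And>y. y \<in> S5 \<inter> U \<Longrightarrow> SU2_adapted S5 y e eta omega1 omega2 omega3"
      "\<And>y. y \<in> S5 \<inter> U \<Longrightarrow> orthonormal_coframe_at S5 y 5 e g5"
      by (rule SU2_coframe_exists) blast
    then show "\<exists>U e. open U \<and> x \<in> U \<and> (\<forall>i\<in>{1..5}. smooth_form 1 (S5 \<inter> U) (e i)) \<and>
      (\<forall>y\<in>S5 \<inter> U. SU2_adapted S5 y e eta omega1 omega2 omega3 \<and> orthonormal_coframe_at S5 y 5 e g5)"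
      by (intro exI[of _ U] exI[of _ e]) (auto intro: smooth_form_elementary)
  qed (intro smooth_form_elementary[OF open_UNIV] elementary_form_sasaki subset_UNIV)+
  moreover have "has_ext_deriv 1 S5 eta ((\<lambda>_. - 2) *\<^sub>f omega3)"
    by (rule has_ext_deriv_elementary) (simp_all add: elementary_form_sasaki ext_deriv_eta form_eq_at_def del: One_nat_def)
  moreover have "has_ext_deriv 2 S5 omega1 ((\<lambda>_. 3) *\<^sub>f (eta \<and>\<^sub>f omega2))"
    using re_vol_eq
    by (intro has_ext_deriv_elementary)
      (simp_all add: elementary_form_sasaki ext_deriv_omega1 form_eq_at_def scale_form_apply)
  moreover have "has_ext_deriv 2 S5 omega2 ((\<lambda>_. - 3) *\<^sub>f (eta \<and>\<^sub>f omega1))"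
    using im_vol_eq
    by (intro has_ext_deriv_elementary)
      (simp_all add: elementary_form_sasaki ext_deriv_omega2 form_eq_at_def scale_form_apply fun_Compl_def)
  ultimately show ?thesis by (simp add: Sasaki_Einstein_def)
qed


section \<open>The sine-cone over the five-sphere\<close>

lemma sasaki_form_rules:
  "odd_form eta" "even_form omega1" "even_form omega2" "even_form omega3" "odd_form re_vol" "odd_form im_vol"
  "differentiable_form eta" "differentiable_form omega1" "differentiable_form omega2" "differentiable_form omega3"
proof -
  show "odd_form re_vol" "odd_form im_vol"
    by (auto simp: odd_form_def has_parity_def re_vol_def im_vol_def split: list.splits)
qed (use elementary_form_sasaki[where U = UNIV] in
    \<open>auto intro: elementary_form_parity elementary_form_differentiable\<close>)

text \<open>
  In an adapted coframe the \<open>\<omega>\<close>'s are the usual basis of the self-dual two-forms in four variables,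
  which is orthogonal with equal lengths under the wedge product.
\<close>

lemma omega_wedge_omega:
  assumes "x \<in> S5"
  shows "form_eq_at S5 x (omega1 \<and>\<^sub>f omega3) 0" "form_eq_at S5 x (omega2 \<and>\<^sub>f omega3) 0"
    "form_eq_at S5 x (omega3 \<and>\<^sub>f omega3) (omega1 \<and>\<^sub>f omega1)"
proof -
  obtain U e where "x \<in> U" and alt: "\<And>i y. alternating_on UNIV 1 (e i y)"
    and e: "\<And>y. y \<in> S5 \<inter> U \<Longrightarrow> SU2_adapted S5 y e eta omega1 omega2 omega3"
    using assms by (rule SU2_coframe_exists) blast
  have odd: "odd_form (e i)" for i using alternating_form_parity(1)[OF alt] by simp
  have \<omega>: "form_eq_at S5 x omega1 (e 1 \<and>\<^sub>f e 2 + e 3 \<and>\<^sub>f e 4)"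
    "form_eq_at S5 x omega2 (e 1 \<and>\<^sub>f e 3 + e 4 \<and>\<^sub>f e 2)"
    "form_eq_at S5 x omega3 (e 1 \<and>\<^sub>f e 4 + e 2 \<and>\<^sub>f e 3)"
    using e[of x] assms \<open>x \<in> U\<close> by (simp_all add: SU2_adapted_def)
  have comm: "e j \<and>\<^sub>f e i = - (e i \<and>\<^sub>f e j)" "e j \<and>\<^sub>f (e i \<and>\<^sub>f \<gamma>) = - (e i \<and>\<^sub>f (e j \<and>\<^sub>f \<gamma>))" if "i < j" for i j \<gamma>
    by (rule odd_wedge_odd wedge_left_commute_odd; rule odd)+
  note normal = wedge_linear wedge_assoc comm odd_wedge_self[OF odd]
  show "form_eq_at S5 x (omega1 \<and>\<^sub>f omega3) 0"
    by (rule form_eq_at_trans[OF form_eq_at_wedge[OF \<omega>(1,3)]]) (simp add: normal form_eq_at_refl)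
  show "form_eq_at S5 x (omega2 \<and>\<^sub>f omega3) 0"
    by (rule form_eq_at_trans[OF form_eq_at_wedge[OF \<omega>(2,3)]]) (simp add: normal form_eq_at_refl)
  have "(e 1 \<and>\<^sub>f e 4 + e 2 \<and>\<^sub>f e 3) \<and>\<^sub>f (e 1 \<and>\<^sub>f e 4 + e 2 \<and>\<^sub>f e 3)
      = (e 1 \<and>\<^sub>f e 2 + e 3 \<and>\<^sub>f e 4) \<and>\<^sub>f (e 1 \<and>\<^sub>f e 2 + e 3 \<and>\<^sub>f e 4)"
    by (simp add: normal)
  with form_eq_at_wedge[OF \<omega>(3,3)] form_eq_at_wedge[OF \<omega>(1,1)]
  show "form_eq_at S5 x (omega3 \<and>\<^sub>f omega3) (omega1 \<and>\<^sub>f omega1)"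
    by (simp add: form_eq_at_def)
qed

abbreviation (input) "\<eta> \<equiv> lift eta"
abbreviation (input) "\<omega>1 \<equiv> lift omega1"
abbreviation (input) "\<omega>2 \<equiv> lift omega2"
abbreviation (input) "\<omega>3 \<equiv> lift omega3"
abbreviation (input) "dt \<equiv> (dlast :: ((real ^ 6) \<times> real) form)"

lemma cone_parity:
  "odd_form \<eta>" "even_form \<omega>1" "even_form \<omega>2" "even_form \<omega>3" "odd_form dt" "odd_form (lift re_vol)" "odd_form (lift im_vol)"
  by (simp_all add: lift_parity sasaki_form_rules odd_dlast)

text \<open>
  These rules order the factors of a monomial as \<open>\<eta>\<close>, \<open>\<omega>\<close>, \<open>dt\<close> so that
  identities between forms reduce to linear algebra in the monomials.
\<close>

lemma cone_commute:
  "dt \<and>\<^sub>f \<eta> = - (\<eta> \<and>\<^sub>f dt)" "dt \<and>\<^sub>f \<omega>1 = \<omega>1 \<and>\<^sub>f dt" "dt \<and>\<^sub>f \<omega>2 = \<omega>2 \<and>\<^sub>f dt" "dt \<and>\<^sub>f \<omega>3 = \<omega>3 \<and>\<^sub>f dt"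
  "\<omega>1 \<and>\<^sub>f \<eta> = \<eta> \<and>\<^sub>f \<omega>1" "\<omega>2 \<and>\<^sub>f \<eta> = \<eta> \<and>\<^sub>f \<omega>2" "\<omega>3 \<and>\<^sub>f \<eta> = \<eta> \<and>\<^sub>f \<omega>3"
  "\<omega>3 \<and>\<^sub>f \<omega>1 = \<omega>1 \<and>\<^sub>f \<omega>3" "\<omega>3 \<and>\<^sub>f \<omega>2 = \<omega>2 \<and>\<^sub>f \<omega>3"
  "dt \<and>\<^sub>f (\<eta> \<and>\<^sub>f \<gamma>) = - (\<eta> \<and>\<^sub>f (dt \<and>\<^sub>f \<gamma>))"
  "dt \<and>\<^sub>f (\<omega>1 \<and>\<^sub>f \<gamma>) = \<omega>1 \<and>\<^sub>f (dt \<and>\<^sub>f \<gamma>)" "dt \<and>\<^sub>f (\<omega>2 \<and>\<^sub>f \<gamma>) = \<omega>2 \<and>\<^sub>f (dt \<and>\<^sub>f \<gamma>)"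
  "dt \<and>\<^sub>f (\<omega>3 \<and>\<^sub>f \<gamma>) = \<omega>3 \<and>\<^sub>f (dt \<and>\<^sub>f \<gamma>)"
  "\<omega>1 \<and>\<^sub>f (\<eta> \<and>\<^sub>f \<gamma>) = \<eta> \<and>\<^sub>f (\<omega>1 \<and>\<^sub>f \<gamma>)" "\<omega>2 \<and>\<^sub>f (\<eta> \<and>\<^sub>f \<gamma>) = \<eta> \<and>\<^sub>f (\<omega>2 \<and>\<^sub>f \<gamma>)"
  "\<omega>3 \<and>\<^sub>f (\<eta> \<and>\<^sub>f \<gamma>) = \<eta> \<and>\<^sub>f (\<omega>3 \<and>\<^sub>f \<gamma>)"
  "lift re_vol \<and>\<^sub>f \<eta> = - (\<eta> \<and>\<^sub>f lift re_vol)"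
  by (rule odd_wedge_odd wedge_commute_even wedge_left_commute_odd wedge_left_commute_even
      wedge_commute_even[symmetric] wedge_left_commute_even[symmetric]; simp add: cone_parity; fail)+

lemmas cone_normal =
  wedge_linear wedge_assoc cone_commute odd_wedge_self[OF odd_dlast] odd_wedge_self[OF cone_parity(1)]

lemmas cone_deriv =
  ext_deriv_rules differentiable_form_rules cone_parity sasaki_form_rules lift_linear
  ext_deriv_eta ext_deriv_omega1 ext_deriv_omega2 ext_deriv_omega3

lemma elementary_form_lift_UNIV: "elementary_form k UNIV \<alpha> \<Longrightarrow> elementary_form k UNIV (lift \<alpha>)"
  using elementary_form_lift[of k UNIV \<alpha>] by simp

lemma elementary_form_cone: "elementary_form 2 UNIV F6" "elementary_form 3 UNIV Psip6" "elementary_form 3 UNIV Psim6"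
  unfolding F6_def Psip6_def Psim6_def
  by (rule elementary_form_intros elementary_form_lift_UNIV elementary_form_sasaki | simp)+

text \<open>
  \<open>N\<close> stands for a piece of the cone. All that enters is that its tangent vectors at \<open>p\<close> project to
  tangent vectors of the sphere.
\<close>

context
  fixes N :: "((real ^ 6) \<times> real) set" and p :: "(real ^ 6) \<times> real"
  assumes p: "fst p \<in> S5" and tan: "fst ` tangent_space N p \<subseteq> tangent_space S5 (fst p)"
begin

lemma form_eq_at_liftI: "form_eq_at S5 (fst p) \<alpha> \<beta> \<Longrightarrow> form_eq_at N p (lift \<alpha>) (lift \<beta>)"
  by (rule form_eq_at_lift[OF tan])

lemma cone_relations:
  "form_eq_at N p (\<omega>1 \<and>\<^sub>f \<omega>3) 0" "form_eq_at N p (\<omega>2 \<and>\<^sub>f \<omega>3) 0"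
  "form_eq_at N p (\<omega>3 \<and>\<^sub>f \<omega>3) (\<omega>1 \<and>\<^sub>f \<omega>1)"
  "form_eq_at N p (lift re_vol) (\<eta> \<and>\<^sub>f \<omega>2)" "form_eq_at N p (lift im_vol) (- (\<eta> \<and>\<^sub>f \<omega>1))"
  using omega_wedge_omega[OF p, THEN form_eq_at_liftI] re_vol_eq[OF p, THEN form_eq_at_liftI]
    im_vol_eq[OF p, THEN form_eq_at_liftI]
  by (simp_all add: lift_wedge lift_linear)

lemma cone_relations_wedge:
  "form_eq_at N p (lift re_vol \<and>\<^sub>f dt) (\<eta> \<and>\<^sub>f (\<omega>2 \<and>\<^sub>f dt))"
  "form_eq_at N p (lift im_vol \<and>\<^sub>f dt) (- (\<eta> \<and>\<^sub>f (\<omega>1 \<and>\<^sub>f dt)))"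
  "form_eq_at N p (\<eta> \<and>\<^sub>f lift re_vol) 0" "form_eq_at N p (\<eta> \<and>\<^sub>f lift im_vol) 0"
  using form_eq_at_wedge[OF cone_relations(4) form_eq_at_refl, of dt]
    form_eq_at_wedge[OF cone_relations(5) form_eq_at_refl, of dt]
    form_eq_at_wedge[OF form_eq_at_refl cone_relations(4), of \<eta>]
    form_eq_at_wedge[OF form_eq_at_refl cone_relations(5), of \<eta>]
  by (simp_all add: cone_normal)

text \<open>
  The exterior derivative is that of the ambient form. It produces \<open>re_vol\<close> and \<open>im_vol\<close>, which
  become wedge products of \<open>\<eta>\<close> with the \<open>\<omega>\<close>'s on tangent vectors; what remains is
  \<open>sin\<^sup>2 + cos\<^sup>2 = 1\<close>.
\<close>

lemma ext_deriv_F6: "form_eq_at N p ((\<lambda>_. 3) *\<^sub>f Psip6) (ext_deriv F6)"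
  unfolding form_eq_at_def
proof (intro allI impI)
  fix vs assume vs: "set vs \<subseteq> tangent_space N p"
  define s c where "s = sinl p" and "c = cosl p"
  have sc: "c * c = 1 - s * s" by (simp add: s_def c_def cosl_squared)
  have "lift re_vol p vs = (\<eta> \<and>\<^sub>f \<omega>2) p vs"
    using cone_relations(4) vs by (simp add: form_eq_at_def)
  hence "ext_deriv F6 p vs = 3 * s ^ 3 * (\<eta> \<and>\<^sub>f \<omega>2) p vs + 3 * s\<^sup>2 * c * (\<omega>1 \<and>\<^sub>f dt) p vs
      + (2 * s * (c * c) - s ^ 3 - 2 * s) * (\<omega>3 \<and>\<^sub>f dt) p vs"
    by (simp add: F6_def cone_deriv cone_normal form_apply s_def[symmetric] c_def[symmetric])
      (simp add: algebra_simps power2_eq_square power3_eq_cube)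
  also have "\<dots> = ((\<lambda>_. 3) *\<^sub>f Psip6) p vs"
    unfolding sc by (simp add: Psip6_def cone_normal form_apply s_def[symmetric] c_def[symmetric])
      (simp add: algebra_simps power2_eq_square power3_eq_cube)
  finally show "((\<lambda>_. 3) *\<^sub>f Psip6) p vs = ext_deriv F6 p vs" by simp
qed

text \<open>
  Intrinsically this is \<open>d (d F) = 0\<close>. It is checked on the explicit form, because the ambient forms
  \<open>d F\<close> and \<open>3 \<Psi>\<^sub>+\<close> agree on tangent vectors only.
\<close>

lemma ext_deriv_Psip6: "form_eq_at N p 0 (ext_deriv Psip6)"
  unfolding form_eq_at_def
proof (intro allI impI)
  fix vs assume vs: "set vs \<subseteq> tangent_space N p"
  have "(\<eta> \<and>\<^sub>f lift im_vol) p vs = 0" "(\<omega>2 \<and>\<^sub>f \<omega>3) p vs = 0"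
    "(lift re_vol \<and>\<^sub>f dt) p vs = (\<eta> \<and>\<^sub>f (\<omega>2 \<and>\<^sub>f dt)) p vs"
    using cone_relations cone_relations_wedge vs by (simp_all add: form_eq_at_def form_apply)
  thus "(0 :: ((real ^ 6) \<times> real) form) p vs = ext_deriv Psip6 p vs"
    by (simp add: Psip6_def cone_deriv cone_normal form_apply algebra_simps)
qed

lemma ext_deriv_Psim6: "form_eq_at N p ((\<lambda>_. - 2) *\<^sub>f (F6 \<and>\<^sub>f F6)) (ext_deriv Psim6)"
  unfolding form_eq_at_def
proof (intro allI impI)
  fix vs assume vs: "set vs \<subseteq> tangent_space N p"
  define s c where "s = sinl p" and "c = cosl p"
  have sc: "c * c = 1 - s * s" by (simp add: s_def c_def cosl_squared)
  have rel: "(\<eta> \<and>\<^sub>f lift re_vol) p vs = 0" "(\<omega>1 \<and>\<^sub>f \<omega>3) p vs = 0"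
    "(\<omega>3 \<and>\<^sub>f \<omega>3) p vs = (\<omega>1 \<and>\<^sub>f \<omega>1) p vs"
    "(lift im_vol \<and>\<^sub>f dt) p vs = - (\<eta> \<and>\<^sub>f (\<omega>1 \<and>\<^sub>f dt)) p vs"
    using cone_relations cone_relations_wedge vs by (simp_all add: form_eq_at_def form_apply)
  have "ext_deriv Psim6 p vs = (3 * s\<^sup>2 * (c * c) - s ^ 4 - 3 * s\<^sup>2) * (\<eta> \<and>\<^sub>f (\<omega>1 \<and>\<^sub>f dt)) p vs
      - 4 * s ^ 3 * c * (\<eta> \<and>\<^sub>f (\<omega>3 \<and>\<^sub>f dt)) p vs - 2 * s ^ 4 * (\<omega>1 \<and>\<^sub>f \<omega>1) p vs"
    using rel by (simp add: Psim6_def cone_deriv cone_normal form_apply s_def[symmetric] c_def[symmetric])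
      (simp add: algebra_simps power2_eq_square power3_eq_cube power4_eq_xxxx)
  moreover have "(F6 \<and>\<^sub>f F6) p vs = s ^ 4 * (s * s + c * c) * (\<omega>1 \<and>\<^sub>f \<omega>1) p vs
      + 2 * s ^ 3 * (s * (\<eta> \<and>\<^sub>f (\<omega>1 \<and>\<^sub>f dt)) p vs + c * (\<eta> \<and>\<^sub>f (\<omega>3 \<and>\<^sub>f dt)) p vs)"
    using rel by (simp add: F6_def cone_normal form_apply s_def[symmetric] c_def[symmetric])
      (simp add: algebra_simps power2_eq_square power3_eq_cube power4_eq_xxxx)
  ultimately show "((\<lambda>_. - 2) *\<^sub>f (F6 \<and>\<^sub>f F6)) p vs = ext_deriv Psim6 p vs"
    unfolding sc by (simp add: form_apply algebra_simps power2_eq_square power3_eq_cube power4_eq_xxxx)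
qed

end


section \<open>The nearly Kaehler structure\<close>

text \<open>
  A rotation of the pair \<open>(e 2, e 4)\<close> fixes \<open>\<omega>2\<close> and rotates the pair \<open>(\<omega>1, \<omega>3)\<close>; the angle is chosen such
  that \<open>\<omega>1\<close> becomes \<open>sin t \<omega>1 + cos t \<omega>3\<close>, the form in the first term of \<open>F\<close>.
\<close>

definition SU3_coframe :: "(nat \<Rightarrow> (real ^ 6) form) \<Rightarrow> nat \<Rightarrow> ((real ^ 6) \<times> real) form" where
  "SU3_coframe e i =
     (if i = 1 then sinl *\<^sub>f lift (e 1)
      else if i = 2 then sinl *\<^sub>f (sinl *\<^sub>f lift (e 2) + cosl *\<^sub>f lift (e 4))
      else if i = 3 then sinl *\<^sub>f lift (e 3)
      else if i = 4 then sinl *\<^sub>f (- (cosl *\<^sub>f lift (e 2)) + sinl *\<^sub>f lift (e 4))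
      else if i = 5 then sinl *\<^sub>f lift (e 5)
      else dlast)"

lemma elementary_form_SU3_coframe:
  assumes "\<And>i. elementary_form 1 U (e i)"
  shows "elementary_form 1 (U \<times> UNIV) (SU3_coframe e i)"
  unfolding SU3_coframe_def
  by (simp del: One_nat_def, intro conjI impI elementary_form_intros elementary_form_lift assms)

lemma lift_alternating_form: "(\<And>x. alternating_on UNIV k (\<alpha> x)) \<Longrightarrow> alternating_on UNIV k (lift \<alpha> p)"
  using lift_alternating[of k "\<alpha> (fst p)"] by (simp add: lift_apply[abs_def])

lemma alternating_dlast: "alternating_on UNIV 1 (dlast p)"
  by (rule elementary_form_alternating[OF elementary_form_dlast])

lemma alternating_form_scale: "alternating_on V k (\<alpha> x) \<Longrightarrow> alternating_on V k ((f *\<^sub>f \<alpha>) x)"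
  unfolding scale_form_def by (rule alternating_scale)

lemma alternating_form_add:
  "alternating_on V k (\<alpha> x) \<Longrightarrow> alternating_on V k (\<beta> x) \<Longrightarrow> alternating_on V k ((\<alpha> + \<beta>) x)"
  unfolding plus_fun_def by (rule alternating_add)

lemma alternating_form_diff:
  fixes \<alpha> \<beta> :: "'a::real_vector form"
  assumes "alternating_on V k (\<alpha> x)" "alternating_on V k (\<beta> x)"
  shows "alternating_on V k ((\<alpha> - \<beta>) x)"
  using alternating_add[OF assms(1) alternating_scale[OF assms(2), of "- 1"]] by (simp add: fun_diff_def)

lemma alternating_SU3_coframe:
  assumes "\<And>i x. alternating_on UNIV 1 (e i x)"
  shows "alternating_on UNIV 1 (SU3_coframe e i p)"
  unfolding SU3_coframe_def
  by (simp del: One_nat_def, intro conjI impI alternating_form_scale alternating_form_add alternating_form_diff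
      lift_alternating_form alternating_dlast assms)

lemma g6_definite:
  assumes "g6 p v v = 0" "sin (snd p) \<noteq> 0"
  shows "v = 0"
proof -
  have "0 \<le> (sin (snd p))\<^sup>2 * (fst v \<bullet> fst v)" by simp
  with assms(1) have "snd v * snd v = 0" "(sin (snd p))\<^sup>2 * (fst v \<bullet> fst v) = 0"
    by (simp_all add: g6_def sine_cone_metric_def induced_metric_def add_nonneg_eq_0_iff)
  with assms(2) show ?thesis by (simp add: prod_eq_iff)
qed

context
  fixes e :: "nat \<Rightarrow> (real ^ 6) form" and N :: "((real ^ 6) \<times> real) set" and p :: "(real ^ 6) \<times> real"
  assumes alt: "\<And>i x. alternating_on UNIV 1 (e i x)"
    and adapted: "SU2_adapted S5 (fst p) e eta omega1 omega2 omega3"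
    and tangent: "tangent_space N p = tangent_space S5 (fst p) \<times> UNIV"
begin

private abbreviation "E i \<equiv> lift (e i)"

lemma E_odd: "odd_form (E i)"
  by (rule lift_parity(1)[OF alternating_form_parity(1)[OF alt]]) simp

lemma E_commute:
  "i < j \<Longrightarrow> E j \<and>\<^sub>f E i = - (E i \<and>\<^sub>f E j)" "i < j \<Longrightarrow> E j \<and>\<^sub>f (E i \<and>\<^sub>f \<gamma>) = - (E i \<and>\<^sub>f (E j \<and>\<^sub>f \<gamma>))"
  "dlast \<and>\<^sub>f E i = - (E i \<and>\<^sub>f dlast)" "dlast \<and>\<^sub>f (E i \<and>\<^sub>f \<gamma>) = - (E i \<and>\<^sub>f (dlast \<and>\<^sub>f \<gamma>))"
  by (rule odd_wedge_odd wedge_left_commute_odd; rule E_odd odd_dlast)+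

lemmas E_normal = wedge_linear wedge_assoc E_commute odd_wedge_self[OF E_odd] odd_wedge_self[OF odd_dlast]

lemma cone_omega_eqs:
  "form_eq_at N p (lift eta) (E 5)"
  "form_eq_at N p (lift omega1) (E 1 \<and>\<^sub>f E 2 + E 3 \<and>\<^sub>f E 4)"
  "form_eq_at N p (lift omega2) (E 1 \<and>\<^sub>f E 3 + E 4 \<and>\<^sub>f E 2)"
  "form_eq_at N p (lift omega3) (E 1 \<and>\<^sub>f E 4 + E 2 \<and>\<^sub>f E 3)"
proof -
  have "fst ` tangent_space N p \<subseteq> tangent_space S5 (fst p)" by (auto simp: tangent)
  note lift = form_eq_at_lift[OF this]
  show "form_eq_at N p (lift eta) (E 5)"
    "form_eq_at N p (lift omega1) (E 1 \<and>\<^sub>f E 2 + E 3 \<and>\<^sub>f E 4)"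
    "form_eq_at N p (lift omega2) (E 1 \<and>\<^sub>f E 3 + E 4 \<and>\<^sub>f E 2)"
    "form_eq_at N p (lift omega3) (E 1 \<and>\<^sub>f E 4 + E 2 \<and>\<^sub>f E 3)"
    using adapted by (auto simp: SU2_adapted_def lift_linear[symmetric] lift_wedge[symmetric] intro!: lift)
qed

lemma SU3_coframe_orthonormal:
  assumes "orthonormal_coframe_at S5 (fst p) 5 e g5" "sin (snd p) \<noteq> 0"
  shows "orthonormal_coframe_at N p 6 (SU3_coframe e) g6"
proof (rule orthonormal_coframe_atI)
  have T: "subspace (tangent_space S5 (fst p))" "dim (tangent_space S5 (fst p)) = 5"
    and g: "\<And>v w. v \<in> tangent_space S5 (fst p) \<Longrightarrow> w \<in> tangent_space S5 (fst p) \<Longrightarrow>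
      v \<bullet> w = (\<Sum>i=1..5. e i (fst p) [v] * e i (fst p) [w])"
    using assms(1) by (auto simp: orthonormal_coframe_at_def coframe_at_def induced_metric_def)
  show "subspace (tangent_space N p)" unfolding tangent using T(1) by (intro subspace_Times subspace_UNIV)
  show "dim (tangent_space N p) = 6" unfolding tangent using T dim_Times[OF T(1) subspace_UNIV[where ?'a = real]] by simp
  show "alternating_on UNIV 1 (SU3_coframe e i p)" for i by (rule alternating_SU3_coframe[OF alt])
  define s c where "s = sinl p" and "c = cosl p"
  have sc: "c * c = 1 - s * s" by (simp add: s_def c_def cosl_squared)
  show "g6 p v w = (\<Sum>i = 1..6. SU3_coframe e i p [v] * SU3_coframe e i p [w])"
    if "v \<in> tangent_space N p" "w \<in> tangent_space N p" for v w
  proof -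
    define f where "f i = e i (fst p) [fst v]" for i
    define h where "h i = e i (fst p) [fst w]" for i
    have I: "{1..6::nat} = {1, 2, 3, 4, 5, 6}" "{1..5::nat} = {1, 2, 3, 4, 5}" by auto
    have "(\<Sum>i = 1..6. SU3_coframe e i p [v] * SU3_coframe e i p [w]) =
        s * s * (f 1 * h 1 + (s * s + c * c) * (f 2 * h 2) + f 3 * h 3 + (s * s + c * c) * (f 4 * h 4) + f 5 * h 5)
        + snd v * snd w"
      by (simp add: I SU3_coframe_def form_apply lift_apply dlast_apply f_def[symmetric] h_def[symmetric]
          s_def[symmetric] c_def[symmetric] del: One_nat_def) (simp add: algebra_simps)
    also have "\<dots> = snd v * snd w + s\<^sup>2 * (fst v \<bullet> fst w)"
      using g[of "fst v" "fst w"] that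
      by (simp add: sc tangent mem_Times_iff I f_def[symmetric] h_def[symmetric] power2_eq_square add.assoc
          del: One_nat_def)
    finally show ?thesis by (simp add: g6_def sine_cone_metric_def induced_metric_def s_def sinl_def)
  qed
  show "v = 0" if "g6 p v v = 0" for v
    by (rule g6_definite[OF that assms(2)])
qed

lemma SU3_adapted_SU3_coframe:
  assumes "orthonormal_coframe_at S5 (fst p) 5 e g5" "sin (snd p) \<noteq> 0"
  shows "SU3_adapted N p (SU3_coframe e) F6 Psip6 Psim6"
proof -
  define s c where "s = sinl p" and "c = cosl p"
  have sc: "c * c = 1 - s * s" by (simp add: s_def c_def cosl_squared)
  define \<eta>' where "\<eta>' = E 5"
  define \<omega>1' where "\<omega>1' = E 1 \<and>\<^sub>f E 2 + E 3 \<and>\<^sub>f E 4"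
  define \<omega>2' where "\<omega>2' = E 1 \<and>\<^sub>f E 3 + E 4 \<and>\<^sub>f E 2"
  define \<omega>3' where "\<omega>3' = E 1 \<and>\<^sub>f E 4 + E 2 \<and>\<^sub>f E 3"
  note defs = \<eta>'_def \<omega>1'_def \<omega>2'_def \<omega>3'_def
  note eqs = cone_omega_eqs[folded defs]
  define F where "F = (\<lambda>p. sinl p ^ 2) *\<^sub>f (sinl *\<^sub>f \<omega>1' + cosl *\<^sub>f \<omega>3') + sinl *\<^sub>f (\<eta>' \<and>\<^sub>f dlast)"
  define P where "P = (\<lambda>p. sinl p ^ 3) *\<^sub>f (\<eta>' \<and>\<^sub>f \<omega>2')
        - (\<lambda>p. sinl p ^ 2) *\<^sub>f ((- (cosl *\<^sub>f \<omega>1') + sinl *\<^sub>f \<omega>3') \<and>\<^sub>f dlast)"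
  define Q where "Q = (\<lambda>p. sinl p ^ 3) *\<^sub>f ((- (cosl *\<^sub>f \<omega>1') + sinl *\<^sub>f \<omega>3') \<and>\<^sub>f \<eta>')
        + (\<lambda>p. sinl p ^ 2) *\<^sub>f (\<omega>2' \<and>\<^sub>f dlast)"
  have 1: "form_eq_at N p F6 F" "form_eq_at N p Psip6 P" "form_eq_at N p Psim6 Q"
    unfolding F6_def Psip6_def Psim6_def F_def P_def Q_def
    by (intro form_eq_at_cong form_eq_at_refl eqs)+
  have "F p vs = model_F (SU3_coframe e) p vs" for vs
    by (simp add: F_def model_F_def SU3_coframe_def defs E_normal form_apply s_def[symmetric] c_def[symmetric])
      (simp add: algebra_simps power2_eq_square)
  moreover have "P p vs = fst (model_Psi (SU3_coframe e)) p vs" for vs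
  proof -
    have "fst (model_Psi (SU3_coframe e)) p vs = s ^ 3 * ((E 1 \<and>\<^sub>f (E 3 \<and>\<^sub>f E 5)) p vs
        - (s * s + c * c) * (E 2 \<and>\<^sub>f (E 4 \<and>\<^sub>f E 5)) p vs)
      - s\<^sup>2 * (s * ((E 1 \<and>\<^sub>f (E 4 \<and>\<^sub>f dlast)) p vs + (E 2 \<and>\<^sub>f (E 3 \<and>\<^sub>f dlast)) p vs)
         - c * ((E 1 \<and>\<^sub>f (E 2 \<and>\<^sub>f dlast)) p vs + (E 3 \<and>\<^sub>f (E 4 \<and>\<^sub>f dlast)) p vs))"
      by (simp add: model_Psi_def complex_wedge_def SU3_coframe_def E_normal form_apply s_def[symmetric] c_def[symmetric])
        (simp add: algebra_simps power2_eq_square power3_eq_cube)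
    also have "\<dots> = P p vs"
      by (simp add: sc P_def defs E_normal form_apply s_def[symmetric] c_def[symmetric])
    finally show ?thesis by simp
  qed
  moreover have "Q p vs = snd (model_Psi (SU3_coframe e)) p vs" for vs
  proof -
    have "snd (model_Psi (SU3_coframe e)) p vs = s\<^sup>2 * ((E 1 \<and>\<^sub>f (E 3 \<and>\<^sub>f dlast)) p vs
        - (s * s + c * c) * (E 2 \<and>\<^sub>f (E 4 \<and>\<^sub>f dlast)) p vs)
      + s ^ 3 * (s * ((E 1 \<and>\<^sub>f (E 4 \<and>\<^sub>f E 5)) p vs + (E 2 \<and>\<^sub>f (E 3 \<and>\<^sub>f E 5)) p vs)
         - c * ((E 1 \<and>\<^sub>f (E 2 \<and>\<^sub>f E 5)) p vs + (E 3 \<and>\<^sub>f (E 4 \<and>\<^sub>f E 5)) p vs))"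
      by (simp add: model_Psi_def complex_wedge_def SU3_coframe_def E_normal form_apply s_def[symmetric] c_def[symmetric])
        (simp add: algebra_simps power2_eq_square power3_eq_cube)
    also have "\<dots> = Q p vs"
      by (simp add: sc Q_def defs E_normal form_apply s_def[symmetric] c_def[symmetric])
    finally show ?thesis by simp
  qed
  ultimately show ?thesis
    using 1 SU3_coframe_orthonormal[OF assms]
    by (simp add: SU3_adapted_def orthonormal_coframe_at_def form_eq_at_def)
qed

end

lemma SU3_coframe_exists:
  assumes "p \<in> S5 \<times> {0<..<pi}"
  obtains U e where "open U" "p \<in> U" "\<And>i. elementary_form 1 U (e i)" "\<And>i y. alternating_on UNIV 1 (e i y)"
    "\<And>N y. y \<in> (S5 \<times> {0<..<pi}) \<inter> U \<Longrightarrow> tangent_space N y = tangent_space S5 (fst y) \<times> UNIV \<Longrightarrow>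
       SU3_adapted N y e F6 Psip6 Psim6"
    "\<And>N y. y \<in> (S5 \<times> {0<..<pi}) \<inter> U \<Longrightarrow> tangent_space N y = tangent_space S5 (fst y) \<times> UNIV \<Longrightarrow>
       orthonormal_coframe_at N y 6 e g6"
proof -
  obtain U e where U: "open U" "fst p \<in> U" and el: "\<And>i. elementary_form 1 U (e i)"
    and alt: "\<And>i y. alternating_on UNIV 1 (e i y)"
    and ad: "\<And>y. y \<in> S5 \<inter> U \<Longrightarrow> SU2_adapted S5 y e eta omega1 omega2 omega3"
    and on: "\<And>y. y \<in> S5 \<inter> U \<Longrightarrow> orthonormal_coframe_at S5 y 5 e g5"
    using SU2_coframe_exists[of "fst p"] assms by (auto simp: mem_Times_iff)
  have sin: "sin (snd y) \<noteq> 0" if "y \<in> (S5 \<times> {0<..<pi}) \<inter> (U \<times> UNIV)" for y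
    using that sin_gt_zero[of "snd y"] by (auto simp: mem_Times_iff)
  show thesis
  proof (rule that)
    show "open (U \<times> (UNIV :: real set))" using U(1) by (simp add: open_Times)
    show "p \<in> U \<times> UNIV" using U(2) by (simp add: mem_Times_iff)
    show "elementary_form 1 (U \<times> UNIV) (SU3_coframe e i)" for i by (rule elementary_form_SU3_coframe[OF el])
    show "alternating_on UNIV 1 (SU3_coframe e i y)" for i y by (rule alternating_SU3_coframe[OF alt])
    fix N y assume y: "y \<in> (S5 \<times> {0<..<pi}) \<inter> (U \<times> UNIV)"
      and T: "tangent_space N y = tangent_space S5 (fst y) \<times> UNIV"
    have "fst y \<in> S5 \<inter> U" using y by (auto simp: mem_Times_iff)
    from SU3_adapted_SU3_coframe[OF alt ad[OF this] T on[OF this] sin[OF y]]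
      SU3_coframe_orthonormal[OF alt ad[OF this] T on[OF this] sin[OF y]]
    show "SU3_adapted N y (SU3_coframe e) F6 Psip6 Psim6" "orthonormal_coframe_at N y 6 (SU3_coframe e) g6"
      by simp_all
  qed
qed

lemma tangent_space_cone:
  fixes V :: "real set"
  assumes "open V" "snd p \<in> V"
  shows "tangent_space (N \<times> V) p = tangent_space N (fst p) \<times> UNIV"
  using tangent_space_Times_open[of V "snd p" N "fst p"] assms by simp

theorem nearly_Kaehler_cone: "nearly_Kaehler (S5 \<times> {0<..<pi}) F6 Psip6 Psim6 g6"
proof -
  let ?M = "S5 \<times> {0<..<pi}"
  have T: "tangent_space ?M p = tangent_space S5 (fst p) \<times> UNIV" if "p \<in> ?M" for p
    by (rule tangent_space_cone) (use that in \<open>auto simp: mem_Times_iff\<close>)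
  have "SU3_structure ?M F6 Psip6 Psim6 g6"
    unfolding SU3_structure_def
  proof (intro conjI ballI)
    fix p assume "p \<in> ?M"
    then obtain U e where U: "open U" "p \<in> U" and el: "\<And>i. elementary_form 1 U (e i)"
      and ad: "\<And>N y. y \<in> ?M \<inter> U \<Longrightarrow> tangent_space N y = tangent_space S5 (fst y) \<times> UNIV \<Longrightarrow>
         SU3_adapted N y e F6 Psip6 Psim6"
      and on: "\<And>N y. y \<in> ?M \<inter> U \<Longrightarrow> tangent_space N y = tangent_space S5 (fst y) \<times> UNIV \<Longrightarrow>
         orthonormal_coframe_at N y 6 e g6"
      by (rule SU3_coframe_exists) blast
    show "\<exists>U e. open U \<and> p \<in> U \<and> (\<forall>i\<in>{1..6}. smooth_form 1 (?M \<inter> U) (e i)) \<and>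
        (\<forall>y\<in>?M \<inter> U. SU3_adapted ?M y e F6 Psip6 Psim6 \<and> orthonormal_coframe_at ?M y 6 e g6)"
    proof (intro exI conjI ballI)
      show "smooth_form 1 (?M \<inter> U) (e i)" for i
        by (rule smooth_form_elementary[OF U(1) el]) simp
      fix y assume y: "y \<in> ?M \<inter> U"
      hence T: "tangent_space ?M y = tangent_space S5 (fst y) \<times> UNIV" by (intro T) simp
      from ad[OF y T] on[OF y T]
      show "SU3_adapted ?M y e F6 Psip6 Psim6" "orthonormal_coframe_at ?M y 6 e g6" .
    qed (fact U)+
  qed (intro smooth_form_elementary[OF open_UNIV] elementary_form_cone subset_UNIV)+
  moreover have "has_ext_deriv 2 ?M F6 ((\<lambda>_. 3) *\<^sub>f Psip6)"
    using T by (intro has_ext_deriv_elementary elementary_form_cone ext_deriv_F6) (auto simp: mem_Times_iff)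
  moreover have "has_ext_deriv 3 ?M Psim6 ((\<lambda>_. - 2) *\<^sub>f (F6 \<and>\<^sub>f F6))"
    using T by (intro has_ext_deriv_elementary elementary_form_cone ext_deriv_Psim6) (auto simp: mem_Times_iff)
  ultimately show ?thesis by (simp add: nearly_Kaehler_def)
qed

text \<open>A form in normal form does not vanish: evaluate it on a dual basis.\<close>

lemma model_F_nonzero:
  assumes "coframe_at N x 6 e"
  shows "\<exists>vs. set vs \<subseteq> tangent_space N x \<and> model_F e x vs \<noteq> 0"
proof -
  obtain a where a: "a \<in> tangent_space N x" "\<And>i. i \<in> {1..6} \<Longrightarrow> e i x [a] = (if i = 1 then 1 else 0)"
    by (rule coframe_dual_vector[OF assms, of 1]) simp_all
  obtain b where b: "b \<in> tangent_space N x" "\<And>i. i \<in> {1..6} \<Longrightarrow> e i x [b] = (if i = 2 then 1 else 0)"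
    by (rule coframe_dual_vector[OF assms, of 2]) simp_all
  have "e i x vs = 0" if "i \<in> {1..6}" "length vs \<noteq> 1" "set vs \<subseteq> tangent_space N x" for i vs
    using assms that by (auto simp: coframe_at_def alternating_on_def)
  hence "model_F e x [a, b] = 1"
    using a b
    by (simp add: model_F_def form_apply wedge_eq_shuffle_product shuffle_product_Cons contract_def grade_sign_def
        del: One_nat_def)
  with a b show ?thesis by (intro exI[of _ "[a, b]"]) simp
qed

lemma G2_model_nonzero:
  assumes "coframe_at N x 7 e"
  shows "\<exists>vs. set vs \<subseteq> tangent_space N x \<and> (model_F e \<and>\<^sub>f e 7 - snd (model_Psi e)) x vs \<noteq> 0"
proof -
  obtain a where a: "a \<in> tangent_space N x" "\<And>i. i \<in> {1..7} \<Longrightarrow> e i x [a] = (if i = 1 then 1 else 0)"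
    by (rule coframe_dual_vector[OF assms, of 1]) simp_all
  obtain b where b: "b \<in> tangent_space N x" "\<And>i. i \<in> {1..7} \<Longrightarrow> e i x [b] = (if i = 2 then 1 else 0)"
    by (rule coframe_dual_vector[OF assms, of 2]) simp_all
  obtain c where c: "c \<in> tangent_space N x" "\<And>i. i \<in> {1..7} \<Longrightarrow> e i x [c] = (if i = 7 then 1 else 0)"
    by (rule coframe_dual_vector[OF assms, of 7]) simp_all
  have "e i x vs = 0" if "i \<in> {1..7}" "length vs \<noteq> 1" "set vs \<subseteq> tangent_space N x" for i vs
    using assms that by (auto simp: coframe_at_def alternating_on_def)
  hence "(model_F e \<and>\<^sub>f e 7 - snd (model_Psi e)) x [a, b, c] = 1"
    using a b c
    by (simp add: model_F_def model_Psi_def complex_wedge_def form_apply wedge_linear wedge_eq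
        shuffle_product_Cons contract_def grade_sign_def del: One_nat_def)
  with a b c show ?thesis by (intro exI[of _ "[a, b, c]"]) simp
qed

text \<open>At the two ends \<open>F\<close> vanishes, and elsewhere there is an adapted coframe.\<close>

theorem SU3_degenerate_iff:
  "{p \<in> S5 \<times> {0..pi}. SU3_degenerate (S5 \<times> UNIV) F6 Psip6 Psim6 p} = S5 \<times> {0, pi}"
proof (intro equalityI subsetI)
  fix p assume p: "p \<in> {p \<in> S5 \<times> {0..pi}. SU3_degenerate (S5 \<times> UNIV) F6 Psip6 Psim6 p}"
  have "p \<notin> S5 \<times> {0<..<pi}"
  proof
    assume *: "p \<in> S5 \<times> {0<..<pi}"
    have T: "tangent_space (S5 \<times> UNIV) p = tangent_space S5 (fst p) \<times> UNIV" by (rule tangent_space_cone) auto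
    obtain e where "SU3_adapted (S5 \<times> UNIV) p e F6 Psip6 Psim6"
      by (rule SU3_coframe_exists[OF *]) (use T * in blast)
    with p show False by (auto simp: SU3_degenerate_def)
  qed
  with p show "p \<in> S5 \<times> {0, pi}" by (auto simp: mem_Times_iff)
next
  fix p assume p: "p \<in> S5 \<times> {0, pi}"
  hence "sinl p = 0" by (auto simp: sinl_def)
  hence zero: "F6 p vs = 0" for vs by (simp add: F6_def form_apply)
  have "\<not> SU3_adapted (S5 \<times> UNIV) p e F6 Psip6 Psim6" for e
  proof
    assume e: "SU3_adapted (S5 \<times> UNIV) p e F6 Psip6 Psim6"
    hence "coframe_at (S5 \<times> UNIV) p 6 e" by (simp add: SU3_adapted_def)
    from model_F_nonzero[OF this] e zero show False by (auto simp: SU3_adapted_def form_eq_at_def)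
  qed
  hence "SU3_degenerate (S5 \<times> UNIV) F6 Psip6 Psim6 p" by (simp add: SU3_degenerate_def)
  with p show "p \<in> {p \<in> S5 \<times> {0..pi}. SU3_degenerate (S5 \<times> UNIV) F6 Psip6 Psim6 p}" by auto
qed


section \<open>The nearly parallel structure\<close>

text \<open>The Hodge dual of \<open>phi7\<close>.\<close>

definition psi7 :: "(((real ^ 6) \<times> real) \<times> real) form" where
  "psi7 = (\<lambda>p. 1 / 2 * sinl p ^ 4) *\<^sub>f (lift F6 \<and>\<^sub>f lift F6)
     + (\<lambda>p. sinl p ^ 3) *\<^sub>f ((sinl *\<^sub>f lift Psip6 + cosl *\<^sub>f lift Psim6) \<and>\<^sub>f dlast)"

lemma elementary_form_phi7: "elementary_form 3 UNIV phi7"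
  unfolding phi7_def
  by (rule elementary_form_intros elementary_form_lift_UNIV elementary_form_cone | simp)+

lemma elementary_form_psi7: "elementary_form 4 UNIV psi7"
  unfolding psi7_def
  by (rule elementary_form_intros elementary_form_lift_UNIV elementary_form_cone | simp)+

lemma cone_form_rules:
  "even_form F6" "odd_form Psip6" "odd_form Psim6"
  "differentiable_form F6" "differentiable_form Psip6" "differentiable_form Psim6"
  using elementary_form_cone by (auto intro: elementary_form_parity elementary_form_differentiable)

lemma cone_commute7:
  "dlast \<and>\<^sub>f lift F6 = lift F6 \<and>\<^sub>f dlast" "dlast \<and>\<^sub>f (lift F6 \<and>\<^sub>f \<gamma>) = lift F6 \<and>\<^sub>f (dlast \<and>\<^sub>f \<gamma>)"
  "dlast \<and>\<^sub>f lift Psip6 = - (lift Psip6 \<and>\<^sub>f dlast)" "dlast \<and>\<^sub>f lift Psim6 = - (lift Psim6 \<and>\<^sub>f dlast)"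
  by (rule odd_wedge_odd wedge_commute_even wedge_left_commute_even; simp add: lift_parity cone_form_rules odd_dlast; fail)+

lemma ext_deriv_phi7:
  assumes p: "fst (fst p) \<in> S5" and tan: "tangent_space N p = (tangent_space S5 (fst (fst p)) \<times> UNIV) \<times> UNIV"
  shows "form_eq_at N p ((\<lambda>_. 4) *\<^sub>f psi7) (ext_deriv phi7)"
  unfolding form_eq_at_def
proof (intro allI impI)
  fix vs assume vs: "set vs \<subseteq> tangent_space N p"
  define s c where "s = sinl p" and "c = cosl p"
  have sc: "c * c = 1 - s * s" by (simp add: s_def c_def cosl_squared)
  have T6: "tangent_space (S5 \<times> UNIV) (fst p) = tangent_space S5 (fst (fst p)) \<times> UNIV" by (rule tangent_space_cone) auto
  have "fst ` tangent_space (S5 \<times> UNIV) (fst p) \<subseteq> tangent_space S5 (fst (fst p))" unfolding T6 by auto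
  note cone = ext_deriv_F6[OF p this] ext_deriv_Psip6[OF p this] ext_deriv_Psim6[OF p this]
  have "fst ` tangent_space N p \<subseteq> tangent_space (S5 \<times> UNIV) (fst p)" unfolding T6 tan by auto
  note lifted = cone[THEN form_eq_at_lift[OF this], unfolded lift_linear lift_wedge]
  have rel: "(lift (ext_deriv F6) \<and>\<^sub>f dlast) p vs = 3 * (lift Psip6 \<and>\<^sub>f dlast) p vs"
    "lift (ext_deriv Psip6) p vs = 0"
    "lift (ext_deriv Psim6) p vs = - 2 * (lift F6 \<and>\<^sub>f lift F6) p vs"
    using form_eq_at_wedge[OF lifted(1) form_eq_at_refl, of dlast] lifted(2,3) vs
    by (simp_all add: form_eq_at_def form_apply wedge_linear)
  have "ext_deriv phi7 p vs = (3 * s\<^sup>2 - 3 * s\<^sup>2 * (c * c) + s ^ 4) * (lift Psip6 \<and>\<^sub>f dlast) p vs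
      + 4 * s ^ 3 * c * (lift Psim6 \<and>\<^sub>f dlast) p vs + 2 * s ^ 4 * (lift F6 \<and>\<^sub>f lift F6) p vs"
    using rel
    by (simp add: phi7_def ext_deriv_rules differentiable_form_rules cone_form_rules lift_parity odd_dlast lift_linear
        wedge_linear wedge_assoc cone_commute7 odd_wedge_self[OF odd_dlast] form_apply s_def[symmetric] c_def[symmetric])
      (simp add: algebra_simps power2_eq_square power3_eq_cube power4_eq_xxxx)
  also have "\<dots> = ((\<lambda>_. 4) *\<^sub>f psi7) p vs"
    unfolding sc
    by (simp add: psi7_def wedge_linear form_apply s_def[symmetric] c_def[symmetric])
      (simp add: algebra_simps power2_eq_square power3_eq_cube power4_eq_xxxx)
  finally show "((\<lambda>_. 4) *\<^sub>f psi7) p vs = ext_deriv phi7 p vs" by simp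
qed

text \<open>
  The complex one-form \<open>f 1 + i f 2\<close> is turned by the angle \<open>q - \<pi>/2\<close>. This keeps the Kaehler form
  and multiplies the complex volume form by \<open>sin q - i cos q\<close>, whose product with \<open>\<Psi>\<^sub>+ + i \<Psi>\<^sub>-\<close> has the
  imaginary part \<open>- cos q \<Psi>\<^sub>+ + sin q \<Psi>\<^sub>-\<close> that occurs in \<open>\<phi>\<close>.
\<close>

definition G2_coframe ::
    "(nat \<Rightarrow> ((real ^ 6) \<times> real) form) \<Rightarrow> nat \<Rightarrow> (((real ^ 6) \<times> real) \<times> real) form" where
  "G2_coframe f i =
     (if i = 1 then sinl *\<^sub>f (sinl *\<^sub>f lift (f 1) + cosl *\<^sub>f lift (f 2))
      else if i = 2 then sinl *\<^sub>f (sinl *\<^sub>f lift (f 2) - cosl *\<^sub>f lift (f 1))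
      else if i = 7 then dlast
      else sinl *\<^sub>f lift (f i))"

lemma elementary_form_G2_coframe:
  assumes "\<And>i. elementary_form 1 U (f i)"
  shows "elementary_form 1 (U \<times> UNIV) (G2_coframe f i)"
  unfolding G2_coframe_def
  by (simp del: One_nat_def, intro conjI impI elementary_form_intros elementary_form_lift assms)

lemma alternating_G2_coframe:
  assumes "\<And>i x. alternating_on UNIV 1 (f i x)"
  shows "alternating_on UNIV 1 (G2_coframe f i p)"
  unfolding G2_coframe_def
  by (simp del: One_nat_def, intro conjI impI alternating_form_scale alternating_form_add alternating_form_diff
      lift_alternating_form alternating_dlast assms)

context
  fixes f :: "nat \<Rightarrow> ((real ^ 6) \<times> real) form" and N :: "(((real ^ 6) \<times> real) \<times> real) set"
    and M :: "((real ^ 6) \<times> real) set" and p :: "((real ^ 6) \<times> real) \<times> real"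
  assumes alt: "\<And>i x. alternating_on UNIV 1 (f i x)"
    and adapted: "SU3_adapted M (fst p) f F6 Psip6 Psim6"
    and orthonormal: "orthonormal_coframe_at M (fst p) 6 f g6"
    and tangent: "tangent_space N p = tangent_space M (fst p) \<times> UNIV"
    and sin: "sin (snd p) \<noteq> 0"
    and definite: "\<And>v. v \<in> tangent_space M (fst p) \<Longrightarrow> g6 (fst p) v v = 0 \<Longrightarrow> v = 0"
begin

private abbreviation "E7 i \<equiv> lift (f i)"

lemma E_odd7: "odd_form (E7 i)"
  by (rule lift_parity(1)[OF alternating_form_parity(1)[OF alt]]) simp

lemma E_commute7:
  "i < j \<Longrightarrow> E7 j \<and>\<^sub>f E7 i = - (E7 i \<and>\<^sub>f E7 j)" "i < j \<Longrightarrow> E7 j \<and>\<^sub>f (E7 i \<and>\<^sub>f \<gamma>) = - (E7 i \<and>\<^sub>f (E7 j \<and>\<^sub>f \<gamma>))"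
  "dlast \<and>\<^sub>f E7 i = - (E7 i \<and>\<^sub>f dlast)" "dlast \<and>\<^sub>f (E7 i \<and>\<^sub>f \<gamma>) = - (E7 i \<and>\<^sub>f (dlast \<and>\<^sub>f \<gamma>))"
  by (rule odd_wedge_odd wedge_left_commute_odd; rule E_odd7 odd_dlast)+

lemmas E_normal7 = wedge_linear wedge_assoc E_commute7 odd_wedge_self[OF E_odd7] odd_wedge_self[OF odd_dlast]

lemma G2_coframe_orthonormal: "orthonormal_coframe_at N p 7 (G2_coframe f) g7"
proof (rule orthonormal_coframe_atI)
  have T: "subspace (tangent_space M (fst p))" "dim (tangent_space M (fst p)) = 6"
    and g: "\<And>v w. v \<in> tangent_space M (fst p) \<Longrightarrow> w \<in> tangent_space M (fst p) \<Longrightarrow>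
      g6 (fst p) v w = (\<Sum>i=1..6. f i (fst p) [v] * f i (fst p) [w])"
    using orthonormal by (auto simp: orthonormal_coframe_at_def coframe_at_def)
  show "subspace (tangent_space N p)" unfolding tangent using T(1) by (intro subspace_Times subspace_UNIV)
  show "dim (tangent_space N p) = 7" unfolding tangent using T dim_Times[OF T(1) subspace_UNIV[where ?'a = real]] by simp
  show "alternating_on UNIV 1 (G2_coframe f i p)" for i by (rule alternating_G2_coframe[OF alt])
  define s c where "s = sinl p" and "c = cosl p"
  have sc: "c * c = 1 - s * s" by (simp add: s_def c_def cosl_squared)
  show "g7 p v w = (\<Sum>i = 1..7. G2_coframe f i p [v] * G2_coframe f i p [w])"
    if "v \<in> tangent_space N p" "w \<in> tangent_space N p" for v w
  proof -
    define a where "a i = f i (fst p) [fst v]" for i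
    define b where "b i = f i (fst p) [fst w]" for i
    have I: "{1..7::nat} = {1, 2, 3, 4, 5, 6, 7}" "{1..6::nat} = {1, 2, 3, 4, 5, 6}" by auto
    have "(\<Sum>i = 1..7. G2_coframe f i p [v] * G2_coframe f i p [w]) =
        s * s * ((s * s + c * c) * (a 1 * b 1) + (s * s + c * c) * (a 2 * b 2) + a 3 * b 3 + a 4 * b 4
          + a 5 * b 5 + a 6 * b 6) + snd v * snd w"
      by (simp add: I G2_coframe_def form_apply lift_apply dlast_apply a_def[symmetric] b_def[symmetric]
          s_def[symmetric] c_def[symmetric] del: One_nat_def) (simp add: algebra_simps)
    also have "\<dots> = snd v * snd w + s\<^sup>2 * g6 (fst p) (fst v) (fst w)"
      using g[of "fst v" "fst w"] that
      by (simp add: sc tangent mem_Times_iff I a_def[symmetric] b_def[symmetric] power2_eq_square add.assoc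
          del: One_nat_def)
    finally show ?thesis by (simp add: g7_def sine_cone_metric_def s_def sinl_def)
  qed
  show "v = 0" if v: "v \<in> tangent_space N p" and 0: "g7 p v v = 0" for v
  proof -
    have fv: "fst v \<in> tangent_space M (fst p)" using v by (simp add: tangent mem_Times_iff)
    have "0 \<le> g6 (fst p) (fst v) (fst v)" by (simp add: g6_def sine_cone_metric_def induced_metric_def)
    hence "0 \<le> (sin (snd p))\<^sup>2 * g6 (fst p) (fst v) (fst v)" by simp
    with 0 have "snd v * snd v = 0" "(sin (snd p))\<^sup>2 * g6 (fst p) (fst v) (fst v) = 0"
      by (simp_all add: g7_def sine_cone_metric_def add_nonneg_eq_0_iff)
    with sin definite[OF fv] show ?thesis by (simp add: prod_eq_iff)
  qed
qed

lemma G2_adapted_G2_coframe: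
  "G2_adapted N p (G2_coframe f) phi7" "form_eq_at N p psi7 (model_star_phi (G2_coframe f))"
proof -
  define s c where "s = sinl p" and "c = cosl p"
  have sc: "c * c = 1 - s * s" by (simp add: s_def c_def cosl_squared)
  have "fst ` tangent_space N p \<subseteq> tangent_space M (fst p)" by (auto simp: tangent)
  note lift = form_eq_at_lift[OF this]
  define F where "F = lift (model_F f)"
  define P where "P = lift (fst (model_Psi f))"
  define Q where "Q = lift (snd (model_Psi f))"
  have eqs: "form_eq_at N p (lift F6) F" "form_eq_at N p (lift Psip6) P" "form_eq_at N p (lift Psim6) Q"
    unfolding F_def P_def Q_def using adapted by (auto simp: SU3_adapted_def intro!: lift)
  have F: "F = E7 1 \<and>\<^sub>f E7 2 + E7 3 \<and>\<^sub>f E7 4 + E7 5 \<and>\<^sub>f E7 6"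
    by (simp add: F_def model_F_def lift_linear lift_wedge)
  have P: "P = E7 1 \<and>\<^sub>f (E7 3 \<and>\<^sub>f E7 5) - E7 2 \<and>\<^sub>f (E7 4 \<and>\<^sub>f E7 5) - E7 1 \<and>\<^sub>f (E7 4 \<and>\<^sub>f E7 6) - E7 2 \<and>\<^sub>f (E7 3 \<and>\<^sub>f E7 6)"
    by (simp add: P_def model_Psi_def complex_wedge_def lift_linear lift_wedge E_normal7)
  have Q: "Q = E7 1 \<and>\<^sub>f (E7 3 \<and>\<^sub>f E7 6) - E7 2 \<and>\<^sub>f (E7 4 \<and>\<^sub>f E7 6) + E7 1 \<and>\<^sub>f (E7 4 \<and>\<^sub>f E7 5) + E7 2 \<and>\<^sub>f (E7 3 \<and>\<^sub>f E7 5)"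
    by (simp add: Q_def model_Psi_def complex_wedge_def lift_linear lift_wedge E_normal7)
  have "form_eq_at N p phi7 ((\<lambda>p. sinl p ^ 2) *\<^sub>f (F \<and>\<^sub>f dlast) - (\<lambda>p. sinl p ^ 3) *\<^sub>f (- (cosl *\<^sub>f P) + sinl *\<^sub>f Q))"
    unfolding phi7_def by (intro form_eq_at_cong form_eq_at_refl eqs)
  moreover have "((\<lambda>p. sinl p ^ 2) *\<^sub>f (F \<and>\<^sub>f dlast) - (\<lambda>p. sinl p ^ 3) *\<^sub>f (- (cosl *\<^sub>f P) + sinl *\<^sub>f Q)) p vs =
      (model_F (G2_coframe f) \<and>\<^sub>f G2_coframe f 7 - snd (model_Psi (G2_coframe f))) p vs" for vs
  proof -
    have "(model_F (G2_coframe f) \<and>\<^sub>f G2_coframe f 7) p vs = s\<^sup>2 * ((s * s + c * c) * (E7 1 \<and>\<^sub>f (E7 2 \<and>\<^sub>f dlast)) p vs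
        + (E7 3 \<and>\<^sub>f (E7 4 \<and>\<^sub>f dlast)) p vs + (E7 5 \<and>\<^sub>f (E7 6 \<and>\<^sub>f dlast)) p vs)"
      by (simp add: model_F_def G2_coframe_def E_normal7 form_apply s_def[symmetric] c_def[symmetric])
        (simp add: algebra_simps power2_eq_square)
    moreover have "snd (model_Psi (G2_coframe f)) p vs = s ^ 3 * (- c * P p vs + s * Q p vs)"
      by (simp add: P Q model_Psi_def complex_wedge_def G2_coframe_def E_normal7 form_apply s_def[symmetric] c_def[symmetric])
        (simp add: algebra_simps power3_eq_cube)
    ultimately show ?thesis
      by (simp add: sc F wedge_linear wedge_assoc form_apply s_def[symmetric] c_def[symmetric])
  qed
  ultimately show "G2_adapted N p (G2_coframe f) phi7"
    using G2_coframe_orthonormal by (simp add: G2_adapted_def orthonormal_coframe_at_def form_eq_at_def)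
  have "form_eq_at N p psi7 ((\<lambda>p. 1 / 2 * sinl p ^ 4) *\<^sub>f (F \<and>\<^sub>f F)
      + (\<lambda>p. sinl p ^ 3) *\<^sub>f ((sinl *\<^sub>f P + cosl *\<^sub>f Q) \<and>\<^sub>f dlast))"
    unfolding psi7_def by (intro form_eq_at_cong form_eq_at_refl eqs)
  moreover have "((\<lambda>p. 1 / 2 * sinl p ^ 4) *\<^sub>f (F \<and>\<^sub>f F)
      + (\<lambda>p. sinl p ^ 3) *\<^sub>f ((sinl *\<^sub>f P + cosl *\<^sub>f Q) \<and>\<^sub>f dlast)) p vs = model_star_phi (G2_coframe f) p vs" for vs
  proof -
    have "(model_F (G2_coframe f) \<and>\<^sub>f model_F (G2_coframe f)) p vs = 2 * s ^ 4 * ((s * s + c * c) * (E7 1 \<and>\<^sub>f (E7 2 \<and>\<^sub>f (E7 3 \<and>\<^sub>f E7 4))) p vs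
        + (s * s + c * c) * (E7 1 \<and>\<^sub>f (E7 2 \<and>\<^sub>f (E7 5 \<and>\<^sub>f E7 6))) p vs + (E7 3 \<and>\<^sub>f (E7 4 \<and>\<^sub>f (E7 5 \<and>\<^sub>f E7 6))) p vs)"
      by (simp add: model_F_def G2_coframe_def E_normal7 form_apply s_def[symmetric] c_def[symmetric])
        (simp add: algebra_simps power4_eq_xxxx)
    moreover have "(fst (model_Psi (G2_coframe f)) \<and>\<^sub>f G2_coframe f 7) p vs =
        s ^ 3 * (s * (P \<and>\<^sub>f dlast) p vs + c * (Q \<and>\<^sub>f dlast) p vs)"
      by (simp add: P Q model_Psi_def complex_wedge_def G2_coframe_def E_normal7 form_apply s_def[symmetric] c_def[symmetric])
        (simp add: algebra_simps power3_eq_cube)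
    moreover have "(F \<and>\<^sub>f F) p vs = 2 * ((E7 1 \<and>\<^sub>f (E7 2 \<and>\<^sub>f (E7 3 \<and>\<^sub>f E7 4))) p vs
        + (E7 1 \<and>\<^sub>f (E7 2 \<and>\<^sub>f (E7 5 \<and>\<^sub>f E7 6))) p vs + (E7 3 \<and>\<^sub>f (E7 4 \<and>\<^sub>f (E7 5 \<and>\<^sub>f E7 6))) p vs)"
      by (simp add: F E_normal7 form_apply)
    ultimately show ?thesis
      by (simp add: sc model_star_phi_def wedge_linear form_apply s_def[symmetric] c_def[symmetric])
  qed
  ultimately show "form_eq_at N p psi7 (model_star_phi (G2_coframe f))" by (simp add: form_eq_at_def)
qed

end

lemma G2_coframe_exists:
  assumes "p \<in> (S5 \<times> {0<..<pi}) \<times> {0<..<pi}"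
  obtains U e where "open U" "p \<in> U" "\<And>i. elementary_form 1 U (e i)"
    "\<And>N y. y \<in> ((S5 \<times> {0<..<pi}) \<times> {0<..<pi}) \<inter> U \<Longrightarrow>
       tangent_space N y = (tangent_space S5 (fst (fst y)) \<times> UNIV) \<times> UNIV \<Longrightarrow>
       G2_adapted N y e phi7 \<and> form_eq_at N y psi7 (model_star_phi e) \<and> orthonormal_coframe_at N y 7 e g7"
proof -
  obtain U e where U: "open U" "fst p \<in> U" and el: "\<And>i. elementary_form 1 U (e i)"
    and alt: "\<And>i y. alternating_on UNIV 1 (e i y)"
    and ad: "\<And>N y. y \<in> (S5 \<times> {0<..<pi}) \<inter> U \<Longrightarrow> tangent_space N y = tangent_space S5 (fst y) \<times> UNIV \<Longrightarrow>
       SU3_adapted N y e F6 Psip6 Psim6"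
    and on: "\<And>N y. y \<in> (S5 \<times> {0<..<pi}) \<inter> U \<Longrightarrow> tangent_space N y = tangent_space S5 (fst y) \<times> UNIV \<Longrightarrow>
       orthonormal_coframe_at N y 6 e g6"
    by (rule SU3_coframe_exists[of "fst p"]) (use assms in \<open>auto simp: mem_Times_iff\<close>)
  show thesis
  proof (rule that)
    show "open (U \<times> (UNIV :: real set))" using U(1) by (simp add: open_Times)
    show "p \<in> U \<times> UNIV" using U(2) by (simp add: mem_Times_iff)
    show "elementary_form 1 (U \<times> UNIV) (G2_coframe e i)" for i by (rule elementary_form_G2_coframe[OF el])
    fix N y assume y: "y \<in> ((S5 \<times> {0<..<pi}) \<times> {0<..<pi}) \<inter> (U \<times> UNIV)"
      and T: "tangent_space N y = (tangent_space S5 (fst (fst y)) \<times> UNIV) \<times> UNIV"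
    have y6: "fst y \<in> (S5 \<times> {0<..<pi}) \<inter> U" using y by (auto simp: mem_Times_iff)
    have T6: "tangent_space (S5 \<times> UNIV) (fst y) = tangent_space S5 (fst (fst y)) \<times> UNIV" by (rule tangent_space_cone) auto
    have sin: "sin (snd y) \<noteq> 0" "sin (snd (fst y)) \<noteq> 0"
      using y sin_gt_zero[of "snd y"] sin_gt_zero[of "snd (fst y)"] by (auto simp: mem_Times_iff)
    have def: "v = 0" if "g6 (fst y) v v = 0" for v
      by (rule g6_definite[OF that sin(2)])
    have T7: "tangent_space N y = tangent_space (S5 \<times> UNIV) (fst y) \<times> UNIV" by (simp only: T T6)
    note facts = alt ad[OF y6 T6] on[OF y6 T6] T7 sin(1) def
    from G2_adapted_G2_coframe[OF facts] G2_coframe_orthonormal[OF facts]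
    show "G2_adapted N y (G2_coframe e) phi7 \<and> form_eq_at N y psi7 (model_star_phi (G2_coframe e))
        \<and> orthonormal_coframe_at N y 7 (G2_coframe e) g7"
      by simp
  qed
qed

lemma tangent_space_cone2:
  fixes V W :: "real set"
  assumes "open V" "open W" "snd (fst p) \<in> V" "snd p \<in> W"
  shows "tangent_space ((N \<times> V) \<times> W) p = (tangent_space N (fst (fst p)) \<times> UNIV) \<times> UNIV"
  using assms by (simp add: tangent_space_cone)

theorem nearly_parallel_cone: "nearly_parallel_G2 ((S5 \<times> {0<..<pi}) \<times> {0<..<pi}) phi7 g7"
proof -
  let ?M = "(S5 \<times> {0<..<pi}) \<times> {0<..<pi}"
  have T: "tangent_space ?M p = (tangent_space S5 (fst (fst p)) \<times> UNIV) \<times> UNIV" if "p \<in> ?M" for p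
    by (rule tangent_space_cone2) (use that in \<open>auto simp: mem_Times_iff\<close>)
  have "G2_structure ?M phi7 psi7 g7"
    unfolding G2_structure_def
  proof (intro conjI ballI)
    fix p assume "p \<in> ?M"
    then obtain U e where U: "open U" "p \<in> U" and el: "\<And>i. elementary_form 1 U (e i)"
      and ad: "\<And>N y. y \<in> ?M \<inter> U \<Longrightarrow> tangent_space N y = (tangent_space S5 (fst (fst y)) \<times> UNIV) \<times> UNIV \<Longrightarrow>
       G2_adapted N y e phi7 \<and> form_eq_at N y psi7 (model_star_phi e) \<and> orthonormal_coframe_at N y 7 e g7"
      by (rule G2_coframe_exists) blast
    show "\<exists>U e. open U \<and> p \<in> U \<and> (\<forall>i\<in>{1..7}. smooth_form 1 (?M \<inter> U) (e i)) \<and>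
        (\<forall>y\<in>?M \<inter> U. G2_adapted ?M y e phi7 \<and> form_eq_at ?M y psi7 (model_star_phi e)
          \<and> orthonormal_coframe_at ?M y 7 e g7)"
    proof (intro exI[of _ U] exI[of _ e] conjI[OF U(1)] conjI[OF U(2)] conjI[of "Ball _ _"] ballI)
      show "smooth_form 1 (?M \<inter> U) (e i)" for i
        by (rule smooth_form_elementary[OF U(1) el]) simp
      fix y assume y: "y \<in> ?M \<inter> U"
      hence "tangent_space ?M y = (tangent_space S5 (fst (fst y)) \<times> UNIV) \<times> UNIV" by (intro T) simp
      from ad[OF y this]
      show "G2_adapted ?M y e phi7 \<and> form_eq_at ?M y psi7 (model_star_phi e) \<and> orthonormal_coframe_at ?M y 7 e g7" .
    qed
  qed (intro smooth_form_elementary[OF open_UNIV] elementary_form_phi7 elementary_form_psi7 subset_UNIV)+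
  moreover have "has_ext_deriv 3 ?M phi7 ((\<lambda>_. 4) *\<^sub>f psi7)"
    using T by (intro has_ext_deriv_elementary elementary_form_phi7 ext_deriv_phi7) (auto simp: mem_Times_iff)
  ultimately show ?thesis by (auto simp: nearly_parallel_G2_def)
qed

text \<open>Where one of the two sines vanishes, so does \<open>phi7\<close>; elsewhere there is an adapted coframe.\<close>

theorem G2_degenerate_iff:
  "{p \<in> (S5 \<times> {0..pi}) \<times> {0..pi}. G2_degenerate ((S5 \<times> UNIV) \<times> UNIV) phi7 p}
     = {((x, t), q). x \<in> S5 \<and> t \<in> {0..pi} \<and> q \<in> {0..pi} \<and> (t \<in> {0, pi} \<or> q \<in> {0, pi})}"
proof (intro equalityI subsetI)
  fix p assume p: "p \<in> {p \<in> (S5 \<times> {0..pi}) \<times> {0..pi}. G2_degenerate ((S5 \<times> UNIV) \<times> UNIV) phi7 p}"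
  have "p \<notin> (S5 \<times> {0<..<pi}) \<times> {0<..<pi}"
  proof
    assume *: "p \<in> (S5 \<times> {0<..<pi}) \<times> {0<..<pi}"
    have T: "tangent_space ((S5 \<times> UNIV) \<times> UNIV) p = (tangent_space S5 (fst (fst p)) \<times> UNIV) \<times> UNIV"
      by (rule tangent_space_cone2) auto
    obtain e where "G2_adapted ((S5 \<times> UNIV) \<times> UNIV) p e phi7"
      by (rule G2_coframe_exists[OF *]) (use T * in blast)
    with p show False by (auto simp: G2_degenerate_def)
  qed
  with p show "p \<in> {((x, t), q). x \<in> S5 \<and> t \<in> {0..pi} \<and> q \<in> {0..pi} \<and> (t \<in> {0, pi} \<or> q \<in> {0, pi})}"
    by (auto simp: mem_Times_iff split: prod.splits)
next
  fix p :: "((real ^ 6) \<times> real) \<times> real"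
  assume p: "p \<in> {((x, t), q). x \<in> S5 \<and> t \<in> {0..pi} \<and> q \<in> {0..pi} \<and> (t \<in> {0, pi} \<or> q \<in> {0, pi})}"
  hence "sinl (fst p) = 0 \<or> sinl p = 0" by (auto simp: sinl_def)
  hence zero: "phi7 p vs = 0" for vs
  proof
    assume s: "sinl (fst p) = 0"
    hence "F6 (fst p) ws = 0" "Psip6 (fst p) ws = 0" "Psim6 (fst p) ws = 0" for ws
      by (simp_all add: F6_def Psip6_def Psim6_def form_apply)
    hence "lift F6 p = (\<lambda>_. 0)" "lift Psip6 p vs = 0" "lift Psim6 p vs = 0"
      by (simp_all add: lift_apply fun_eq_iff)
    thus ?thesis by (simp add: phi7_def form_apply wedge_eq_shuffle_product)
  qed (simp add: phi7_def form_apply)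
  have "\<not> G2_adapted ((S5 \<times> UNIV) \<times> UNIV) p e phi7" for e
  proof
    assume e: "G2_adapted ((S5 \<times> UNIV) \<times> UNIV) p e phi7"
    hence "coframe_at ((S5 \<times> UNIV) \<times> UNIV) p 7 e" by (simp add: G2_adapted_def)
    from G2_model_nonzero[OF this] e zero show False by (auto simp: G2_adapted_def form_eq_at_def)
  qed
  hence "G2_degenerate ((S5 \<times> UNIV) \<times> UNIV) phi7 p" by (simp add: G2_degenerate_def)
  with p show "p \<in> {p \<in> (S5 \<times> {0..pi}) \<times> {0..pi}. G2_degenerate ((S5 \<times> UNIV) \<times> UNIV) phi7 p}"
    by auto
qed


section \<open>Polar coordinates\<close>

lemma tangent_space_image:
  assumes "(f has_derivative f') (at x)" "f ` N \<subseteq> S" "v \<in> tangent_space N x"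
  shows "f' v \<in> tangent_space S (f x)"
proof -
  obtain c \<epsilon> where c: "\<epsilon> > 0" "c 0 = x" "\<And>s. \<bar>s\<bar> < \<epsilon> \<Longrightarrow> c s \<in> N" "(c has_vector_derivative v) (at (0::real))"
    using assms(3) by (auto simp: tangent_space_def)
  have lin: "linear f'" using assms(1) by (rule has_derivative_linear)
  have "((\<lambda>s. f (c s)) has_derivative (\<lambda>s. f' (s *\<^sub>R v))) (at 0)"
    using has_derivative_compose[of c "\<lambda>s. s *\<^sub>R v" 0 UNIV f f'] c(2,4) assms(1)
    by (simp add: has_vector_derivative_def)
  hence "((\<lambda>s. f (c s)) has_vector_derivative f' v) (at 0)"
    by (simp add: has_vector_derivative_def linear_scale[OF lin])
  with c assms(2) show ?thesis
    unfolding tangent_space_def by (intro CollectI exI[of _ "\<lambda>s. f (c s)"] exI[of _ \<epsilon>]) auto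
qed

text \<open>
  An isometry onto a part of the unit sphere, in a form that passes from \<open>N\<close> to the sine-cone over \<open>N\<close>.
\<close>

definition spherical_isometry ::
    "'a::euclidean_space set \<Rightarrow> 'a metric \<Rightarrow> ('a \<Rightarrow> 'b::euclidean_space) \<Rightarrow> 'b set \<Rightarrow> bool" where
  "spherical_isometry N g f A \<longleftrightarrow>
     (\<forall>b\<in>Basis. elementary UNIV (\<lambda>x. f x \<bullet> b)) \<and> bij_betw f N (sphere 0 1 - A) \<and>
     (\<forall>x\<in>N. \<forall>v\<in>tangent_space N x. \<forall>w\<in>tangent_space N x.
        frechet_derivative f (at x) v \<bullet> frechet_derivative f (at x) w = g x v w)"

lemma spherical_isometry_imp_isometry_between:
  "spherical_isometry N g f A \<Longrightarrow> isometry_between N g f (sphere 0 1 - A) induced_metric"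
  unfolding spherical_isometry_def isometry_between_def pullback_metric_def induced_metric_def
  by (auto intro!: exI[of _ UNIV] smooth_on_componentwise_elementary)

lemma elementary_vector_differentiable:
  assumes "\<forall>b\<in>Basis. elementary UNIV (\<lambda>x. f x \<bullet> b)"
  shows "f differentiable (at x)"
  using assms by (subst differentiable_componentwise_within) (auto intro: elementary_differentiable[OF _ UNIV_I])

definition polar :: "('a \<Rightarrow> 'b::real_vector) \<Rightarrow> 'a \<times> real \<Rightarrow> 'b \<times> real" where
  "polar f p = (sin (snd p) *\<^sub>R f (fst p), cos (snd p))"

text \<open>
  The last coordinate of the image determines \<open>q\<close>, as the cosine is injective on \<open>(0, \<pi>)\<close>, and the
  direction of the other component determines \<open>f x\<close>. As \<open>A\<close> is a cone, only this direction matters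
  for membership in \<open>A\<close>.
\<close>

lemma polar_bij_betw:
  fixes f :: "'a \<Rightarrow> 'b::real_inner"
  assumes f: "bij_betw f N (sphere 0 1 - A)" and "0 \<in> A"
    and A: "\<And>c y. c > 0 \<Longrightarrow> c *\<^sub>R y \<in> A \<longleftrightarrow> y \<in> A"
  shows "bij_betw (polar f) (N \<times> {0<..<pi}) (sphere 0 1 - {y. fst y \<in> A})"
  unfolding bij_betw_def
proof (intro conjI equalityI subsetI)
  show "inj_on (polar f) (N \<times> {0<..<pi})"
  proof (rule inj_onI)
    fix p r assume p: "p \<in> N \<times> {0<..<pi}" and r: "r \<in> N \<times> {0<..<pi}" and eq: "polar f p = polar f r"
    have "snd p = snd r"
      using p r eq cos_inj_pi[of "snd p" "snd r"] by (auto simp: polar_def mem_Times_iff)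
    moreover have "sin (snd p) > 0" using p sin_gt_zero by (auto simp: mem_Times_iff)
    ultimately have "f (fst p) = f (fst r)" using eq by (auto simp: polar_def)
    with f p r have "fst p = fst r" by (auto simp: bij_betw_def inj_on_def mem_Times_iff)
    with \<open>snd p = snd r\<close> show "p = r" by (simp add: prod_eq_iff)
  qed
next
  fix y assume "y \<in> polar f ` (N \<times> {0<..<pi})"
  then obtain x q where y: "y = polar f (x, q)" "x \<in> N" "0 < q" "q < pi" by auto
  have fx: "f x \<in> sphere 0 1 - A" using f y(2) by (auto simp: bij_betw_def)
  have "sin q > 0" using y sin_gt_zero by auto
  with fx A[of "sin q" "f x"] show "y \<in> sphere 0 1 - {y. fst y \<in> A}"
    by (simp add: y(1) polar_def norm_Pair)
next
  fix y assume y: "y \<in> sphere (0 :: 'b \<times> real) 1 - {y. fst y \<in> A}"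
  have sq: "(norm (fst y))\<^sup>2 = 1 - (snd y)\<^sup>2"
    using y norm_Pair[of "fst y" "snd y"] by simp
  have pos: "norm (fst y) > 0" using y assms(2) by auto
  have n: "norm (fst y) = sqrt (1 - (snd y)\<^sup>2)" using real_sqrt_unique[OF sq] by simp
  have "(snd y)\<^sup>2 < 1" using zero_less_power[OF pos, of 2] sq by linarith
  hence "\<bar>snd y\<bar> < 1" by (simp add: abs_square_less_1)
  hence s: "-1 < snd y" "snd y < 1" by (auto simp: abs_less_iff)
  define q where "q = arccos (snd y)"
  have q: "0 < q" "q < pi" "cos q = snd y" "sin q = norm (fst y)"
    using s n by (auto simp: q_def arccos_lt_bounded sin_arccos)
  have "(1 / norm (fst y)) *\<^sub>R fst y \<in> sphere 0 1 - A"
    using y pos A[of "1 / norm (fst y)" "fst y"] by auto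
  then obtain x where x: "x \<in> N" "f x = (1 / norm (fst y)) *\<^sub>R fst y"
    using f by (metis bij_betw_def imageE)
  have "y = polar f (x, q)"
    using pos by (simp add: polar_def q x prod_eq_iff)
  with x q show "y \<in> polar f ` (N \<times> {0<..<pi})" by auto
qed

text \<open>
  The position vector \<open>f x\<close> on the unit sphere is orthogonal to the image of the derivative of \<open>f\<close>, so
  the mixed terms vanish.
\<close>

lemma spherical_isometry_polar:
  assumes iso: "spherical_isometry N g f A" and A: "0 \<in> A" "\<And>c y. c > 0 \<Longrightarrow> c *\<^sub>R y \<in> A \<longleftrightarrow> y \<in> A"
  shows "spherical_isometry (N \<times> {0<..<pi}) (sine_cone_metric g) (polar f) {y. fst y \<in> A}"
proof -
  have el: "\<And>b. b \<in> Basis \<Longrightarrow> elementary UNIV (\<lambda>x. f x \<bullet> b)" and bij: "bij_betw f N (sphere 0 1 - A)"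
    and met: "\<And>x v w. x \<in> N \<Longrightarrow> v \<in> tangent_space N x \<Longrightarrow> w \<in> tangent_space N x \<Longrightarrow>
        frechet_derivative f (at x) v \<bullet> frechet_derivative f (at x) w = g x v w"
    using iso by (auto simp: spherical_isometry_def)
  show ?thesis
    unfolding spherical_isometry_def
  proof (intro conjI ballI polar_bij_betw[OF bij] A)
    fix b :: "'b \<times> real" assume "b \<in> Basis"
    moreover have "elementary UNIV (\<lambda>p. f (fst p) \<bullet> u)" if "u \<in> Basis" for u
      using elementary_compose_linear[OF el[OF that] bounded_linear_fst] by simp
    ultimately show "elementary UNIV (\<lambda>x. polar f x \<bullet> b)"
      by (auto simp: polar_def Basis_prod_def inner_prod_def intro!: elementary_intros
          elementary_linear[OF bounded_linear_snd])
  next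
    fix p v w assume p: "p \<in> N \<times> {0<..<pi}"
      and v: "v \<in> tangent_space (N \<times> {0<..<pi}) p" and w: "w \<in> tangent_space (N \<times> {0<..<pi}) p"
    define f' where "f' = frechet_derivative f (at (fst p))"
    have vw: "fst v \<in> tangent_space N (fst p)" "fst w \<in> tangent_space N (fst p)"
      using v w p by (subst (asm) (1 2) tangent_space_cone; auto simp: mem_Times_iff)+
    have f': "(f has_derivative f') (at (fst p))"
      using el elementary_vector_differentiable[of f] by (simp add: f'_def frechet_derivative_works[symmetric])
    have fx: "norm (f (fst p)) = 1" and img: "f ` N \<subseteq> sphere 0 1"
      using bij p by (auto simp: bij_betw_def mem_Times_iff)
    have orth: "f (fst p) \<bullet> f' a = 0" if "a \<in> tangent_space N (fst p)" for a
      using tangent_space_image[OF f' img that] tangent_space_sphere[OF fx] by auto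
    have "((\<lambda>p. f (fst p)) has_derivative (\<lambda>v. f' (fst v))) (at p)"
      using has_derivative_compose[OF bounded_linear_imp_has_derivative[OF bounded_linear_fst]] f' by blast
    moreover have snd: "(snd has_derivative snd) (at p)"
      by (rule bounded_linear_imp_has_derivative[OF bounded_linear_snd])
    ultimately have "(polar f has_derivative (\<lambda>v. (sin (snd p) *\<^sub>R f' (fst v) + (snd v * cos (snd p)) *\<^sub>R f (fst p),
        - (snd v * sin (snd p))))) (at p)"
      unfolding polar_def[abs_def] by (auto intro!: derivative_eq_intros simp: mult.commute)
    from frechet_derivative_at[OF this, symmetric]
    have "frechet_derivative (polar f) (at p) v \<bullet> frechet_derivative (polar f) (at p) w =
        (sin (snd p))\<^sup>2 * (f' (fst v) \<bullet> f' (fst w)) + ((cos (snd p))\<^sup>2 + (sin (snd p))\<^sup>2) * (snd v * snd w)"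
      using orth[OF vw(1)] orth[OF vw(2)] fx
      by (simp add: inner_prod_def inner_add_left inner_add_right inner_commute[of "f' _" "f (fst p)"] norm_eq_1
          power2_eq_square algebra_simps) (simp flip: distrib_left power2_eq_square)
    also have "\<dots> = sine_cone_metric g p v w"
      using met[OF _ vw] p by (auto simp: sine_cone_metric_def f'_def mem_Times_iff)
    finally show "frechet_derivative (polar f) (at p) v \<bullet> frechet_derivative (polar f) (at p) w = sine_cone_metric g p v w" .
  qed
qed

lemma spherical_isometry_S5: "spherical_isometry S5 g5 (\<lambda>x. x) {0}"
proof -
  have "S5 - {0} = S5" by auto
  thus ?thesis
    by (auto simp: spherical_isometry_def induced_metric_def frechet_derivative_bounded_linear[OF bounded_linear_ident]
        intro!: elementary_linear bounded_linear_inner_left simp: bij_betw_def)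
qed

lemma spherical_isometry_polar6: "spherical_isometry (S5 \<times> {0<..<pi}) g6 polar6 {y. fst y = 0}"
proof -
  have "polar6 = polar (\<lambda>x. x)" by (simp add: fun_eq_iff polar_def polar6_def split: prod.splits)
  with spherical_isometry_polar[OF spherical_isometry_S5] show ?thesis by (simp add: g6_def)
qed

lemma spherical_isometry_polar7:
  "spherical_isometry ((S5 \<times> {0<..<pi}) \<times> {0<..<pi}) g7 polar7 {y. fst (fst y) = 0}"
proof -
  have "polar7 = polar polar6" by (simp add: fun_eq_iff polar_def polar7_def split: prod.splits)
  with spherical_isometry_polar[OF spherical_isometry_polar6] show ?thesis by (simp add: g7_def)
qed


section \<open>Conical ends\<close>

lemma sin_squared_close:
  fixes \<epsilon> :: real
  assumes "\<epsilon> > 0"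
  obtains \<delta> where "\<delta> > 0" "\<And>r. 0 < r \<Longrightarrow> r < \<delta> \<Longrightarrow> \<bar>(sin r)\<^sup>2 - r\<^sup>2\<bar> \<le> \<epsilon> * (sin r)\<^sup>2"
proof -
  have "(sin has_field_derivative cos 0) (at (0::real))" by (rule DERIV_sin)
  hence "((\<lambda>r. sin r / r) \<longlongrightarrow> (1::real)) (at 0)" by (simp add: has_field_derivative_iff)
  hence "((\<lambda>r. (inverse (sin r / r))\<^sup>2) \<longlongrightarrow> (inverse (1::real))\<^sup>2) (at 0)"
    by (intro tendsto_power tendsto_inverse) auto
  hence "((\<lambda>r. (inverse (sin r / r))\<^sup>2) \<longlongrightarrow> (1::real)) (at 0)" by simp
  from LIM_D[OF this assms] obtain \<delta> where \<delta>: "\<delta> > 0"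
    "\<forall>r::real. r \<noteq> 0 \<and> norm (r - 0) < \<delta> \<longrightarrow> norm ((inverse (sin r / r))\<^sup>2 - 1) < \<epsilon>"
    by blast
  show thesis
  proof (rule that)
    show "min \<delta> pi > 0" using \<delta>(1) by simp
    fix r :: real assume r: "0 < r" "r < min \<delta> pi"
    hence pos: "sin r > 0" by (intro sin_gt_zero) auto
    have "\<bar>(sin r)\<^sup>2 - r\<^sup>2\<bar> = (sin r)\<^sup>2 * \<bar>(inverse (sin r / r))\<^sup>2 - 1\<bar>"
    proof -
      have "(sin r)\<^sup>2 * ((inverse (sin r / r))\<^sup>2 - 1) = r\<^sup>2 - (sin r)\<^sup>2"
        using pos by (simp add: field_simps power2_eq_square)
      hence "\<bar>(sin r)\<^sup>2 * ((inverse (sin r / r))\<^sup>2 - 1)\<bar> = \<bar>r\<^sup>2 - (sin r)\<^sup>2\<bar>" by simp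
      thus ?thesis by (simp add: abs_mult abs_minus_commute)
    qed
    also have "\<dots> \<le> (sin r)\<^sup>2 * \<epsilon>" using \<delta>(2)[rule_format, of r] r by (intro mult_left_mono) auto
    finally show "\<bar>(sin r)\<^sup>2 - r\<^sup>2\<bar> \<le> \<epsilon> * (sin r)\<^sup>2" by (simp add: mult.commute)
  qed
qed

text \<open>
  The distance \<open>u t\<close> to either end is \<open>t\<close> or \<open>\<pi> - t\<close>. Both have the same sine and a derivative of
  square \<open>1\<close>, which is all that the two ends have to share.
\<close>

context
  fixes u :: "real \<Rightarrow> real" and \<sigma> :: real and g :: "'a::euclidean_space metric" and N :: "'a set"
  assumes u: "\<And>t. (u has_real_derivative \<sigma>) (at t)" and \<sigma>: "\<sigma>\<^sup>2 = 1"
    and u_pos: "\<And>t. 0 < t \<Longrightarrow> t < pi \<Longrightarrow> 0 < u t" and sin_u: "\<And>t. sin (u t) = sin t"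
    and g_nonneg: "\<And>x v. 0 \<le> g x v v"
begin

lemma conical_end_sine_cone:
  "conical_end (N \<times> {0<..<pi}) (\<lambda>p. u (snd p)) (sine_cone_metric g) (\<lambda>p. u (snd p))
     (pullback_metric fst g) (\<lambda>_ _ _. 0)"
  unfolding conical_end_def
proof (intro conjI ballI allI impI)
  show "0 < u (snd p)" if "p \<in> N \<times> {0<..<pi}" for p
    using that u_pos by (auto simp: mem_Times_iff)
  fix \<epsilon> :: real assume \<epsilon>: "\<epsilon> > 0"
  obtain \<delta> where \<delta>: "\<delta> > 0" "\<And>r. 0 < r \<Longrightarrow> r < \<delta> \<Longrightarrow> \<bar>(sin r)\<^sup>2 - r\<^sup>2\<bar> \<le> \<epsilon> * (sin r)\<^sup>2"
    using sin_squared_close[OF \<epsilon>] by blast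
  have "\<bar>sine_cone_metric g p v v - ((frechet_derivative (\<lambda>p. u (snd p)) (at p) v)\<^sup>2
      + (u (snd p))\<^sup>2 * pullback_metric fst g p v v + 0)\<bar> \<le> \<epsilon> * sine_cone_metric g p v v"
    if p: "p \<in> N \<times> {0<..<pi}" and small: "u (snd p) < \<delta>" for p v
  proof -
    have "(u has_derivative (\<lambda>x. x * \<sigma>)) (at (snd p))" using u[of "snd p"] by (simp add: has_field_derivative_def mult_commute_abs)
    from has_derivative_compose[OF bounded_linear_imp_has_derivative[OF bounded_linear_snd] this]
    have "((\<lambda>p. u (snd p)) has_derivative (\<lambda>v. snd v * \<sigma>)) (at p)" .
    from frechet_derivative_at[OF this, symmetric]
    have D: "(frechet_derivative (\<lambda>p. u (snd p)) (at p) v)\<^sup>2 = (snd v)\<^sup>2"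
      using \<sigma> by (simp add: power_mult_distrib)
    define G where "G = g (fst p) (fst v) (fst v)"
    have G: "pullback_metric fst g p v v = G"
      by (simp add: pullback_metric_def G_def frechet_derivative_bounded_linear[OF bounded_linear_fst])
    have G0: "0 \<le> G" by (simp add: G_def g_nonneg)
    have "\<bar>(sin (u (snd p)))\<^sup>2 - (u (snd p))\<^sup>2\<bar> \<le> \<epsilon> * (sin (u (snd p)))\<^sup>2"
      using \<delta>(2)[of "u (snd p)"] small p u_pos by (auto simp: mem_Times_iff)
    hence "\<bar>(sin (snd p))\<^sup>2 - (u (snd p))\<^sup>2\<bar> * G \<le> \<epsilon> * (sin (snd p))\<^sup>2 * G"
      using G0 by (intro mult_right_mono) (simp_all add: sin_u)
    also have "\<dots> \<le> \<epsilon> * (snd v * snd v + (sin (snd p))\<^sup>2 * G)"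
      using \<epsilon> by (simp add: algebra_simps)
    finally have "\<bar>((sin (snd p))\<^sup>2 - (u (snd p))\<^sup>2) * G\<bar> \<le> \<epsilon> * (snd v * snd v + (sin (snd p))\<^sup>2 * G)"
      using G0 by (simp add: abs_mult)
    thus ?thesis
      by (simp add: sine_cone_metric_def D G G_def[symmetric] power2_eq_square[of "snd v"] algebra_simps)
  qed
  thus "\<exists>\<delta>>0. \<forall>p\<in>N \<times> {0<..<pi}. u (snd p) < \<delta> \<longrightarrow> u (snd p) < \<epsilon> \<and>
      (\<forall>v\<in>tangent_space (N \<times> {0<..<pi}) p.
        \<bar>sine_cone_metric g p v v - ((frechet_derivative (\<lambda>p. u (snd p)) (at p) v)\<^sup>2
      + (u (snd p))\<^sup>2 * pullback_metric fst g p v v + 0)\<bar> \<le> \<epsilon> * sine_cone_metric g p v v)"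
    using \<delta>(1) \<epsilon> by (intro exI[of _ "min \<delta> \<epsilon>"]) auto
qed

text \<open>
  Near \<open>t = 0\<close> or \<open>t = \<pi>\<close> with \<open>0 < q < \<pi>\<close> the distance to the singular set is
  \<open>u t * sin q\<close> to leading order. The derivative of this function has a mixed term in
  \<open>dt dq\<close>, which carries a factor \<open>u t * sin q\<close>; the arithmetic-geometric mean inequality bounds it
  by \<open>u t\<close> times the metric, uniformly in \<open>q\<close>.
\<close>

lemma conical_edge_sine_cone:
  "conical_end ((N \<times> {0<..<pi}) \<times> {0<..<pi}) (\<lambda>p. u (snd (fst p))) (sine_cone_metric (sine_cone_metric g))
     (\<lambda>p. u (snd (fst p)) * sin (snd p)) (pullback_metric (\<lambda>p. fst (fst p)) g) (\<lambda>_ v w. snd v * snd w)"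
  unfolding conical_end_def
proof (intro conjI ballI allI impI)
  let ?M = "(N \<times> {0<..<pi}) \<times> {0<..<pi}"
  show "0 < u (snd (fst p)) * sin (snd p)" if "p \<in> ?M" for p
    using that u_pos sin_gt_zero[of "snd p"] by (auto simp: mem_Times_iff)
  fix \<epsilon> :: real assume \<epsilon>: "\<epsilon> > 0"
  obtain \<delta> where \<delta>: "\<delta> > 0" "\<And>r. 0 < r \<Longrightarrow> r < \<delta> \<Longrightarrow> \<bar>(sin r)\<^sup>2 - r\<^sup>2\<bar> \<le> \<epsilon> * (sin r)\<^sup>2"
    using sin_squared_close[OF \<epsilon>] by blast
  let ?s = "\<lambda>p. u (snd (fst p)) * sin (snd p) :: real"
  have "?s p < \<epsilon> \<and> \<bar>sine_cone_metric (sine_cone_metric g) p v v - ((frechet_derivative ?s (at p) v)\<^sup>2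
      + (?s p)\<^sup>2 * pullback_metric (\<lambda>p. fst (fst p)) g p v v + snd v * snd v)\<bar>
      \<le> \<epsilon> * sine_cone_metric (sine_cone_metric g) p v v"
    if p: "p \<in> ?M" and small: "u (snd (fst p)) < min \<delta> (min 1 (\<epsilon> / 2))" for p v
  proof
    define r where "r = u (snd (fst p))"
    define s c where "s = sin (snd p)" and "c = cos (snd p)"
    define a b where "a = snd (fst v)" and "b = snd v"
    define G where "G = g (fst (fst p)) (fst (fst v)) (fst (fst v))"
    have r: "0 < r" "r < \<delta>" "r < 1" "2 * r < \<epsilon>"
      using p small u_pos by (auto simp: r_def mem_Times_iff)
    have s: "0 < s" using p sin_gt_zero by (auto simp: s_def mem_Times_iff)
    have "s \<le> 1" "\<bar>c\<bar> \<le> 1" by (simp_all add: s_def c_def)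
    have "r * s \<le> r * 1" using r \<open>s \<le> 1\<close> by (intro mult_left_mono) auto
    hence "r * s < \<epsilon>" using r by linarith
    thus "?s p < \<epsilon>" by (simp add: r_def s_def)
    have snd: "(snd has_derivative snd) (at p)" by (rule bounded_linear_imp_has_derivative[OF bounded_linear_snd])
    have sndfst: "((\<lambda>p. snd (fst p)) has_derivative (\<lambda>v. snd (fst v))) (at p)"
      by (intro bounded_linear_imp_has_derivative bounded_linear_compose[OF bounded_linear_snd bounded_linear_fst])
    have "(u has_derivative (\<lambda>x. x * \<sigma>)) (at (snd (fst p)))"
      using u[of "snd (fst p)"] by (simp add: has_field_derivative_def mult_commute_abs)
    from has_derivative_compose[OF sndfst this]
    have "(?s has_derivative (\<lambda>v. r * (snd v * c) + snd (fst v) * \<sigma> * s)) (at p)"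
      by (auto intro!: derivative_eq_intros snd simp: r_def s_def c_def)
    from frechet_derivative_at[OF this, symmetric]
    have D: "frechet_derivative ?s (at p) v = r * (b * c) + a * \<sigma> * s" by (simp add: a_def b_def)
    have "frechet_derivative (\<lambda>p. fst (fst p)) (at p) = (\<lambda>v :: ('a \<times> real) \<times> real. fst (fst v))"
      by (intro frechet_derivative_bounded_linear bounded_linear_compose[OF bounded_linear_fst bounded_linear_fst])
    hence G: "pullback_metric (\<lambda>p. fst (fst p)) g p v v = G" by (simp add: pullback_metric_def G_def)
    have G0: "0 \<le> G" by (simp add: G_def g_nonneg)
    define S where "S = (sin (snd (fst p)))\<^sup>2"
    have g: "sine_cone_metric (sine_cone_metric g) p v v = b\<^sup>2 + s\<^sup>2 * (a\<^sup>2 + S * G)"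
      by (simp add: sine_cone_metric_def a_def b_def s_def G_def S_def power2_eq_square)
    have "\<bar>S - r\<^sup>2\<bar> \<le> \<epsilon> * S"
      using \<delta>(2)[OF r(1,2)] by (simp add: S_def r_def sin_u)
    hence 1: "\<bar>s\<^sup>2 * G * (S - r\<^sup>2)\<bar> \<le> s\<^sup>2 * G * (\<epsilon> * S)"
      using G0 by (simp add: abs_mult mult_left_mono)
    have "\<bar>(b * c) * (a * \<sigma> * s)\<bar> \<le> \<bar>b\<bar> * \<bar>a * s\<bar>"
    proof -
      have "\<bar>\<sigma>\<bar> = 1" using \<sigma> by (auto simp: power2_eq_1_iff)
      hence "\<bar>(b * c) * (a * \<sigma> * s)\<bar> = \<bar>c\<bar> * (\<bar>b\<bar> * \<bar>a * s\<bar>)" by (simp add: abs_mult)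
      also have "\<dots> \<le> 1 * (\<bar>b\<bar> * \<bar>a * s\<bar>)" using \<open>\<bar>c\<bar> \<le> 1\<close> by (intro mult_right_mono) auto
      finally show ?thesis by simp
    qed
    moreover have "2 * (\<bar>b\<bar> * \<bar>a * s\<bar>) \<le> b\<^sup>2 + s\<^sup>2 * a\<^sup>2"
      using sum_squares_bound[of "\<bar>b\<bar>" "\<bar>a * s\<bar>"] by (simp add: power_mult_distrib ac_simps)
    ultimately have 2: "\<bar>2 * r * ((b * c) * (a * \<sigma> * s))\<bar> \<le> r * (b\<^sup>2 + s\<^sup>2 * a\<^sup>2)"
    proof -
      assume *: "\<bar>(b * c) * (a * \<sigma> * s)\<bar> \<le> \<bar>b\<bar> * \<bar>a * s\<bar>" "2 * (\<bar>b\<bar> * \<bar>a * s\<bar>) \<le> b\<^sup>2 + s\<^sup>2 * a\<^sup>2"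
      have "\<bar>2 * r * ((b * c) * (a * \<sigma> * s))\<bar> = r * (2 * \<bar>(b * c) * (a * \<sigma> * s)\<bar>)"
        using r by (simp add: abs_mult)
      also have "\<dots> \<le> r * (b\<^sup>2 + s\<^sup>2 * a\<^sup>2)" using * r by (intro mult_left_mono) auto
      finally show ?thesis .
    qed
    \<comment> \<open>The remaining contribution of \<open>dq\<close> to the square of the derivative.\<close>
    have 3: "\<bar>r\<^sup>2 * (b * c)\<^sup>2\<bar> \<le> r * b\<^sup>2"
    proof -
      have "c\<^sup>2 \<le> 1" using \<open>\<bar>c\<bar> \<le> 1\<close> by (simp add: abs_square_le_1)
      hence "r\<^sup>2 * (b * c)\<^sup>2 \<le> r\<^sup>2 * (b\<^sup>2 * 1)" unfolding power_mult_distrib by (intro mult_left_mono) auto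
      also have "\<dots> \<le> r * b\<^sup>2"
        using mult_right_mono[of "r * r" "r * 1" "b\<^sup>2"] mult_left_mono[of r 1 r] r by (simp add: power2_eq_square)
      finally show ?thesis by simp
    qed
    have "(r * (b * c) + a * \<sigma> * s)\<^sup>2 = r\<^sup>2 * (b * c)\<^sup>2 + 2 * r * ((b * c) * (a * \<sigma> * s)) + s\<^sup>2 * a\<^sup>2 * \<sigma>\<^sup>2"
      by (simp add: power2_eq_square algebra_simps)
    hence "\<bar>(b\<^sup>2 + s\<^sup>2 * (a\<^sup>2 + S * G)) - ((r * (b * c) + a * \<sigma> * s)\<^sup>2 + (r * s)\<^sup>2 * G + b * b)\<bar>
        = \<bar>s\<^sup>2 * G * (S - r\<^sup>2) - 2 * r * ((b * c) * (a * \<sigma> * s)) - r\<^sup>2 * (b * c)\<^sup>2\<bar>"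
      using \<sigma> by (intro arg_cong[where f = abs]) (simp add: power2_eq_square[of b] power_mult_distrib[of r s] algebra_simps)
    also have "\<dots> \<le> s\<^sup>2 * G * (\<epsilon> * S) + r * (b\<^sup>2 + s\<^sup>2 * a\<^sup>2) + r * b\<^sup>2"
      using 1 2 3 by linarith
    also have "\<dots> \<le> s\<^sup>2 * G * (\<epsilon> * S) + 2 * r * (b\<^sup>2 + s\<^sup>2 * a\<^sup>2)"
      using r by (simp add: algebra_simps)
    also have "\<dots> \<le> s\<^sup>2 * G * (\<epsilon> * S) + \<epsilon> * (b\<^sup>2 + s\<^sup>2 * a\<^sup>2)"
      using r by (intro add_left_mono mult_right_mono) auto
    also have "\<dots> = \<epsilon> * (b\<^sup>2 + s\<^sup>2 * (a\<^sup>2 + S * G))" by (simp add: algebra_simps)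
    finally show "\<bar>sine_cone_metric (sine_cone_metric g) p v v - ((frechet_derivative ?s (at p) v)\<^sup>2
      + (?s p)\<^sup>2 * pullback_metric (\<lambda>p. fst (fst p)) g p v v + snd v * snd v)\<bar>
      \<le> \<epsilon> * sine_cone_metric (sine_cone_metric g) p v v"
      unfolding g D G by (simp add: r_def s_def b_def)
  qed
  thus "\<exists>\<delta>>0. \<forall>p\<in>?M. u (snd (fst p)) < \<delta> \<longrightarrow> ?s p < \<epsilon> \<and> (\<forall>v\<in>tangent_space ?M p.
      \<bar>sine_cone_metric (sine_cone_metric g) p v v - ((frechet_derivative ?s (at p) v)\<^sup>2
      + (?s p)\<^sup>2 * pullback_metric (\<lambda>p. fst (fst p)) g p v v + snd v * snd v)\<bar>
      \<le> \<epsilon> * sine_cone_metric (sine_cone_metric g) p v v)"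
    using \<delta>(1) \<epsilon> by (intro exI[of _ "min \<delta> (min 1 (\<epsilon> / 2))"]) auto
qed

end

lemma g5_nonneg: "0 \<le> g5 x v v" and g6_nonneg: "0 \<le> g6 y w w"
  by (simp_all add: induced_metric_def g6_def sine_cone_metric_def)

lemma distance_to_ends:
  "((\<lambda>t. t) has_real_derivative 1) (at t)" "((\<lambda>t. pi - t) has_real_derivative - 1) (at t)"
  by (auto intro!: derivative_eq_intros)

theorem theorem6p1:
  shows
    "Sasaki_Einstein S5 eta omega1 omega2 omega3 g5 \<and>

     (let M = S5 \<times> {0<..<pi}; link = pullback_metric fst g5; none = (\<lambda>_ _ _. 0) in
        nearly_Kaehler M F6 Psip6 Psim6 g6 \<and>
        isometry_between M g6 polar6 (sphere 0 1 - {y. fst y = 0}) induced_metric \<and>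
        {p \<in> S5 \<times> {0..pi}. SU3_degenerate (S5 \<times> UNIV) F6 Psip6 Psim6 p} = S5 \<times> {0, pi} \<and>
        conical_end M (\<lambda>(x, t). t) g6 (\<lambda>(x, t). t) link none \<and>
        conical_end M (\<lambda>(x, t). pi - t) g6 (\<lambda>(x, t). pi - t) link none) \<and>

     (let M = (S5 \<times> {0<..<pi}) \<times> {0<..<pi};
          link5 = pullback_metric (\<lambda>p. fst (fst p)) g5; edge = (\<lambda>_ v w. snd v * snd w);
          link6 = pullback_metric fst g6; none = (\<lambda>_ _ _. 0) in
        nearly_parallel_G2 M phi7 g7 \<and>
        isometry_between M g7 polar7 (sphere 0 1 - {y. fst (fst y) = 0}) induced_metric \<and>
        {p \<in> (S5 \<times> {0..pi}) \<times> {0..pi}. G2_degenerate ((S5 \<times> UNIV) \<times> UNIV) phi7 p}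
          = {((x, t), q). x \<in> S5 \<and> t \<in> {0..pi} \<and> q \<in> {0..pi} \<and> (t \<in> {0, pi} \<or> q \<in> {0, pi})} \<and>
        conical_end M (\<lambda>((x, t), q). t) g7 (\<lambda>((x, t), q). t * sin q) link5 edge \<and>
        conical_end M (\<lambda>((x, t), q). pi - t) g7 (\<lambda>((x, t), q). (pi - t) * sin q) link5 edge \<and>
        conical_end M (\<lambda>((x, t), q). q) g7 (\<lambda>((x, t), q). q) link6 none \<and>
        conical_end M (\<lambda>((x, t), q). pi - q) g7 (\<lambda>((x, t), q). pi - q) link6 none)"
proof -
  note cone6 = conical_end_sine_cone[where g = g5, OF distance_to_ends(1) _ _ _ g5_nonneg]
    conical_end_sine_cone[where g = g5, OF distance_to_ends(2) _ _ _ g5_nonneg]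
  note cone7 = conical_end_sine_cone[where g = g6, OF distance_to_ends(1) _ _ _ g6_nonneg]
    conical_end_sine_cone[where g = g6, OF distance_to_ends(2) _ _ _ g6_nonneg]
  note edge = conical_edge_sine_cone[where g = g5, OF distance_to_ends(1) _ _ _ g5_nonneg]
    conical_edge_sine_cone[where g = g5, OF distance_to_ends(2) _ _ _ g5_nonneg]
  show ?thesis
    unfolding Let_def case_prod_unfold
    using Sasaki_Einstein_S5 nearly_Kaehler_cone SU3_degenerate_iff nearly_parallel_cone
      spherical_isometry_imp_isometry_between[OF spherical_isometry_polar6]
      spherical_isometry_imp_isometry_between[OF spherical_isometry_polar7]
      G2_degenerate_iff[unfolded case_prod_unfold]
      cone6[of S5, folded g6_def] cone7[of "S5 \<times> {0<..<pi}", folded g7_def] edge[of S5, folded g6_def, folded g7_def]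
    by (intro conjI) simp_all
qed

end
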